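(* Let $(M^{d+l},g;D,D^\perp)$, where $D=\bar J(TM)\cap TM$, be a CR-submanifold of an almost Hermitian manifold $(\bar M,\bar J,\bar g)$, where $D$ has rank $d$ and $D^\perp$ (of rank $l$) is the orthogonal complement of $D$ in $TM$. Then the following inequality holds: $$\mathrm{S}_{\mathrm{m}}(D,D^\perp)\le \frac14\,\|H_D\|^2+\bar\delta^+_{\mathrm{m}}(d,l).$$ The equality holds at a point $x\in M$ if and only if $M^{d+l}$ is mixed totally geodesic, $H_D(x)=H_{D^\perp}(x)$, and $\bar{\mathrm S}_{\mathrm{m}}(D(x),D^\perp(x))=\bar\delta^+_{\mathrm{m}}(d,l)(x)$.
   Context: An almost Hermitian manifold $(\bar M,\bar J,\bar g)$ is an even-dimensional Riemannian manifold $(\bar M,\bar g)$ with a skew-symmetric $(1,1)$-tensor $\bar J$ such that $\bar J^2X=-X$ and $\bar g(\bar JX,\bar JY)=\bar g(X,Y)$ for all $X,Y\in T\bar M$. A submanifold $M^{d+l}$ ($d,l>0$) of $\bar M$ with the induced metric $g$ is a CR-submanifold if $D=\bar J(TM)\cap TM$ (the maximal $\bar J$-invariant subbundle of $TM$) is a complex distribution of constant real dimension $d$. The mutual curvature of $(D,D^\perp)$ is the function on $M$ given by $\mathrm{S}_{\mathrm{m}}(D(x),D^\perp(x))=\sum_{1\le a\le d,\ d<b\le d+l}K(e_a,e_b)$, where $K$ is the sectional curvature of $(M,g)$ and $\{e_i\}$ is an orthonormal basis of $T_xM$ with $e_1,\ldots,e_d\in D(x)$ and $e_{d+1},\ldots,e_{d+l}\in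 D^\perp(x)$. For orthogonal subspaces $V_1,V_2\subset T_x\bar M$, $\bar{\mathrm S}_{\mathrm{m}}(V_1,V_2)=\sum_{a,b}\bar K(e_a,e_b)$, where $\bar K$ is the sectional curvature of $(\bar M,\bar g)$ and $\{e_a\}$, $\{e_b\}$ are orthonormal bases of $V_1$, $V_2$; $\bar\delta^+_{\mathrm{m}}(d,l)(x)=\max\bar{\mathrm S}_{\mathrm{m}}(V_1,V_2)$ over all pairs of mutually orthogonal subspaces of $T_x\bar M$ with $\dim V_1=d$, $\dim V_2=l$. $h:TM\times TM\to TM^\perp$ is the second fundamental form of $M$ in $\bar M$, where $TM^\perp$ is the normal bundle of $M$; for a subspace $V\subset T_xM$ with orthonormal basis $\{e_i\}$, the mean curvature vector is $H_V=\sum_i h(e_i,e_i)$ (no normalization), and $H_D(x)=H_{D(x)}$, $H_{D^\perp}(x)=H_{D^\perp(x)}$. Here mixed totally geodesic means mixed totally geodesic on $(D,D^\perp)$: $h(X,Y)=0$ for all $X\in D$, $Y\in D^\perp$.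
   Formalization: The bound uses the mean curvature vector of all of TM, H_D + H_{D^⊥}, instead of H_D: as printed the inequality fails for the unit 3-sphere in flat C^2 (2 ≤ 1). "Mixed totally geodesic" is taken at the point x. *)

theory Defs
  imports "HOL-Analysis.Analysis" "HOL-Library.Function_Algebras"
begin

instantiation "fun" :: (type, real_vector) real_vector
begin

definition scaleR_fun :: "real \<Rightarrow> ('a \<Rightarrow> 'b) \<Rightarrow> 'a \<Rightarrow> 'b"
  where "scaleR_fun r f = (\<lambda>x. r *\<^sub>R f x)"

instance
  by standard (simp_all add: scaleR_fun_def fun_eq_iff scaleR_add_right scaleR_add_left)

end

abbreviation dderiv :: "('e::real_normed_vector \<Rightarrow> 'f::real_normed_vector) \<Rightarrow> 'e \<Rightarrow> 'e \<Rightarrow> 'f"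
  where "dderiv f x v \<equiv> frechet_derivative f (at x) v"

text \<open>Only meant for open sets \<open>S\<close>.\<close>

primrec Ck_on :: "nat \<Rightarrow> 'e set \<Rightarrow> ('e::real_normed_vector \<Rightarrow> 'f::real_normed_vector) \<Rightarrow> bool" where
  "Ck_on 0 S f = continuous_on S f"
| "Ck_on (Suc k) S f =
     ((\<forall>x\<in>S. f differentiable (at x)) \<and> (\<forall>v. Ck_on k S (\<lambda>x. dderiv f x v)))"

definition smooth_on :: "'e set \<Rightarrow> ('e::real_normed_vector \<Rightarrow> 'f::real_normed_vector) \<Rightarrow> bool"
  where "smooth_on S f \<longleftrightarrow> (\<forall>k. Ck_on k S f)"


section \<open>Smooth manifolds and tangent vectors\<close>

text \<open>A chart is a pair of its domain and its coordinate map; the values of the map outside the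
  domain are irrelevant. A smooth manifold of dimension \<open>DIM('e)\<close> is given by an atlas; its points
  are those covered by the atlas, an open subset of the Hausdorff second countable space \<open>'a\<close>.\<close>

type_synonym ('a, 'e) chart = "'a set \<times> ('a \<Rightarrow> 'e)"

abbreviation cdom :: "('a, 'e) chart \<Rightarrow> 'a set" where "cdom c \<equiv> fst c"
abbreviation cmap :: "('a, 'e) chart \<Rightarrow> 'a \<Rightarrow> 'e" where "cmap c \<equiv> snd c"
definition cran :: "('a, 'e) chart \<Rightarrow> 'e set" where "cran c = cmap c ` cdom c"
definition cinv :: "('a, 'e) chart \<Rightarrow> 'e \<Rightarrow> 'a" where "cinv c = inv_into (cdom c) (cmap c)"

definition smooth_atlas ::
  "('a::{t2_space,second_countable_topology}, 'e::euclidean_space) chart set \<Rightarrow> bool" where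
  "smooth_atlas A \<longleftrightarrow>
     (\<forall>c\<in>A. open (cdom c) \<and> open (cran c) \<and> homeomorphism (cdom c) (cran c) (cmap c) (cinv c)) \<and>
     (\<forall>c\<in>A. \<forall>c'\<in>A. smooth_on (cmap c ` (cdom c \<inter> cdom c')) (cmap c' \<circ> cinv c))"

definition manifold_carrier :: "('a, 'e) chart set \<Rightarrow> 'a set"
  where "manifold_carrier A = (\<Union>c\<in>A. cdom c)"

text \<open>Intrinsic objects below that are given by a coordinate formula are evaluated in this chart
  around \<open>p\<close>; by the usual transformation laws the result is the same in every chart around \<open>p\<close>.\<close>

definition chart_at :: "('a, 'e) chart set \<Rightarrow> 'a \<Rightarrow> ('a, 'e) chart"
  where "chart_at A p = (SOME c. c \<in> A \<and> p \<in> cdom c)"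

text \<open>A tangent vector at \<open>p\<close> is the family of its components in all charts around \<open>p\<close>; these
  components are related by the differentials of the coordinate changes. The value is 0
  on all other charts, so that equality of tangent vectors is equality of functions.\<close>

type_synonym ('a, 'e) tvec = "('a, 'e) chart \<Rightarrow> 'e"

definition chart_change ::
  "('a, 'e::euclidean_space) chart \<Rightarrow> ('a, 'e) chart \<Rightarrow> 'a \<Rightarrow> 'e \<Rightarrow> 'e" where
  "chart_change c c' p u = dderiv (cmap c' \<circ> cinv c) (cmap c p) u"

definition tangent_space ::
  "('a, 'e::euclidean_space) chart set \<Rightarrow> 'a \<Rightarrow> ('a, 'e) tvec set" where
  "tangent_space A p =
     {v. (\<forall>c\<in>A. \<forall>c'\<in>A. p \<in> cdom c \<inter> cdom c' \<longrightarrow> v c' = chart_change c c' p (v c)) \<and>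
         (\<forall>c. \<not> (c \<in> A \<and> p \<in> cdom c) \<longrightarrow> v c = 0)}"

text \<open>The tangent vector at \<open>p\<close> whose component in the chart \<open>c\<close> is \<open>u\<close>.\<close>

definition tvec_of ::
  "('a, 'e::euclidean_space) chart set \<Rightarrow> ('a, 'e) chart \<Rightarrow> 'a \<Rightarrow> 'e \<Rightarrow> ('a, 'e) tvec" where
  "tvec_of A c p u = (\<lambda>c'. if c' \<in> A \<and> p \<in> cdom c' then chart_change c c' p u else 0)"


section \<open>Riemannian metrics and sectional curvature\<close>

type_synonym ('a, 'e) metric = "'a \<Rightarrow> ('a, 'e) tvec \<Rightarrow> ('a, 'e) tvec \<Rightarrow> real"

text \<open>\<open>g(u, w)\<close> at the point with coordinates \<open>y\<close> in \<open>c\<close>, for coordinate vectors \<open>u\<close> and \<open>w\<close>.\<close>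

definition metric_coord ::
  "('a, 'e::euclidean_space) chart set \<Rightarrow> ('a, 'e) metric \<Rightarrow> ('a, 'e) chart \<Rightarrow> 'e \<Rightarrow> 'e \<Rightarrow> 'e \<Rightarrow> real"
  where "metric_coord A g c y u w =
    g (cinv c y) (tvec_of A c (cinv c y) u) (tvec_of A c (cinv c y) w)"

definition riemannian_metric ::
  "('a, 'e::euclidean_space) chart set \<Rightarrow> ('a, 'e) metric \<Rightarrow> bool" where
  "riemannian_metric A g \<longleftrightarrow>
     (\<forall>p\<in>manifold_carrier A. \<forall>u\<in>tangent_space A p. \<forall>v\<in>tangent_space A p.
        g p u v = g p v u \<and>
        (\<forall>w\<in>tangent_space A p. g p (u + v) w = g p u w + g p v w) \<and>
        (\<forall>r. g p (r *\<^sub>R u) v = r * g p u v) \<and>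
        (u \<noteq> 0 \<longrightarrow> g p u u > 0)) \<and>
     (\<forall>c\<in>A. \<forall>u w. smooth_on (cran c) (\<lambda>y. metric_coord A g c y u w))"

text \<open>The Levi-Civita connection in coordinates: \<open>christoffel A g c y u w\<close> is
  \<open>\<nabla>\<^sub>u w\<close> for the coordinate-constant vector fields \<open>u\<close> and \<open>w\<close>, determined by Koszul's formula
  (their brackets vanish).\<close>

definition christoffel ::
  "('a, 'e::euclidean_space) chart set \<Rightarrow> ('a, 'e) metric \<Rightarrow> ('a, 'e) chart \<Rightarrow> 'e \<Rightarrow> 'e \<Rightarrow> 'e \<Rightarrow> 'e" where
  "christoffel A g c y u w = (THE x. \<forall>z.
     metric_coord A g c y x z =
       (dderiv (\<lambda>y'. metric_coord A g c y' w z) y u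
        + dderiv (\<lambda>y'. metric_coord A g c y' u z) y w
        - dderiv (\<lambda>y'. metric_coord A g c y' u w) y z) / 2)"

text \<open>\<open>R(u, v) w = \<nabla>\<^sub>u \<nabla>\<^sub>v w - \<nabla>\<^sub>v \<nabla>\<^sub>u w\<close> for coordinate-constant vector fields.\<close>

definition curvature_coord ::
  "('a, 'e::euclidean_space) chart set \<Rightarrow> ('a, 'e) metric \<Rightarrow> ('a, 'e) chart \<Rightarrow> 'e \<Rightarrow> 'e \<Rightarrow> 'e \<Rightarrow> 'e \<Rightarrow> 'e" where
  "curvature_coord A g c y u v w =
     dderiv (\<lambda>y'. christoffel A g c y' v w) y u + christoffel A g c y u (christoffel A g c y v w)
     - (dderiv (\<lambda>y'. christoffel A g c y' u w) y v + christoffel A g c y v (christoffel A g c y u w))"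

definition riemann_curvature ::
  "('a, 'e::euclidean_space) chart set \<Rightarrow> ('a, 'e) metric \<Rightarrow> 'a
     \<Rightarrow> ('a, 'e) tvec \<Rightarrow> ('a, 'e) tvec \<Rightarrow> ('a, 'e) tvec \<Rightarrow> ('a, 'e) tvec" where
  "riemann_curvature A g p u v w =
     (let c = chart_at A p
      in tvec_of A c p (curvature_coord A g c (cmap c p) (u c) (v c) (w c)))"

definition sectional_curvature ::
  "('a, 'e::euclidean_space) chart set \<Rightarrow> ('a, 'e) metric \<Rightarrow> 'a
     \<Rightarrow> ('a, 'e) tvec \<Rightarrow> ('a, 'e) tvec \<Rightarrow> real" where
  "sectional_curvature A g p u v =
     g p (riemann_curvature A g p u v v) u / (g p u u * g p v v - (g p u v)\<^sup>2)"

definition is_onb :: "('a, 'e::euclidean_space) metric \<Rightarrow> 'a \<Rightarrow> ('a, 'e) tvec set \<Rightarrow> ('a, 'e) tvec set \<Rightarrow> bool"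
  where "is_onb g p V E \<longleftrightarrow>
    finite E \<and> E \<subseteq> V \<and> span E = V \<and> (\<forall>u\<in>E. \<forall>v\<in>E. g p u v = (if u = v then 1 else 0))"

text \<open>The sums over \<open>onb\<close> below do not depend on the choice of the orthonormal basis.\<close>

definition onb :: "('a, 'e::euclidean_space) metric \<Rightarrow> 'a \<Rightarrow> ('a, 'e) tvec set \<Rightarrow> ('a, 'e) tvec set"
  where "onb g p V = (SOME E. is_onb g p V E)"

definition mutual_curvature ::
  "('a, 'e::euclidean_space) chart set \<Rightarrow> ('a, 'e) metric \<Rightarrow> 'a
     \<Rightarrow> ('a, 'e) tvec set \<Rightarrow> ('a, 'e) tvec set \<Rightarrow> real" where
  "mutual_curvature A g p V W =
     (\<Sum>u\<in>onb g p V. \<Sum>v\<in>onb g p W. sectional_curvature A g p u v)"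

definition max_mutual_curvature ::
  "('a, 'e::euclidean_space) chart set \<Rightarrow> ('a, 'e) metric \<Rightarrow> nat \<Rightarrow> nat \<Rightarrow> 'a \<Rightarrow> real" where
  "max_mutual_curvature A g d l p = (GREATEST s. \<exists>V W.
     subspace V \<and> V \<subseteq> tangent_space A p \<and> dim V = d \<and>
     subspace W \<and> W \<subseteq> tangent_space A p \<and> dim W = l \<and>
     (\<forall>v\<in>V. \<forall>w\<in>W. g p v w = 0) \<and>
     s = mutual_curvature A g p V W)"


section \<open>Almost Hermitian manifolds\<close>

definition almost_hermitian ::
  "('b::{t2_space,second_countable_topology}, 'f::euclidean_space) chart set
     \<Rightarrow> ('b \<Rightarrow> ('b, 'f) tvec \<Rightarrow> ('b, 'f) tvec) \<Rightarrow> ('b, 'f) metric \<Rightarrow> bool" where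
  "almost_hermitian B J g \<longleftrightarrow>
     smooth_atlas B \<and> even DIM('f) \<and> riemannian_metric B g \<and>
     (\<forall>q\<in>manifold_carrier B. \<forall>u\<in>tangent_space B q. \<forall>v\<in>tangent_space B q.
        J q u \<in> tangent_space B q \<and>
        J q (u + v) = J q u + J q v \<and>
        (\<forall>r. J q (r *\<^sub>R u) = r *\<^sub>R J q u) \<and>
        J q (J q u) = - u \<and>
        g q (J q u) v = - g q u (J q v) \<and>
        g q (J q u) (J q v) = g q u v) \<and>
     (\<forall>c\<in>B. \<forall>u. smooth_on (cran c) (\<lambda>y. J (cinv c y) (tvec_of B c (cinv c y) u) c))"


section \<open>Submanifolds\<close>

text \<open>Submanifolds are immersed: \<open>f\<close> maps the manifold \<open>M\<close> with atlas \<open>A\<close> to the ambient manifold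
  with atlas \<open>B\<close>. The tangent space of \<open>M\<close> at \<open>p\<close>, as a subspace of the ambient
  tangent space at \<open>f p\<close>, is the image of \<open>differential A B f p\<close>. Embedded submanifolds are the case of
  the inclusion map.\<close>

definition local_rep :: "('a, 'e) chart \<Rightarrow> ('b, 'f) chart \<Rightarrow> ('a \<Rightarrow> 'b) \<Rightarrow> 'e \<Rightarrow> 'f"
  where "local_rep c c' f = cmap c' \<circ> f \<circ> cinv c"

definition differential ::
  "('a, 'e::euclidean_space) chart set \<Rightarrow> ('b, 'f::euclidean_space) chart set \<Rightarrow> ('a \<Rightarrow> 'b) \<Rightarrow> 'a
     \<Rightarrow> ('a, 'e) tvec \<Rightarrow> ('b, 'f) tvec" where
  "differential A B f p v =
     (let c = chart_at A p; c' = chart_at B (f p)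
      in tvec_of B c' (f p) (dderiv (local_rep c c' f) (cmap c p) (v c)))"

definition immersion ::
  "('a::{t2_space,second_countable_topology}, 'e::euclidean_space) chart set
     \<Rightarrow> ('b::{t2_space,second_countable_topology}, 'f::euclidean_space) chart set
     \<Rightarrow> ('a \<Rightarrow> 'b) \<Rightarrow> bool" where
  "immersion A B f \<longleftrightarrow>
     continuous_on (manifold_carrier A) f \<and>
     f ` manifold_carrier A \<subseteq> manifold_carrier B \<and>
     (\<forall>c\<in>A. \<forall>c'\<in>B. smooth_on (cmap c ` (cdom c \<inter> f -` cdom c')) (local_rep c c' f)) \<and>
     (\<forall>p\<in>manifold_carrier A. inj_on (differential A B f p) (tangent_space A p))"

definition induced_metric ::
  "('a, 'e::euclidean_space) chart set \<Rightarrow> ('b, 'f::euclidean_space) chart set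
     \<Rightarrow> ('b, 'f) metric \<Rightarrow> ('a \<Rightarrow> 'b) \<Rightarrow> ('a, 'e) metric" where
  "induced_metric A B gb f p u v = gb (f p) (differential A B f p u) (differential A B f p v)"

definition normal_part ::
  "('a, 'e::euclidean_space) chart set \<Rightarrow> ('b, 'f::euclidean_space) chart set
     \<Rightarrow> ('b, 'f) metric \<Rightarrow> ('a \<Rightarrow> 'b) \<Rightarrow> 'a \<Rightarrow> ('b, 'f) tvec \<Rightarrow> ('b, 'f) tvec" where
  "normal_part A B gb f p w = (THE n. n \<in> tangent_space B (f p) \<and>
     (\<forall>u\<in>tangent_space A p. gb (f p) n (differential A B f p u) = 0) \<and>
     (\<exists>t\<in>tangent_space A p. w = differential A B f p t + n))"

text \<open>\<open>h(u, v)\<close> is the normal part of the ambient covariant derivative in the direction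
  \<open>df u\<close> of \<open>df V\<close>, where \<open>V\<close> extends \<open>v\<close> as a coordinate-constant vector field on \<open>M\<close>.\<close>

definition second_fundamental_form ::
  "('a, 'e::euclidean_space) chart set \<Rightarrow> ('b, 'f::euclidean_space) chart set
     \<Rightarrow> ('b, 'f) metric \<Rightarrow> ('a \<Rightarrow> 'b) \<Rightarrow> 'a
     \<Rightarrow> ('a, 'e) tvec \<Rightarrow> ('a, 'e) tvec \<Rightarrow> ('b, 'f) tvec" where
  "second_fundamental_form A B gb f p u v =
     (let c = chart_at A p; c' = chart_at B (f p); F = local_rep c c' f; y = cmap c p
      in normal_part A B gb f p (tvec_of B c' (f p)
           (dderiv (\<lambda>y'. dderiv F y' (v c)) y (u c)
            + christoffel B gb c' (F y) (dderiv F y (u c)) (dderiv F y (v c)))))"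

text \<open>Unnormalized: \<open>H\<^sub>V\<close> is the trace of \<open>h\<close> over \<open>V\<close>. For \<open>TM = D \<oplus> D'\<close>, the mixed term of the Gauss
  equation is bounded by \<open>\<langle>H\<^sub>D, H\<^sub>D\<^sub>'\<rangle> \<le> \<parallel>H\<^sub>D + H\<^sub>D\<^sub>'\<parallel>\<^sup>2 / 4\<close>, where \<open>H\<^sub>D + H\<^sub>D\<^sub>'\<close> is the mean curvature of the whole
  tangent space. It is not bounded by \<open>\<parallel>H\<^sub>D\<parallel>\<^sup>2 / 4\<close>: the unit sphere of real dimension 3 in
  flat complex 2-space has mutual curvature 2 and \<open>\<parallel>H\<^sub>D\<parallel>\<^sup>2 / 4 = 1\<close>.\<close>

definition mean_curvature ::
  "('a, 'e::euclidean_space) chart set \<Rightarrow> ('b, 'f::euclidean_space) chart set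
     \<Rightarrow> ('b, 'f) metric \<Rightarrow> ('a \<Rightarrow> 'b) \<Rightarrow> 'a \<Rightarrow> ('a, 'e) tvec set \<Rightarrow> ('b, 'f) tvec" where
  "mean_curvature A B gb f p V =
     (\<Sum>e\<in>onb (induced_metric A B gb f) p V. second_fundamental_form A B gb f p e e)"


section \<open>CR-submanifolds\<close>

text \<open>The distribution \<open>D = J(TM) \<inter> TM\<close>, pulled back to the tangent spaces of \<open>M\<close>.\<close>

definition cr_distribution ::
  "('a, 'e::euclidean_space) chart set \<Rightarrow> ('b, 'f::euclidean_space) chart set
     \<Rightarrow> ('b \<Rightarrow> ('b, 'f) tvec \<Rightarrow> ('b, 'f) tvec) \<Rightarrow> ('a \<Rightarrow> 'b) \<Rightarrow> 'a \<Rightarrow> ('a, 'e) tvec set" where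
  "cr_distribution A B J f p =
     {v \<in> tangent_space A p.
        differential A B f p v \<in> J (f p) ` differential A B f p ` tangent_space A p}"

definition orth_complement ::
  "('a, 'e::euclidean_space) chart set \<Rightarrow> ('a, 'e) metric \<Rightarrow> 'a \<Rightarrow> ('a, 'e) tvec set \<Rightarrow> ('a, 'e) tvec set"
  where "orth_complement A g p V = {v \<in> tangent_space A p. \<forall>u\<in>V. g p u v = 0}"

definition CR_submanifold ::
  "('a::{t2_space,second_countable_topology}, 'e::euclidean_space) chart set
     \<Rightarrow> ('b::{t2_space,second_countable_topology}, 'f::euclidean_space) chart set
     \<Rightarrow> ('b \<Rightarrow> ('b, 'f) tvec \<Rightarrow> ('b, 'f) tvec) \<Rightarrow> ('a \<Rightarrow> 'b) \<Rightarrow> nat \<Rightarrow> nat \<Rightarrow> bool" where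
  "CR_submanifold A B J f d l \<longleftrightarrow>
     smooth_atlas A \<and> DIM('e) = d + l \<and> d > 0 \<and> l > 0 \<and> immersion A B f \<and>
     (\<forall>p\<in>manifold_carrier A. dim (cr_distribution A B J f p) = d)"

definition mixed_totally_geodesic_at ::
  "('a, 'e::euclidean_space) chart set \<Rightarrow> ('b, 'f::euclidean_space) chart set
     \<Rightarrow> ('b, 'f) metric \<Rightarrow> ('a \<Rightarrow> 'b) \<Rightarrow> 'a \<Rightarrow> ('a, 'e) tvec set \<Rightarrow> ('a, 'e) tvec set \<Rightarrow> bool" where
  "mixed_totally_geodesic_at A B gb f p V W \<longleftrightarrow>
     (\<forall>u\<in>V. \<forall>v\<in>W. second_fundamental_form A B gb f p u v = 0)"

end

theory Submission
  imports Defs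
begin

text \<open>In the charts that define the curvatures at a point, differentiating
  \<open>g(\<nabla>\<^sub>v w, z) = \<langle>\<nabla>\<^sub>v dF w, dF z\<rangle>\<close> along \<open>u\<close> and antisymmetrizing in \<open>u\<close> and \<open>v\<close> yields the Gauss
  equation. Summing it over orthonormal bases of \<open>D\<close> and its complement \<open>D'\<close> gives
  \<open>S = S' + \<langle>H\<^sub>D, H\<^sub>D\<^sub>'\<rangle> - \<Sum>|h(e\<^sub>a, e\<^sub>b)|\<^sup>2\<close>, where \<open>S'\<close> is the ambient mutual curvature of the two spaces,
  and by polarization \<open>\<langle>H\<^sub>D, H\<^sub>D\<^sub>'\<rangle> = |H|\<^sup>2/4 - |H\<^sub>D - H\<^sub>D\<^sub>'|\<^sup>2/4\<close> for \<open>H = H\<^sub>D + H\<^sub>D\<^sub>'\<close>. The maximum of the ambient mutual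
  curvature is attained because pairs of mutually orthogonal orthonormal families form a compact set.\<close>

section \<open>Orthonormal bases and traces\<close>

text \<open>\<open>christoffel\<close>, \<open>normal_part\<close> and
  \<open>max_mutual_curvature\<close> are given by descriptions and \<open>onb\<close> by a choice,
  so each needs an existence proof before it can be computed with. The connection needs more, since
  curvature differentiates it in the base point. For the ambient metric this follows from two
  derivatives of the metric; but the induced metric is a pullback by \<open>differential\<close>,
  which is read in charts that may change from point to point. Hence \<open>differential\<close>
  must be computable in one fixed pair of charts, and the induced connection is differentiated
  through its relation to the ambient one. The curvatures and the second fundamental form at a point
  all use the same pair of charts, so the Gauss equation is needed only there. Tangent vectors are
  functions on charts, a type without norm or inner product. Orthonormal bases are therefore built
  for a form that is constrained only on a subspace, and the compactness argument runs in coordinate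
  space, where a pair of families is encoded as a linear map.\<close>

definition bilinear_on :: "'v::real_vector set \<Rightarrow> ('v \<Rightarrow> 'v \<Rightarrow> 'w::real_vector) \<Rightarrow> bool" where
  "bilinear_on T b \<longleftrightarrow> (\<forall>u\<in>T. \<forall>v\<in>T.
     (\<forall>w\<in>T. b (u + w) v = b u v + b w v \<and> b v (u + w) = b v u + b v w) \<and>
     (\<forall>r. b (r *\<^sub>R u) v = r *\<^sub>R b u v \<and> b v (r *\<^sub>R u) = r *\<^sub>R b v u))"

context
  fixes T :: "'v::real_vector set" and b :: "'v \<Rightarrow> 'v \<Rightarrow> 'w::real_vector"
  assumes sub: "subspace T" and bil: "bilinear_on T b"
begin

lemma bilinear_on_zero: "u \<in> T \<Longrightarrow> b 0 u = 0" "u \<in> T \<Longrightarrow> b u 0 = 0"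
  using bil sub unfolding bilinear_on_def
  by (metis add_cancel_right_left subspace_0)+

lemma bilinear_on_diff:
  assumes "u \<in> T" "v \<in> T" "w \<in> T"
  shows "b (u - v) w = b u w - b v w" "b w (u - v) = b w u - b w v"
proof -
  have "u - v = u + (-1) *\<^sub>R v" "(-1) *\<^sub>R v \<in> T"
    using sub assms subspace_scale by (simp, blast)
  then show "b (u - v) w = b u w - b v w" "b w (u - v) = b w u - b w v"
    using bil assms unfolding bilinear_on_def
    by (metis scaleR_minus1_left uminus_add_conv_diff)+
qed

lemma bilinear_on_sum:
  assumes "finite I" "\<And>i. i \<in> I \<Longrightarrow> x i \<in> T" "w \<in> T"
  shows "b (\<Sum>i\<in>I. c i *\<^sub>R x i) w = (\<Sum>i\<in>I. c i *\<^sub>R b (x i) w)"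
    and "b w (\<Sum>i\<in>I. c i *\<^sub>R x i) = (\<Sum>i\<in>I. c i *\<^sub>R b w (x i))"
proof -
  \<comment> \<open>Membership of the partial sum in \<open>T\<close> is carried along because
    \<open>b\<close> is additive only on \<open>T\<close>.\<close>
  have "b (\<Sum>i\<in>I. c i *\<^sub>R x i) w = (\<Sum>i\<in>I. c i *\<^sub>R b (x i) w) \<and>
        b w (\<Sum>i\<in>I. c i *\<^sub>R x i) = (\<Sum>i\<in>I. c i *\<^sub>R b w (x i)) \<and> (\<Sum>i\<in>I. c i *\<^sub>R x i) \<in> T"
    using assms(1,2)
  proof (induction I rule: finite_induct)
    case empty
    show ?case using bilinear_on_zero[OF assms(3)] sub by (simp add: subspace_0)
  next
    case (insert i I)
    have 1: "c i *\<^sub>R x i \<in> T" using insert sub by (simp add: subspace_scale)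
    have 2: "(\<Sum>i\<in>I. c i *\<^sub>R x i) \<in> T" using insert by blast
    have "b (c i *\<^sub>R x i + (\<Sum>i\<in>I. c i *\<^sub>R x i)) w = c i *\<^sub>R b (x i) w + b (\<Sum>i\<in>I. c i *\<^sub>R x i) w"
      "b w (c i *\<^sub>R x i + (\<Sum>i\<in>I. c i *\<^sub>R x i)) = c i *\<^sub>R b w (x i) + b w (\<Sum>i\<in>I. c i *\<^sub>R x i)"
      using bil 1 2 assms(3) insert.prems unfolding bilinear_on_def by (metis insertI1)+
    moreover have "c i *\<^sub>R x i + (\<Sum>i\<in>I. c i *\<^sub>R x i) \<in> T"
      using subspace_add[OF sub 1 2] .
    ultimately show ?case using insert.IH insert.prems insert.hyps by simp
  qed
  then show "b (\<Sum>i\<in>I. c i *\<^sub>R x i) w = (\<Sum>i\<in>I. c i *\<^sub>R b (x i) w)"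
    and "b w (\<Sum>i\<in>I. c i *\<^sub>R x i) = (\<Sum>i\<in>I. c i *\<^sub>R b w (x i))" by auto
qed

end

definition orthonormal_basis :: "('v::real_vector \<Rightarrow> 'v \<Rightarrow> real) \<Rightarrow> 'v set \<Rightarrow> 'v set \<Rightarrow> bool" where
  "orthonormal_basis ip V E \<longleftrightarrow>
     finite E \<and> E \<subseteq> V \<and> span E = V \<and> (\<forall>u\<in>E. \<forall>v\<in>E. ip u v = (if u = v then 1 else 0))"

text \<open>A metric at a point is constrained only on tangent vectors, so the axioms are relative
  to a subspace \<open>T\<close>. Finite dimension is expressed by a finite spanning set, since it
  concerns \<open>T\<close> and not the whole type of families over charts.\<close>

locale inner_product_on =
  fixes T :: "'v::real_vector set" and ip :: "'v \<Rightarrow> 'v \<Rightarrow> real"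
  assumes subspace_T: "subspace T"
    and finite_dim: "\<exists>S. finite S \<and> T \<subseteq> span S"
    and bilinear: "bilinear_on T ip"
    and commute: "u \<in> T \<Longrightarrow> v \<in> T \<Longrightarrow> ip u v = ip v u"
    and pos: "u \<in> T \<Longrightarrow> u \<noteq> 0 \<Longrightarrow> ip u u > 0"
begin

lemmas diff = bilinear_on_diff[OF subspace_T bilinear]
lemmas sum = bilinear_on_sum[OF subspace_T bilinear]
lemmas zero = bilinear_on_zero[OF subspace_T bilinear]

lemma add:
  assumes "u \<in> T" "v \<in> T" "w \<in> T"
  shows "ip (u + v) w = ip u w + ip v w" "ip w (u + v) = ip w u + ip w v"
  using assms bilinear unfolding bilinear_on_def by metis+

lemma scale:
  assumes "u \<in> T" "v \<in> T"
  shows "ip (r *\<^sub>R u) v = r * ip u v" "ip v (r *\<^sub>R u) = r * ip v u"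
  using assms bilinear unfolding bilinear_on_def by (metis real_scaleR_def)+

lemma eq_0_iff: "u \<in> T \<Longrightarrow> ip u u = 0 \<longleftrightarrow> u = 0"
  using pos[of u] zero by fastforce

lemma nonneg: "u \<in> T \<Longrightarrow> ip u u \<ge> 0"
  using pos[of u] zero by fastforce

lemma onb_expansion:
  assumes E: "orthonormal_basis ip V E" and V: "V \<subseteq> T" and v: "v \<in> V"
  shows "v = (\<Sum>e\<in>E. ip v e *\<^sub>R e)"
proof -
  have fin: "finite E" and ET: "E \<subseteq> T"
    and on: "\<And>u v. u \<in> E \<Longrightarrow> v \<in> E \<Longrightarrow> ip u v = (if u = v then 1 else 0)"
    using E V by (auto simp: orthonormal_basis_def)
  have "v \<in> span E" using E v by (simp add: orthonormal_basis_def)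
  then obtain c where c: "v = (\<Sum>e\<in>E. c e *\<^sub>R e)"
    using span_finite[OF fin] by auto
  have "ip v e = c e" if "e \<in> E" for e
  proof -
    have "ip v e = (\<Sum>e'\<in>E. c e' *\<^sub>R ip e' e)"
      unfolding c using ET that fin by (intro sum(1)) auto
    also have "\<dots> = (\<Sum>e'\<in>E. if e' = e then c e' else 0)"
      by (rule sum.cong) (auto simp: on that)
    finally show ?thesis using fin that by simp
  qed
  then show ?thesis using c by auto
qed

lemma onb_independent:
  assumes E: "orthonormal_basis ip V E" and V: "V \<subseteq> T"
  shows "independent E" "card E = dim V"
proof -
  have fin: "finite E" and ET: "E \<subseteq> T"
    and on: "\<And>u v. u \<in> E \<Longrightarrow> v \<in> E \<Longrightarrow> ip u v = (if u = v then 1 else 0)"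
    using E V by (auto simp: orthonormal_basis_def)
  show "independent E"
  proof (rule independent_if_scalars_zero[OF fin])
    fix c e assume c: "(\<Sum>e\<in>E. c e *\<^sub>R e) = 0" and e: "e \<in> E"
    have "ip (\<Sum>e\<in>E. c e *\<^sub>R e) e = (\<Sum>e'\<in>E. c e' *\<^sub>R ip e' e)"
      using ET e fin by (intro sum(1)) auto
    also have "\<dots> = (\<Sum>e'\<in>E. if e' = e then c e' else 0)"
      by (rule sum.cong) (auto simp: on e)
    finally show "c e = 0" using fin e c zero ET by auto
  qed
  then show "card E = dim V" using E dim_eq_card[of E V] unfolding orthonormal_basis_def by (metis span_span)
qed

text \<open>Induction on the generators: the part of a new generator orthogonal to the basis so far
  is either zero, and the generator is dropped, or it is normalized and added. The generators may
  thus be dependent.\<close>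

lemma gram_schmidt:
  assumes "finite S" "S \<subseteq> T"
  shows "\<exists>E. orthonormal_basis ip (span S) E"
  using assms
proof (induction S rule: finite_induct)
  case empty
  show ?case by (rule exI[of _ "{}"]) (simp add: orthonormal_basis_def)
next
  case (insert a S)
  then obtain E where E: "orthonormal_basis ip (span S) E" by auto
  have ST: "span S \<subseteq> T" using insert.prems subspace_T by (simp add: span_minimal)
  have fin: "finite E" and ES: "E \<subseteq> span S" "span E = span S"
    and on: "\<And>u v. u \<in> E \<Longrightarrow> v \<in> E \<Longrightarrow> ip u v = (if u = v then 1 else 0)"
    using E by (auto simp: orthonormal_basis_def)
  have ET: "E \<subseteq> T" using ES ST by auto
  define p where "p = (\<Sum>e\<in>E. ip a e *\<^sub>R e)"
  have pS: "p \<in> span S" unfolding p_def using ES by (intro span_sum span_scale) auto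
  have aT: "a \<in> T" "p \<in> T" using insert.prems pS ST by auto
  have orth: "ip (a - p) e = 0" if "e \<in> E" for e
  proof -
    have "ip p e = (\<Sum>e'\<in>E. ip a e' *\<^sub>R ip e' e)"
      unfolding p_def using ET that fin by (intro sum(1)) auto
    also have "\<dots> = (\<Sum>e'\<in>E. if e' = e then ip a e' else 0)"
      by (rule sum.cong) (auto simp: on that)
    finally show ?thesis using fin that aT ET by (auto simp: diff)
  qed
  have dT: "a - p \<in> T" using aT subspace_T by (simp add: subspace_diff)
  show ?case
  proof (cases "a = p")
    case True
    then have "span (insert a S) = span S" using pS by (simp add: span_redundant)
    then show ?thesis using E by auto
  next
    case False
    define n where "n = (1 / sqrt (ip (a - p) (a - p))) *\<^sub>R (a - p)"
    have pos': "ip (a - p) (a - p) > 0" using pos dT False by simp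
    have nT: "n \<in> T" unfolding n_def using dT subspace_T by (simp add: subspace_scale)
    have nn: "ip n n = 1" using pos' unfolding n_def
      by (simp add: scale dT subspace_scale[OF subspace_T] real_sqrt_mult[symmetric] divide_simps)
    have ne: "ip n e = 0" "ip e n = 0" if "e \<in> E" for e
    proof -
      show "ip n e = 0" using orth[OF that] that ET unfolding n_def
        by (subst scale(1)) (auto simp: dT)
      then show "ip e n = 0" using commute[of e n] nT that ET by auto
    qed
    have nE: "n \<notin> E" using ne(1)[of n] nn by auto
    have "span (insert n E) = span (insert a S)"
    proof (rule span_eq[THEN iffD2], intro conjI)
      have "n \<in> span (insert a S)" unfolding n_def
        using pS span_mono[of S "insert a S"] by (intro span_scale span_diff) (auto simp: span_base)
      then show "insert n E \<subseteq> span (insert a S)"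
        using ES span_mono[of S "insert a S"] by auto
      have "a = sqrt (ip (a - p) (a - p)) *\<^sub>R n + p" using pos' unfolding n_def by simp
      moreover have "p \<in> span (insert n E)" using pS ES span_mono[of E "insert n E"] by auto
      ultimately have "a \<in> span (insert n E)"
        by (metis insertI1 span_add span_base span_scale)
      then show "insert a S \<subseteq> span (insert n E)"
        using ES span_mono[of E "insert n E"] span_superset[of S] by auto
    qed
    moreover have "insert n E \<subseteq> span (insert n E)" by (rule span_superset)
    ultimately have "orthonormal_basis ip (span (insert a S)) (insert n E)"
      using fin on nn ne nE unfolding orthonormal_basis_def by auto
    then show ?thesis by blast
  qed
qed

text \<open>A basis of \<open>V\<close> is independent inside the span of a finite set, hence
  finite, and can be orthonormalized.\<close>

lemma onb_exists:
  assumes V: "subspace V" "V \<subseteq> T"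
  shows "\<exists>E. orthonormal_basis ip V E"
proof -
  obtain S where S: "finite S" "T \<subseteq> span S" using finite_dim by auto
  obtain C where C: "C \<subseteq> V" "independent C" "V \<subseteq> span C"
    by (rule basis_exists[of V])
  have "C \<subseteq> span S" using C(1) V(2) S(2) by blast
  then have "finite C" using independent_span_bound[OF S(1) C(2)] by blast
  moreover have "span C = V" using C V by (simp add: span_subspace)
  moreover have "C \<subseteq> T" using C(1) V(2) by blast
  ultimately show ?thesis using gram_schmidt[of C] by simp
qed

text \<open>Each \<open>e\<close> is expanded in \<open>E'\<close> in both arguments. The
  coefficient of \<open>b p q\<close> becomes the sum over \<open>e\<close> of
  \<open>ip e p * ip e q\<close>, which by the expansion of \<open>p\<close> in \<open>E\<close> is
  \<open>ip p q\<close>, that is 0 or 1. This makes the choice inside \<open>onb\<close> harmless;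
  \<open>b\<close> is vector-valued so that the mean curvature is covered along with curvature
  sums.\<close>

lemma trace_independent:
  assumes E: "orthonormal_basis ip V E" and E': "orthonormal_basis ip V E'" and V: "V \<subseteq> T"
    and b: "bilinear_on V b"
  shows "(\<Sum>e\<in>E. b e e) = (\<Sum>e\<in>E'. b e e)"
proof -
  have fin: "finite E" "finite E'" and EV: "E \<subseteq> V" "E' \<subseteq> V" and sub: "subspace V"
    using E E' unfolding orthonormal_basis_def by (auto intro: subspace_span)
  have on: "\<And>u v. u \<in> E' \<Longrightarrow> v \<in> E' \<Longrightarrow> ip u v = (if u = v then 1 else 0)"
    using E' by (auto simp: orthonormal_basis_def)
  have b1: "b e e = (\<Sum>p\<in>E'. \<Sum>q\<in>E'. (ip e p * ip e q) *\<^sub>R b p q)" if e: "e \<in> E" for e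
  proof -
    have ex: "e = (\<Sum>p\<in>E'. ip e p *\<^sub>R p)" using onb_expansion[OF E' V] e EV by auto
    have "b e e = b (\<Sum>p\<in>E'. ip e p *\<^sub>R p) e" using ex by simp
    also have "\<dots> = (\<Sum>p\<in>E'. ip e p *\<^sub>R b p e)"
      using e EV fin by (intro bilinear_on_sum[OF sub b]) auto
    also have "\<dots> = (\<Sum>p\<in>E'. ip e p *\<^sub>R b p (\<Sum>q\<in>E'. ip e q *\<^sub>R q))" using ex by simp
    also have "\<dots> = (\<Sum>p\<in>E'. ip e p *\<^sub>R (\<Sum>q\<in>E'. ip e q *\<^sub>R b p q))"
      using e EV fin by (intro sum.cong refl arg_cong2[of _ _ _ _ scaleR] bilinear_on_sum[OF sub b]) auto
    finally show ?thesis by (simp add: scaleR_sum_right)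
  qed
  have "(\<Sum>e\<in>E. b e e) = (\<Sum>e\<in>E. \<Sum>p\<in>E'. \<Sum>q\<in>E'. (ip e p * ip e q) *\<^sub>R b p q)"
    using b1 by simp
  also have "\<dots> = (\<Sum>p\<in>E'. \<Sum>e\<in>E. \<Sum>q\<in>E'. (ip e p * ip e q) *\<^sub>R b p q)" by (rule sum.swap)
  also have "\<dots> = (\<Sum>p\<in>E'. \<Sum>q\<in>E'. \<Sum>e\<in>E. (ip e p * ip e q) *\<^sub>R b p q)"
    by (rule sum.cong[OF refl], rule sum.swap)
  also have "\<dots> = (\<Sum>p\<in>E'. \<Sum>q\<in>E'. if p = q then b p q else 0)"
  proof (intro sum.cong refl)
    fix p q assume p: "p \<in> E'" and q: "q \<in> E'"
    have T: "p \<in> T" "q \<in> T" "\<And>e. e \<in> E \<Longrightarrow> e \<in> T" using p q EV V by auto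
    have "ip p q = ip (\<Sum>e\<in>E. ip p e *\<^sub>R e) q" using onb_expansion[OF E V] p EV by auto
    also have "\<dots> = (\<Sum>e\<in>E. ip p e *\<^sub>R ip e q)" using T fin by (intro sum) auto
    also have "\<dots> = (\<Sum>e\<in>E. ip e p * ip e q)" using T commute by (intro sum.cong) auto
    finally have "(\<Sum>e\<in>E. ip e p * ip e q) = (if p = q then 1 else 0)"
      using on[OF p q] by simp
    then show "(\<Sum>e\<in>E. (ip e p * ip e q) *\<^sub>R b p q) = (if p = q then b p q else 0)"
      unfolding scaleR_sum_left[symmetric] by simp
  qed
  also have "\<dots> = (\<Sum>p\<in>E'. b p p)" using fin by simp
  finally show ?thesis .
qed

lemma subspace_complement: "V \<subseteq> T \<Longrightarrow> subspace {v \<in> T. \<forall>u\<in>V. ip u v = 0}"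
  using subspace_T by (auto simp: subspace_def add scale zero subset_iff)

text \<open>Subtracting from \<open>t\<close> its projection to \<open>V\<close> leaves a vector
  orthogonal to \<open>V\<close>, which \<open>E'\<close> spans. Both the splitting of the mean
  curvature and the dimension count for a subspace and its complement come from this.\<close>

lemma onb_union:
  assumes E: "orthonormal_basis ip V E" and V: "V \<subseteq> T"
    and E': "orthonormal_basis ip {v \<in> T. \<forall>u\<in>V. ip u v = 0} E'"
  shows "orthonormal_basis ip T (E \<union> E')" "E \<inter> E' = {}"
proof -
  have sub: "subspace V" using E unfolding orthonormal_basis_def by auto
  have fin: "finite E" "finite E'" and EV: "E \<subseteq> V" "E' \<subseteq> T"
    and on: "\<And>u v. u \<in> E \<Longrightarrow> v \<in> E \<Longrightarrow> ip u v = (if u = v then 1 else 0)"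
      "\<And>u v. u \<in> E' \<Longrightarrow> v \<in> E' \<Longrightarrow> ip u v = (if u = v then 1 else 0)"
      "\<And>u v. u \<in> E \<Longrightarrow> v \<in> E' \<Longrightarrow> ip u v = 0"
    using E E' unfolding orthonormal_basis_def by auto
  have on': "ip v u = 0" if "u \<in> E" "v \<in> E'" for u v
    using on(3)[OF that] that EV V commute[of u v] by auto
  show dis: "E \<inter> E' = {}" using on(1) on(3) by fastforce
  have "T \<subseteq> span (E \<union> E')"
  proof
    fix t assume t: "t \<in> T"
    define p where "p = (\<Sum>e\<in>E. ip t e *\<^sub>R e)"
    have pE: "p \<in> span E" unfolding p_def by (intro span_sum span_scale) (auto simp: span_base)
    then have pV: "p \<in> V" using E by (auto simp: orthonormal_basis_def)
    have pT: "p \<in> T" using pV V by auto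
    have orth: "ip (t - p) e = 0" if "e \<in> E" for e
    proof -
      have "ip p e = (\<Sum>e'\<in>E. ip t e' *\<^sub>R ip e' e)"
        unfolding p_def using EV V that fin by (intro sum(1)) auto
      also have "\<dots> = (\<Sum>e'\<in>E. if e' = e then ip t e' else 0)"
        by (rule sum.cong) (auto simp: on that)
      finally show ?thesis using fin that t pT EV V by (subst diff) auto
    qed
    have dT: "t - p \<in> T" using t pT subspace_T by (simp add: subspace_diff)
    have "ip u (t - p) = 0" if u: "u \<in> V" for u
    proof -
      have "ip u (t - p) = ip (\<Sum>e\<in>E. ip u e *\<^sub>R e) (t - p)"
        using onb_expansion[OF E V u] by simp
      also have "\<dots> = (\<Sum>e\<in>E. ip u e *\<^sub>R ip e (t - p))"
        using EV V fin dT by (intro sum(1)) auto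
      also have "\<dots> = 0"
      proof (rule sum.neutral, rule)
        fix e assume e: "e \<in> E"
        then have "e \<in> T" using EV V by auto
        then show "ip u e *\<^sub>R ip e (t - p) = 0" using orth[OF e] commute[OF dT] by simp
      qed
      finally show ?thesis .
    qed
    then have "t - p \<in> span E'" using dT E' by (auto simp: orthonormal_basis_def)
    then have "t - p + p \<in> span (E \<union> E')"
      using pE span_mono[of E "E \<union> E'"] span_mono[of E' "E \<union> E'"] by (intro span_add) auto
    then show "t \<in> span (E \<union> E')" by simp
  qed
  moreover have "span (E \<union> E') \<subseteq> T" using EV V subspace_T by (intro span_minimal) auto
  ultimately show "orthonormal_basis ip T (E \<union> E')"
    using fin EV V on on' dis unfolding orthonormal_basis_def by auto
qed

end

text \<open>If two members of \<open>E\<close> had the same image, their product would be that of a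
  vector with itself, namely 1; so a map that preserves the form is injective on
  \<open>E\<close>.\<close>

lemma orthonormal_basis_image:
  assumes "orthonormal_basis ip V E" "linear \<phi>" "\<And>u v. u \<in> V \<Longrightarrow> v \<in> V \<Longrightarrow> ip' (\<phi> u) (\<phi> v) = ip u v"
  shows "orthonormal_basis ip' (\<phi> ` V) (\<phi> ` E)" "inj_on \<phi> E"
proof -
  have fin: "finite E" and EV: "E \<subseteq> V" "span E = V"
    and on: "\<And>u v. u \<in> E \<Longrightarrow> v \<in> E \<Longrightarrow> ip u v = (if u = v then 1 else 0)"
    using assms(1) by (auto simp: orthonormal_basis_def)
  have on': "ip' (\<phi> u) (\<phi> v) = (if u = v then 1 else 0)" if "u \<in> E" "v \<in> E" for u v
    using that assms(3)[of u v] on[of u v] subsetD[OF EV(1), of u] subsetD[OF EV(1), of v] by simp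
  show inj: "inj_on \<phi> E" 
  proof (rule inj_onI)
    fix u v assume "u \<in> E" "v \<in> E" "\<phi> u = \<phi> v"
    then show "u = v" using on'[of u u] on'[of u v] by (auto split: if_splits)
  qed
  have "span (\<phi> ` E) = \<phi> ` V" using linear_span_image[OF assms(2), of E] EV by simp
  then show "orthonormal_basis ip' (\<phi> ` V) (\<phi> ` E)"
    using fin EV(1) on' inj unfolding orthonormal_basis_def by (auto simp: inj_on_eq_iff simp del: span_eq_iff)
qed


section \<open>Calculus\<close>

lemma smooth_on_differentiable: "smooth_on S f \<Longrightarrow> x \<in> S \<Longrightarrow> f differentiable (at x)"
  unfolding smooth_on_def by (metis Ck_on.simps(2))

lemma smooth_on_dderiv: "smooth_on S f \<Longrightarrow> smooth_on S (\<lambda>x. dderiv f x v)"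
  unfolding smooth_on_def by (metis Ck_on.simps(2))

lemma smooth_on_continuous: "smooth_on S f \<Longrightarrow> continuous_on S f"
  unfolding smooth_on_def by (metis Ck_on.simps(1))

lemma has_derivative_dderiv: "f differentiable (at x) \<Longrightarrow> (f has_derivative dderiv f x) (at x)"
  by (simp add: frechet_derivative_works)

lemma dderiv_eq: "(f has_derivative f') (at x) \<Longrightarrow> dderiv f x = f'"
  using frechet_derivative_at by metis

lemma isCont_nhds: "isCont f x \<longleftrightarrow> (f \<longlongrightarrow> f x) (nhds x)"
  unfolding isCont_def by (rule tendsto_at_iff_tendsto_nhds)

section \<open>Symmetry of second derivatives\<close>

lemma second_difference:
  fixes f :: "'e::real_normed_vector \<Rightarrow> real"
  assumes S: "ball x r \<subseteq> S" and s: "0 < s" "s * (norm u + norm v) < r"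
    and d: "\<And>y. y \<in> S \<Longrightarrow> f differentiable (at y)"
    and du: "\<And>y. y \<in> S \<Longrightarrow> (\<lambda>y. dderiv f y u) differentiable (at y)"
  shows "\<exists>y\<in>ball x r. f (x + s *\<^sub>R u + s *\<^sub>R v) - f (x + s *\<^sub>R u) - f (x + s *\<^sub>R v) + f x
           = s * s * dderiv (\<lambda>y. dderiv f y u) y v"
proof -
  have inb: "x + \<sigma> *\<^sub>R u + \<tau> *\<^sub>R v \<in> ball x r" if "0 \<le> \<sigma>" "\<sigma> \<le> s" "0 \<le> \<tau>" "\<tau> \<le> s" for \<sigma> \<tau>
  proof -
    have "norm (\<sigma> *\<^sub>R u + \<tau> *\<^sub>R v) \<le> \<sigma> * norm u + \<tau> * norm v"
      using norm_triangle_ineq[of "\<sigma> *\<^sub>R u" "\<tau> *\<^sub>R v"] that by simp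
    also have "\<dots> \<le> s * norm u + s * norm v"
      using that by (intro add_mono mult_right_mono) auto
    also have "\<dots> < r" using s(2) by (simp add: distrib_left)
    finally have "norm (\<sigma> *\<^sub>R u + \<tau> *\<^sub>R v) < r" .
    moreover have "x - (x + \<sigma> *\<^sub>R u + \<tau> *\<^sub>R v) = - (\<sigma> *\<^sub>R u + \<tau> *\<^sub>R v)" by simp
    ultimately show ?thesis unfolding mem_ball dist_norm by (simp only: norm_minus_cancel)
  qed
  have line: "((\<lambda>\<sigma>. F (a + \<sigma> *\<^sub>R w)) has_real_derivative dderiv F (a + \<sigma> *\<^sub>R w) w) (at \<sigma>)"
    if "F differentiable (at (a + \<sigma> *\<^sub>R w))" for F :: "'e \<Rightarrow> real" and a w \<sigma>
  proof -
    have l: "linear (dderiv F (a + \<sigma> *\<^sub>R w))" using that linear_frechet_derivative by blast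
    have "((\<lambda>\<sigma>. a + \<sigma> *\<^sub>R w) has_derivative (\<lambda>h. h *\<^sub>R w)) (at \<sigma>)"
      by (auto intro!: derivative_eq_intros)
    from diff_chain_at[OF this] has_derivative_dderiv[OF that]
    have "((\<lambda>\<sigma>. F (a + \<sigma> *\<^sub>R w)) has_derivative (\<lambda>h. dderiv F (a + \<sigma> *\<^sub>R w) (h *\<^sub>R w))) (at \<sigma>)"
      by (simp add: o_def)
    moreover have "(\<lambda>h. dderiv F (a + \<sigma> *\<^sub>R w) (h *\<^sub>R w)) = (*) (dderiv F (a + \<sigma> *\<^sub>R w) w)"
      by (auto simp: linear_scale[OF l] mult.commute)
    ultimately show ?thesis by (simp add: has_field_derivative_def)
  qed
  \<comment> \<open>The increment in direction \<open>v\<close> as a function of the displacement in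
    direction \<open>u\<close>. The mean value theorem is applied to it, and then once more, in
    direction \<open>v\<close>, to the derivative that it produces.\<close>
  define \<phi> where "\<phi> \<sigma> = f (x + s *\<^sub>R v + \<sigma> *\<^sub>R u) - f (x + \<sigma> *\<^sub>R u)" for \<sigma>
  have "DERIV \<phi> \<sigma> :> dderiv f (x + s *\<^sub>R v + \<sigma> *\<^sub>R u) u - dderiv f (x + \<sigma> *\<^sub>R u) u"
    if "0 \<le> \<sigma>" "\<sigma> \<le> s" for \<sigma>
    unfolding \<phi>_def
    using inb[of \<sigma> s] inb[of \<sigma> 0] that S s
    by (intro DERIV_diff line d) (auto simp: algebra_simps)
  from MVT2[OF s(1) this] obtain \<sigma> where \<sigma>: "0 < \<sigma>" "\<sigma> < s"
    "\<phi> s - \<phi> 0 = s * (dderiv f (x + s *\<^sub>R v + \<sigma> *\<^sub>R u) u - dderiv f (x + \<sigma> *\<^sub>R u) u)" by auto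
  have "DERIV (\<lambda>\<tau>. dderiv f (x + \<sigma> *\<^sub>R u + \<tau> *\<^sub>R v) u) \<tau> :>
      dderiv (\<lambda>y. dderiv f y u) (x + \<sigma> *\<^sub>R u + \<tau> *\<^sub>R v) v" if "0 \<le> \<tau>" "\<tau> \<le> s" for \<tau>
    using inb[of \<sigma> \<tau>] that \<sigma> S by (intro line[of "\<lambda>y. dderiv f y u"] du) auto
  from MVT2[OF s(1) this] obtain \<tau> where \<tau>: "0 < \<tau>" "\<tau> < s"
    "dderiv f (x + \<sigma> *\<^sub>R u + s *\<^sub>R v) u - dderiv f (x + \<sigma> *\<^sub>R u + 0 *\<^sub>R v) u
       = s * dderiv (\<lambda>y. dderiv f y u) (x + \<sigma> *\<^sub>R u + \<tau> *\<^sub>R v) v" by auto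
  have "f (x + s *\<^sub>R u + s *\<^sub>R v) - f (x + s *\<^sub>R u) - f (x + s *\<^sub>R v) + f x
           = s * s * dderiv (\<lambda>y. dderiv f y u) (x + \<sigma> *\<^sub>R u + \<tau> *\<^sub>R v) v"
    using \<sigma>(3) \<tau>(3) unfolding \<phi>_def by (simp add: algebra_simps)
  then show ?thesis using inb[of \<sigma> \<tau>] \<sigma> \<tau> by force
qed

text \<open>The second difference is symmetric in \<open>u\<close> and \<open>v\<close>, so
  evaluating it in both orders gives equal values of the two mixed derivatives at two points near
  \<open>x\<close>. If they differed at \<open>x\<close>, continuity would keep them apart on a
  small ball.\<close>

lemma dderiv_commute_real:
  fixes f :: "'e::real_normed_vector \<Rightarrow> real"
  assumes S: "open S" "x \<in> S"
    and d: "\<And>y. y \<in> S \<Longrightarrow> f differentiable (at y)"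
    and du: "\<And>y w. y \<in> S \<Longrightarrow> (\<lambda>y. dderiv f y w) differentiable (at y)"
    and cont: "\<And>u v. continuous_on S (\<lambda>y. dderiv (\<lambda>y. dderiv f y u) y v)"
  shows "dderiv (\<lambda>y. dderiv f y u) x v = dderiv (\<lambda>y. dderiv f y v) x u"
proof (rule ccontr)
  define P where "P u v y = dderiv (\<lambda>y. dderiv f y u) y v" for u v y
  assume "dderiv (\<lambda>y. dderiv f y u) x v \<noteq> dderiv (\<lambda>y. dderiv f y v) x u"
  then have ne: "P u v x \<noteq> P v u x" by (simp add: P_def)
  \<comment> \<open>Half the gap, so that the intervals of radius \<open>e\<close> around the two
    values are disjoint.\<close>
  define e where "e = \<bar>P u v x - P v u x\<bar> / 2"
  have e: "e > 0" using ne by (simp add: e_def)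
  have "isCont (P u v) x" "isCont (P v u) x"
    using cont S unfolding P_def by (simp_all add: continuous_on_eq_continuous_at)
  then obtain d1 d2 where d1: "d1 > 0" "\<And>y. dist y x < d1 \<Longrightarrow> dist (P u v y) (P u v x) < e"
    and d2: "d2 > 0" "\<And>y. dist y x < d2 \<Longrightarrow> dist (P v u y) (P v u x) < e"
    using e unfolding continuous_at_eps_delta by (metis dist_commute)
  obtain d3 where d3: "d3 > 0" "ball x d3 \<subseteq> S" using S by (meson open_contains_ball)
  define r where "r = min d1 (min d2 d3)"
  have r: "r > 0" "ball x r \<subseteq> S" using d1 d2 d3 by (auto simp: r_def)
  \<comment> \<open>The summand 1 keeps the denominator positive when \<open>u\<close> and
    \<open>v\<close> both vanish; the parallelogram scaled by \<open>s\<close> then stays in the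
    ball of radius \<open>r\<close>.\<close>
  define s where "s = r / (2 * (norm u + norm v + 1))"
  have n: "norm u + norm v + 1 > 0" using norm_ge_zero[of u] norm_ge_zero[of v] by linarith
  then have s: "s > 0" using r by (simp add: s_def)
  have "s * (norm u + norm v + 1) = r / 2" using n by (simp add: s_def field_simps)
  then have sr: "s * (norm u + norm v) < r" "s * (norm v + norm u) < r"
    using s r by (simp_all add: algebra_simps)
  obtain y1 where y1: "y1 \<in> ball x r" "f (x + s *\<^sub>R u + s *\<^sub>R v) - f (x + s *\<^sub>R u) - f (x + s *\<^sub>R v) + f x
           = s * s * P u v y1"
    using second_difference[OF r(2) s sr(1) d du] unfolding P_def by blast
  obtain y2 where y2: "y2 \<in> ball x r" "f (x + s *\<^sub>R v + s *\<^sub>R u) - f (x + s *\<^sub>R v) - f (x + s *\<^sub>R u) + f x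
           = s * s * P v u y2"
    using second_difference[OF r(2) s sr(2) d du] unfolding P_def by blast
  have "s * s * P u v y1 = s * s * P v u y2" using y1(2) y2(2) by (simp add: algebra_simps)
  then have "P u v y1 = P v u y2" using s by simp
  moreover have "\<bar>P u v y1 - P u v x\<bar> < e" "\<bar>P v u y2 - P v u x\<bar> < e"
    using d1(2)[of y1] d2(2)[of y2] y1 y2 by (auto simp: r_def dist_real_def dist_commute)
  ultimately show False unfolding e_def by (auto simp: abs_if field_simps split: if_splits)
qed

text \<open>Reduction to components, because the mean value argument is for real functions: the
  derivative of a component is the component of the derivative.\<close>

lemma dderiv_commute:
  fixes f :: "'e::real_normed_vector \<Rightarrow> 'f::euclidean_space"
  assumes S: "open S" "x \<in> S" and f: "smooth_on S f"
  shows "dderiv (\<lambda>y. dderiv f y u) x v = dderiv (\<lambda>y. dderiv f y v) x u"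
proof (rule euclidean_eqI)
  fix b :: 'f
  have inner: "((\<lambda>y. F y \<bullet> b) has_derivative (\<lambda>h. dderiv F y h \<bullet> b)) (at y)"
    if "smooth_on S F" "y \<in> S" for F :: "'e \<Rightarrow> 'f" and y
    using has_derivative_dderiv[OF smooth_on_differentiable[OF that]]
    by (rule has_derivative_inner_left)
  have 1: "dderiv (\<lambda>y. f y \<bullet> b) y w = dderiv f y w \<bullet> b" if "y \<in> S" for y w
    using dderiv_eq[OF inner[OF f that]] by simp
  have 2: "((\<lambda>y. dderiv (\<lambda>y. f y \<bullet> b) y w) has_derivative (\<lambda>h. dderiv (\<lambda>y. dderiv f y w) y h \<bullet> b)) (at y)"
    if "y \<in> S" for y w
    by (rule has_derivative_transform_within_open[OF inner[OF smooth_on_dderiv[OF f] that] S(1) that])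
      (simp add: 1)
  have 3: "dderiv (\<lambda>y. dderiv (\<lambda>y. f y \<bullet> b) y w) y z = dderiv (\<lambda>y. dderiv f y w) y z \<bullet> b" if "y \<in> S" for y w z
    using dderiv_eq[OF 2[OF that]] by simp
  have "continuous_on S (\<lambda>y. dderiv (\<lambda>y. dderiv f y w) y z \<bullet> b)" for w z
    by (intro continuous_intros smooth_on_continuous smooth_on_dderiv f)
  then have "continuous_on S (\<lambda>y. dderiv (\<lambda>y. dderiv (\<lambda>y. f y \<bullet> b) y w) y z)" for w z
    by (subst continuous_on_cong[OF refl 3]) auto
  then have "dderiv (\<lambda>y. dderiv (\<lambda>y. f y \<bullet> b) y u) x v = dderiv (\<lambda>y. dderiv (\<lambda>y. f y \<bullet> b) y v) x u"
    by (intro dderiv_commute_real[OF S] differentiableI[OF inner[OF f]] differentiableI[OF 2])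
  then show "dderiv (\<lambda>y. dderiv f y u) x v \<bullet> b = dderiv (\<lambda>y. dderiv f y v) x u \<bullet> b"
    by (simp add: 3 S)
qed

section \<open>Product rule for fields of bilinear maps\<close>

lemma bilinear_expansion:
  fixes b :: "'a::euclidean_space \<Rightarrow> 'b::euclidean_space \<Rightarrow> 'c::real_vector"
  assumes "bilinear b"
  shows "b u v = (\<Sum>i\<in>Basis. \<Sum>j\<in>Basis. ((u \<bullet> i) * (v \<bullet> j)) *\<^sub>R b i j)"
proof -
  have l: "linear (b u)" "linear (\<lambda>u. b u v)" for u v using assms by (auto simp: bilinear_def)
  have "b u v = b (\<Sum>i\<in>Basis. (u \<bullet> i) *\<^sub>R i) v" by (simp add: euclidean_representation)
  also have "\<dots> = (\<Sum>i\<in>Basis. (u \<bullet> i) *\<^sub>R b i v)"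
    by (simp add: linear_sum[OF l(2)] linear_scale[OF l(2)])
  also have "\<dots> = (\<Sum>i\<in>Basis. (u \<bullet> i) *\<^sub>R b i (\<Sum>j\<in>Basis. (v \<bullet> j) *\<^sub>R j))"
    by (simp add: euclidean_representation)
  also have "\<dots> = (\<Sum>i\<in>Basis. (u \<bullet> i) *\<^sub>R (\<Sum>j\<in>Basis. (v \<bullet> j) *\<^sub>R b i j))"
    by (simp add: linear_sum[OF l(1)] linear_scale[OF l(1)] del: euclidean_representation)
  finally show ?thesis by (simp add: scaleR_sum_right)
qed

text \<open>The field is known to be differentiable only for constant arguments. Expansion in bases
  turns it into a finite sum of ordinary products, which are differentiated and folded back. It
  serves for the metric and for the Levi-Civita connection along a map.\<close>

lemma has_derivative_bilinear_field:
  fixes \<Phi> :: "'f::real_normed_vector \<Rightarrow> 'a::euclidean_space \<Rightarrow> 'b::euclidean_space \<Rightarrow> 'c::real_normed_vector"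
    and P :: "'t::real_normed_vector \<Rightarrow> 'f"
  assumes S: "open S" "P t \<in> S" and bil: "\<And>y. y \<in> S \<Longrightarrow> bilinear (\<Phi> y)"
    and diff: "\<And>a b. (\<lambda>y. \<Phi> y a b) differentiable (at (P t))"
    and P: "(P has_derivative P') (at t)"
    and X: "(X has_derivative X') (at t)" and Y: "(Y has_derivative Y') (at t)"
  shows "((\<lambda>s. \<Phi> (P s) (X s) (Y s)) has_derivative
     (\<lambda>h. dderiv (\<lambda>y. \<Phi> y (X t) (Y t)) (P t) (P' h) + \<Phi> (P t) (X' h) (Y t) + \<Phi> (P t) (X t) (Y' h))) (at t)"
proof -
  define D where "D i j = dderiv (\<lambda>y. \<Phi> y i j) (P t)" for i j
  have D: "((\<lambda>y. \<Phi> y i j) has_derivative D i j) (at (P t))" for i j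
    unfolding D_def by (rule has_derivative_dderiv[OF diff])
  have Dexp: "D a b k = (\<Sum>i\<in>Basis. \<Sum>j\<in>Basis. ((a \<bullet> i) * (b \<bullet> j)) *\<^sub>R D i j k)" for a b k
  proof -
    have "((\<lambda>y. \<Sum>i\<in>Basis. \<Sum>j\<in>Basis. ((a \<bullet> i) * (b \<bullet> j)) *\<^sub>R \<Phi> y i j) has_derivative
        (\<lambda>k. \<Sum>i\<in>Basis. \<Sum>j\<in>Basis. ((a \<bullet> i) * (b \<bullet> j)) *\<^sub>R D i j k)) (at (P t))"
      by (intro has_derivative_sum has_derivative_scaleR_right D)
    then have "((\<lambda>y. \<Phi> y a b) has_derivative
        (\<lambda>k. \<Sum>i\<in>Basis. \<Sum>j\<in>Basis. ((a \<bullet> i) * (b \<bullet> j)) *\<^sub>R D i j k)) (at (P t))"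
      by (rule has_derivative_transform_within_open[OF _ S]) (rule bilinear_expansion[OF bil, symmetric])
    from has_derivative_unique[OF D this] show ?thesis by (rule fun_cong)
  qed
  obtain U where U: "open U" "t \<in> U" "\<And>s. s \<in> U \<Longrightarrow> P s \<in> S"
    using continuous_at_open[THEN iffD1, OF has_derivative_continuous[OF P], rule_format, of S] S
    by blast
  have PD: "((\<lambda>s. \<Phi> (P s) i j) has_derivative (\<lambda>h. D i j (P' h))) (at t)" for i j
    using diff_chain_at[OF P D] by (simp add: o_def)
  have XI: "((\<lambda>s. X s \<bullet> i) has_derivative (\<lambda>h. X' h \<bullet> i)) (at t)" for i
    by (rule has_derivative_inner_left[OF X])
  have YI: "((\<lambda>s. Y s \<bullet> i) has_derivative (\<lambda>h. Y' h \<bullet> i)) (at t)" for i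
    by (rule has_derivative_inner_left[OF Y])
  have "((\<lambda>s. \<Sum>i\<in>Basis. \<Sum>j\<in>Basis. ((X s \<bullet> i) * (Y s \<bullet> j)) *\<^sub>R \<Phi> (P s) i j) has_derivative
     (\<lambda>h. \<Sum>i\<in>Basis. \<Sum>j\<in>Basis. ((X t \<bullet> i) * (Y t \<bullet> j)) *\<^sub>R D i j (P' h)
         + ((X t \<bullet> i) * (Y' h \<bullet> j) + (X' h \<bullet> i) * (Y t \<bullet> j)) *\<^sub>R \<Phi> (P t) i j)) (at t)"
    by (intro has_derivative_sum has_derivative_scaleR has_derivative_mult XI YI PD)
  then have 1: "((\<lambda>s. \<Phi> (P s) (X s) (Y s)) has_derivative
     (\<lambda>h. \<Sum>i\<in>Basis. \<Sum>j\<in>Basis. ((X t \<bullet> i) * (Y t \<bullet> j)) *\<^sub>R D i j (P' h)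
         + ((X t \<bullet> i) * (Y' h \<bullet> j) + (X' h \<bullet> i) * (Y t \<bullet> j)) *\<^sub>R \<Phi> (P t) i j)) (at t)"
    by (rule has_derivative_transform_within_open[OF _ U(1,2)])
      (rule bilinear_expansion[OF bil[OF U(3)], symmetric])
  have 2: "(\<Sum>i\<in>Basis. \<Sum>j\<in>Basis. ((X t \<bullet> i) * (Y t \<bullet> j)) *\<^sub>R D i j (P' h)
         + ((X t \<bullet> i) * (Y' h \<bullet> j) + (X' h \<bullet> i) * (Y t \<bullet> j)) *\<^sub>R \<Phi> (P t) i j)
     = D (X t) (Y t) (P' h) + \<Phi> (P t) (X' h) (Y t) + \<Phi> (P t) (X t) (Y' h)" for h
    unfolding Dexp[of "X t" "Y t"] bilinear_expansion[OF bil[OF S(2)], of "X' h"]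
      bilinear_expansion[OF bil[OF S(2)], of "X t"]
    by (simp add: sum.distrib scaleR_add_left add.assoc)
  show ?thesis using 1[unfolded 2] unfolding D_def .
qed

text \<open>In the product rule the term with the derivative of \<open>c\<close> would carry the
  factor \<open>q y\<close>, which is 0, so continuity of \<open>c\<close> is enough. This lets the
  solution of a linear system serve as a coefficient before it is known to be
  differentiable.\<close>

lemma has_derivative_scaleR_vanishing:
  fixes c :: "'e::real_normed_vector \<Rightarrow> real"
  assumes c: "isCont c y" and q: "(q has_derivative q') (at y)" "q y = 0"
  shows "((\<lambda>z. c z *\<^sub>R q z) has_derivative (\<lambda>h. c y *\<^sub>R q' h)) (at y)"
proof -
  have bl: "bounded_linear q'" using q(1) by (rule has_derivative_bounded_linear)
  then obtain K where K: "\<And>h. norm (q' h) \<le> norm h * K" using bounded_linear.bounded by blast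
  have lim: "((\<lambda>h. norm (q (y + h) - q' h) / norm h) \<longlongrightarrow> 0) (at 0)"
    using q unfolding has_derivative_at by simp
  have c0: "((\<lambda>h. c (y + h)) \<longlongrightarrow> c y) (at 0)"
    using c by (simp add: isCont_def LIM_offset_zero_iff)
  have "((\<lambda>h. norm (c (y + h) *\<^sub>R q (y + h) - c y *\<^sub>R q' h) / norm h) \<longlongrightarrow> 0) (at 0)"
  proof (rule Lim_null_comparison)
    show "\<forall>\<^sub>F h in at 0. norm (norm (c (y + h) *\<^sub>R q (y + h) - c y *\<^sub>R q' h) / norm h)
       \<le> \<bar>c (y + h)\<bar> * (norm (q (y + h) - q' h) / norm h) + \<bar>c (y + h) - c y\<bar> * K"
    proof (rule eventually_at_filter[THEN iffD2], rule always_eventually, intro allI impI)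
      fix h :: 'e assume h: "h \<noteq> 0"
      have "c (y + h) *\<^sub>R q (y + h) - c y *\<^sub>R q' h
          = c (y + h) *\<^sub>R (q (y + h) - q' h) + (c (y + h) - c y) *\<^sub>R q' h"
        by (simp add: algebra_simps)
      then have "norm (c (y + h) *\<^sub>R q (y + h) - c y *\<^sub>R q' h)
          \<le> \<bar>c (y + h)\<bar> * norm (q (y + h) - q' h) + \<bar>c (y + h) - c y\<bar> * norm (q' h)"
        by (metis norm_scaleR norm_triangle_ineq)
      also have "\<dots> \<le> \<bar>c (y + h)\<bar> * norm (q (y + h) - q' h) + \<bar>c (y + h) - c y\<bar> * (norm h * K)"
        by (intro add_left_mono mult_left_mono K) auto
      finally show "norm (norm (c (y + h) *\<^sub>R q (y + h) - c y *\<^sub>R q' h) / norm h)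
        \<le> \<bar>c (y + h)\<bar> * (norm (q (y + h) - q' h) / norm h) + \<bar>c (y + h) - c y\<bar> * K"
        using h by (simp add: field_simps)
    qed
    have "((\<lambda>h. \<bar>c (y + h)\<bar> * (norm (q (y + h) - q' h) / norm h) + \<bar>c (y + h) - c y\<bar> * K)
       \<longlongrightarrow> \<bar>c y\<bar> * 0 + \<bar>c y - c y\<bar> * K) (at 0)"
      by (intro tendsto_intros lim c0)
    then show "((\<lambda>h. \<bar>c (y + h)\<bar> * (norm (q (y + h) - q' h) / norm h) + \<bar>c (y + h) - c y\<bar> * K) \<longlongrightarrow> 0) (at 0)"
      by simp
  qed
  moreover have "bounded_linear (\<lambda>h. c y *\<^sub>R q' h)" using bl by (rule bounded_linear_const_scaleR)
  ultimately show ?thesis unfolding has_derivative_at using q(2) by simp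
qed

text \<open>With a left inverse \<open>L\<close> of the matrix at \<open>y0\<close>, the system
  expresses \<open>x\<close> as \<open>p\<close> minus a combination of known functions
  \<open>q i\<close> that vanish at \<open>y0\<close>, with the components of \<open>x\<close> as
  coefficients. Smallness of the \<open>q i\<close> bounds \<open>x\<close>, boundedness makes it
  continuous, and continuity suffices to differentiate products with the vanishing
  \<open>q i\<close>.\<close>

lemma differentiable_solution:
  fixes a :: "'e::real_normed_vector \<Rightarrow> 'v::euclidean_space \<Rightarrow> 'v \<Rightarrow> real"
  assumes S: "open S" "y0 \<in> S" and bil: "\<And>y. y \<in> S \<Longrightarrow> bilinear (a y)"
    and pos: "\<And>v. v \<noteq> 0 \<Longrightarrow> a y0 v v > 0"
    and da: "\<And>u v. (\<lambda>y. a y u v) differentiable (at y0)"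
    and db: "\<And>v. (\<lambda>y. b y v) differentiable (at y0)"
    and sol: "\<And>y v. y \<in> S \<Longrightarrow> a y (x y) v = b y v"
  shows "x differentiable (at y0)"
proof -
  define M where "M y v = (\<Sum>j\<in>Basis. a y v j *\<^sub>R j)" for y and v :: 'v
  define \<beta> where "\<beta> y = (\<Sum>j\<in>Basis. b y j *\<^sub>R (j :: 'v))" for y
  have lin: "linear (\<lambda>u. a y u v)" "linear (a y u)" if "y \<in> S" for y u v
    using bil[OF that] by (auto simp: bilinear_def)
  have linM: "linear (M y)" if "y \<in> S" for y
    unfolding M_def
    by (intro linear_compose_sum ballI linear_compose_scale_right lin(1)[OF that] linearI)
       (simp_all add: linear_add[OF lin(1)[OF that]] linear_scale[OF lin(1)[OF that]] scaleR_add_left)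
  have "inj (M y0)"
  proof (rule linear_injective_0[OF linM[OF S(2)], THEN iffD2], intro allI impI)
    fix v assume v: "M y0 v = 0"
    have j: "a y0 v j = 0" if "j \<in> Basis" for j
    proof -
      have "M y0 v \<bullet> j = a y0 v j" unfolding M_def using that by (simp add: inner_sum_left_Basis)
      then show ?thesis using v by simp
    qed
    have "a y0 v v = a y0 v (\<Sum>j\<in>Basis. (v \<bullet> j) *\<^sub>R j)" by (simp add: euclidean_representation)
    also have "\<dots> = (\<Sum>j\<in>Basis. (v \<bullet> j) *\<^sub>R a y0 v j)"
      by (simp add: linear_sum[OF lin(2)[OF S(2)]] linear_scale[OF lin(2)[OF S(2)]] del: euclidean_representation)
    also have "\<dots> = 0" using j by simp
    finally show "v = 0" using pos[of v] by fastforce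
  qed
  then obtain L where L: "linear L" "L \<circ> M y0 = id"
    using linear_injective_left_inverse[OF linM[OF S(2)]] by auto
  have LM: "L (M y0 v) = v" for v using L(2) by (simp add: fun_eq_iff)
  define p where "p y = L (\<beta> y)" for y
  define q where "q i y = L (M y i - M y0 i)" for i y
  have M\<beta>: "M y (x y) = \<beta> y" if "y \<in> S" for y using sol[OF that] by (simp add: M_def \<beta>_def)
  have xeq: "x y = p y - (\<Sum>i\<in>Basis. (x y \<bullet> i) *\<^sub>R q i y)" if "y \<in> S" for y
  proof -
    have "(\<Sum>i\<in>Basis. (x y \<bullet> i) *\<^sub>R q i y) = L (\<Sum>i\<in>Basis. (x y \<bullet> i) *\<^sub>R (M y i - M y0 i))"
      unfolding q_def by (simp add: linear_sum[OF L(1)] linear_scale[OF L(1)])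
    also have "(\<Sum>i\<in>Basis. (x y \<bullet> i) *\<^sub>R (M y i - M y0 i))
       = M y (\<Sum>i\<in>Basis. (x y \<bullet> i) *\<^sub>R i) - M y0 (\<Sum>i\<in>Basis. (x y \<bullet> i) *\<^sub>R i)"
      by (simp add: linear_sum[OF linM] linear_scale[OF linM] that S scaleR_diff_right sum_subtractf
          del: euclidean_representation)
    also have "L \<dots> = p y - x y"
      by (simp add: euclidean_representation M\<beta>[OF that] linear_diff[OF L(1)] LM p_def)
    finally show ?thesis by simp
  qed
  have bL: "bounded_linear L" using L(1) by (simp add: linear_conv_bounded_linear)
  have dL: "(\<lambda>y. L (h y)) differentiable (at y0)" if "h differentiable (at y0)" for h
    using that bounded_linear.has_derivative[OF bL] unfolding differentiable_def by blast
  have dp: "p differentiable (at y0)" unfolding p_def \<beta>_def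
    by (intro dL differentiable_sum ballI differentiable_scaleR db differentiable_const finite_Basis)
  have dq: "q i differentiable (at y0)" for i unfolding q_def M_def
    by (intro dL differentiable_diff differentiable_sum ballI differentiable_scaleR da differentiable_const finite_Basis)
  have q0: "q i y0 = 0" for i by (simp add: q_def linear_0[OF L(1)])
  have cp: "isCont p y0" and cq: "isCont (q i) y0" for i
    using dp dq differentiable_imp_continuous_within by blast+
  have limq: "((\<lambda>y. \<Sum>i\<in>Basis. norm (q i y)) \<longlongrightarrow> 0) (nhds y0)"
  proof -
    have "isCont (\<lambda>y. \<Sum>i\<in>Basis. norm (q i y)) y0" by (intro continuous_intros cq)
    then have "((\<lambda>y. \<Sum>i\<in>Basis. norm (q i y)) \<longlongrightarrow> (\<Sum>i\<in>Basis. norm (q i y0))) (nhds y0)"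
      by (rule isCont_nhds[THEN iffD1])
    then show ?thesis by (simp add: q0)
  qed
  have bound: "\<forall>\<^sub>F y in nhds y0. norm (x y) \<le> 2 * (norm (p y0) + 1)"
  proof -
    have "\<forall>\<^sub>F y in nhds y0. (\<Sum>i\<in>Basis. norm (q i y)) < 1/2"
      using limq by (rule order_tendstoD) simp
    moreover have "((\<lambda>y. norm (p y)) \<longlongrightarrow> norm (p y0)) (nhds y0)"
      using cp by (intro tendsto_norm) (simp add: isCont_nhds)
    then have "\<forall>\<^sub>F y in nhds y0. norm (p y) < norm (p y0) + 1"
      by (rule order_tendstoD) simp
    moreover have "\<forall>\<^sub>F y in nhds y0. y \<in> S" using S by (rule eventually_nhds_in_open)
    ultimately show ?thesis
    proof eventually_elim
      case (elim y)
      have "norm (\<Sum>i\<in>Basis. (x y \<bullet> i) *\<^sub>R q i y) \<le> (\<Sum>i\<in>Basis. norm (x y) * norm (q i y))"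
        by (intro order_trans[OF norm_sum] sum_mono) (simp add: Basis_le_norm mult_right_mono)
      also have "\<dots> = norm (x y) * (\<Sum>i\<in>Basis. norm (q i y))" by (simp add: sum_distrib_left)
      \<comment> \<open>The bound 1/2 makes the correction at most half of
        \<open>norm (x y)\<close>, so that it can be absorbed in the left side.\<close>
      also have "\<dots> \<le> norm (x y) * (1/2)" using elim by (intro mult_left_mono) auto
      finally have "norm (x y) \<le> norm (p y) + norm (x y) * (1/2)"
        using xeq[OF elim(3)] by (smt (verit) norm_triangle_ineq4)
      then show ?case using elim by simp
    qed
  qed
  have lim0: "((\<lambda>y. (x y \<bullet> i) *\<^sub>R q i y) \<longlongrightarrow> 0) (nhds y0)" if "i \<in> Basis" for i
  proof (rule Lim_null_comparison)
    show "\<forall>\<^sub>F y in nhds y0. norm ((x y \<bullet> i) *\<^sub>R q i y) \<le> 2 * (norm (p y0) + 1) * norm (q i y)"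
      using bound
    proof eventually_elim
      case (elim y)
      have "\<bar>x y \<bullet> i\<bar> \<le> 2 * (norm (p y0) + 1)" using elim Basis_le_norm[OF that, of "x y"] by linarith
      then show ?case by (simp add: mult_right_mono)
    qed
    have "((\<lambda>y. 2 * (norm (p y0) + 1) * norm (q i y)) \<longlongrightarrow> 2 * (norm (p y0) + 1) * norm (q i y0)) (nhds y0)"
      using cq[of i] by (intro tendsto_intros) (simp add: isCont_nhds)
    then show "((\<lambda>y. 2 * (norm (p y0) + 1) * norm (q i y)) \<longlongrightarrow> 0) (nhds y0)" by (simp add: q0)
  qed
  have x0: "x y0 = p y0" using xeq[OF S(2)] by (simp add: q0)
  have "((\<lambda>y. p y - (\<Sum>i\<in>Basis. (x y \<bullet> i) *\<^sub>R q i y)) \<longlongrightarrow> p y0 - (\<Sum>i\<in>(Basis::'v set). 0)) (nhds y0)"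
    using cp by (intro tendsto_diff tendsto_sum lim0) (simp_all add: isCont_nhds)
  then have "(x \<longlongrightarrow> x y0) (nhds y0)"
    using xeq x0 eventually_nhds_in_open[OF S]
    by (subst tendsto_cong[where g = "\<lambda>y. p y - (\<Sum>i\<in>Basis. (x y \<bullet> i) *\<^sub>R q i y)"])
       (auto elim!: eventually_mono)
  then have cx: "isCont x y0" by (simp add: isCont_nhds)
  have "((\<lambda>y. p y - (\<Sum>i\<in>Basis. (x y \<bullet> i) *\<^sub>R q i y)) has_derivative
     (\<lambda>h. dderiv p y0 h - (\<Sum>i\<in>Basis. (x y0 \<bullet> i) *\<^sub>R dderiv (q i) y0 h))) (at y0)"
    by (intro has_derivative_diff has_derivative_sum has_derivative_scaleR_vanishing has_derivative_dderiv
        dp dq q0 continuous_intros cx)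
  then show ?thesis
    by (rule differentiableI[OF has_derivative_transform_within_open[OF _ S]]) (rule xeq[symmetric])
qed


section \<open>The Gauss equation in coordinates\<close>

text \<open>\<open>koszul\<close>, \<open>levi_civita\<close> and \<open>curv\<close> repeat
  \<open>christoffel\<close> and \<open>curvature_coord\<close> for a bare field of bilinear forms
  on coordinate space, so that the ambient and the induced metric are treated alike and without an
  atlas.\<close>

definition koszul :: "('e::euclidean_space \<Rightarrow> 'e \<Rightarrow> 'e \<Rightarrow> real) \<Rightarrow> 'e \<Rightarrow> 'e \<Rightarrow> 'e \<Rightarrow> 'e \<Rightarrow> real" where
  "koszul G y u w z =
     (dderiv (\<lambda>y'. G y' w z) y u + dderiv (\<lambda>y'. G y' u z) y w - dderiv (\<lambda>y'. G y' u w) y z) / 2"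

definition levi_civita :: "('e::euclidean_space \<Rightarrow> 'e \<Rightarrow> 'e \<Rightarrow> real) \<Rightarrow> 'e \<Rightarrow> 'e \<Rightarrow> 'e \<Rightarrow> 'e" where
  "levi_civita G y u w = (THE x. \<forall>z. G y x z = koszul G y u w z)"

definition curv :: "('e::euclidean_space \<Rightarrow> 'e \<Rightarrow> 'e \<Rightarrow> real) \<Rightarrow> 'e \<Rightarrow> 'e \<Rightarrow> 'e \<Rightarrow> 'e \<Rightarrow> 'e" where
  "curv G y u v w =
     dderiv (\<lambda>y'. levi_civita G y' v w) y u + levi_civita G y u (levi_civita G y v w)
     - (dderiv (\<lambda>y'. levi_civita G y' u w) y v + levi_civita G y v (levi_civita G y u w))"

lemma christoffel_eq_levi_civita: "christoffel A g c = levi_civita (metric_coord A g c)"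
  unfolding christoffel_def levi_civita_def koszul_def by (intro ext) simp

lemma curvature_coord_eq_curv: "curvature_coord A g c = curv (metric_coord A g c)"
  unfolding curvature_coord_def curv_def christoffel_eq_levi_civita by (intro ext) simp

section \<open>The Levi-Civita connection of a metric in coordinates\<close>

locale local_metric =
  fixes S :: "'e::euclidean_space set" and G :: "'e \<Rightarrow> 'e \<Rightarrow> 'e \<Rightarrow> real"
  assumes open_S: "open S"
    and bil: "y \<in> S \<Longrightarrow> bilinear (G y)"
    and sym: "y \<in> S \<Longrightarrow> G y u w = G y w u"
    and pos: "y \<in> S \<Longrightarrow> u \<noteq> 0 \<Longrightarrow> G y u u > 0"
    and diff: "y \<in> S \<Longrightarrow> (\<lambda>y. G y u w) differentiable (at y)"
begin

lemma nondegenerate: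
  assumes y: "y \<in> S" and eq: "\<And>z. G y x z = G y x' z"
  shows "x = x'"
proof -
  have "G y (x - x') (x - x') = 0" using eq by (simp add: bilinear_lsub[OF bil[OF y]])
  then show ?thesis using pos[OF y, of "x - x'"] by fastforce
qed

text \<open>The map that sends \<open>v\<close> to the vector of values of \<open>G y v\<close> on
  the basis is injective by positivity, hence surjective; a preimage of the vector of values of
  \<open>\<phi>\<close> represents it.\<close>

lemma riesz:
  assumes y: "y \<in> S" and \<phi>: "linear \<phi>"
  shows "\<exists>x. \<forall>z. G y x z = \<phi> z"
proof -
  have lin: "linear (\<lambda>u. G y u v)" "linear (G y u)" for u v
    using bil[OF y] by (auto simp: bilinear_def)
  define M where "M v = (\<Sum>j\<in>Basis. G y v j *\<^sub>R j)" for v :: 'e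
  have expand: "\<psi> z = (\<Sum>j\<in>Basis. (z \<bullet> j) * \<psi> j)" if "linear \<psi>" for \<psi> :: "'e \<Rightarrow> real" and z
    using linear_sum[OF that, of "\<lambda>j. (z \<bullet> j) *\<^sub>R j" Basis]
    by (simp add: euclidean_representation linear_scale[OF that])
  have linM: "linear M"
    unfolding M_def
    by (intro linearI)
       (simp_all add: linear_add[OF lin(1)] linear_scale[OF lin(1)] scaleR_add_left sum.distrib scaleR_sum_right)
  have Mj: "M v \<bullet> j = G y v j" if "j \<in> Basis" for v j
    unfolding M_def using that by (simp add: inner_sum_left_Basis)
  have "inj M"
  proof (rule linear_injective_0[OF linM, THEN iffD2], intro allI impI)
    fix v assume v: "M v = 0"
    have "G y v j = 0" if "j \<in> Basis" for j using Mj[OF that, of v] v by simp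
    then have "G y v v = 0" by (subst expand[OF lin(2)]) simp
    then show "v = 0" using pos[OF y, of v] by fastforce
  qed
  then have "surj M" using linear_injective_imp_surjective[OF linM] by simp
  then obtain x where x: "M x = (\<Sum>j\<in>Basis. \<phi> j *\<^sub>R j)" by (metis surjD)
  have "G y x j = \<phi> j" if "j \<in> Basis" for j
    using Mj[OF that, of x] x that by (simp add: inner_sum_left_Basis)
  then have "G y x z = \<phi> z" for z
    by (subst expand[OF lin(2)], subst expand[OF \<phi>]) simp
  then show ?thesis by blast
qed

text \<open>Bilinearity and symmetry of \<open>G\<close> hold at all points of the open set
  \<open>S\<close>, so they pass to derivatives in the base point. They make the Koszul expression
  linear in each argument.\<close>

lemma dderiv_metric_linear:
  assumes y: "y \<in> S"
  shows "dderiv (\<lambda>y. G y (a + b) w) y v = dderiv (\<lambda>y. G y a w) y v + dderiv (\<lambda>y. G y b w) y v"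
    and "dderiv (\<lambda>y. G y (r *\<^sub>R a) w) y v = r * dderiv (\<lambda>y. G y a w) y v"
    and "dderiv (\<lambda>y. G y w (a + b)) y v = dderiv (\<lambda>y. G y w a) y v + dderiv (\<lambda>y. G y w b) y v"
    and "dderiv (\<lambda>y. G y w (r *\<^sub>R a)) y v = r * dderiv (\<lambda>y. G y w a) y v"
    and "dderiv (\<lambda>y. G y a w) y (v + v') = dderiv (\<lambda>y. G y a w) y v + dderiv (\<lambda>y. G y a w) y v'"
    and "dderiv (\<lambda>y. G y a w) y (r *\<^sub>R v) = r * dderiv (\<lambda>y. G y a w) y v"
    and "dderiv (\<lambda>y. G y a w) y v = dderiv (\<lambda>y. G y w a) y v"
proof -
  have d: "((\<lambda>y. G y a w) has_derivative dderiv (\<lambda>y. G y a w) y) (at y)" for a w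
    by (rule has_derivative_dderiv[OF diff[OF y]])
  note tr = has_derivative_transform_within_open[OF _ open_S y]
  have "((\<lambda>y. G y (a + b) w) has_derivative (\<lambda>v. dderiv (\<lambda>y. G y a w) y v + dderiv (\<lambda>y. G y b w) y v)) (at y)"
    by (rule tr[OF has_derivative_add[OF d d]]) (simp add: bilinear_ladd[OF bil])
  from dderiv_eq[OF this]
  show "dderiv (\<lambda>y. G y (a + b) w) y v = dderiv (\<lambda>y. G y a w) y v + dderiv (\<lambda>y. G y b w) y v" by simp
  have "((\<lambda>y. G y (r *\<^sub>R a) w) has_derivative (\<lambda>v. r * dderiv (\<lambda>y. G y a w) y v)) (at y)"
    by (rule tr[OF has_derivative_mult_right[OF d]]) (simp add: bilinear_lmul[OF bil])
  from dderiv_eq[OF this]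
  show "dderiv (\<lambda>y. G y (r *\<^sub>R a) w) y v = r * dderiv (\<lambda>y. G y a w) y v" by simp
  have "((\<lambda>y. G y w (a + b)) has_derivative (\<lambda>v. dderiv (\<lambda>y. G y w a) y v + dderiv (\<lambda>y. G y w b) y v)) (at y)"
    by (rule tr[OF has_derivative_add[OF d d]]) (simp add: bilinear_radd[OF bil])
  from dderiv_eq[OF this]
  show "dderiv (\<lambda>y. G y w (a + b)) y v = dderiv (\<lambda>y. G y w a) y v + dderiv (\<lambda>y. G y w b) y v" by simp
  have "((\<lambda>y. G y w (r *\<^sub>R a)) has_derivative (\<lambda>v. r * dderiv (\<lambda>y. G y w a) y v)) (at y)"
    by (rule tr[OF has_derivative_mult_right[OF d]]) (simp add: bilinear_rmul[OF bil])
  from dderiv_eq[OF this]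
  show "dderiv (\<lambda>y. G y w (r *\<^sub>R a)) y v = r * dderiv (\<lambda>y. G y w a) y v" by simp
  have l: "linear (dderiv (\<lambda>y. G y a w) y)" by (rule linear_frechet_derivative[OF diff[OF y]])
  show "dderiv (\<lambda>y. G y a w) y (v + v') = dderiv (\<lambda>y. G y a w) y v + dderiv (\<lambda>y. G y a w) y v'"
    by (rule linear_add[OF l])
  show "dderiv (\<lambda>y. G y a w) y (r *\<^sub>R v) = r * dderiv (\<lambda>y. G y a w) y v"
    using linear_scale[OF l] by simp
  have "((\<lambda>y. G y a w) has_derivative (\<lambda>v. dderiv (\<lambda>y. G y w a) y v)) (at y)"
    by (rule tr[OF d]) (rule sym)
  from dderiv_eq[OF this]
  show "dderiv (\<lambda>y. G y a w) y v = dderiv (\<lambda>y. G y w a) y v" by simp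
qed

text \<open>Representation and nondegeneracy discharge the definite description; from here on the
  connection is used only through this equation.\<close>

lemma levi_civita_eq:
  assumes y: "y \<in> S"
  shows "G y (levi_civita G y u w) z = koszul G y u w z"
proof -
  have "linear (koszul G y u w)"
    by (rule linearI) (simp_all add: koszul_def dderiv_metric_linear(3-6)[OF y] algebra_simps add_divide_distrib diff_divide_distrib)
  from riesz[OF y this] obtain x where x: "\<forall>z. G y x z = koszul G y u w z" by blast
  have "\<exists>!x. \<forall>z. G y x z = koszul G y u w z"
  proof (rule ex1I[of _ x])
    show "\<forall>z. G y x z = koszul G y u w z" by (rule x)
    fix x' assume x': "\<forall>z. G y x' z = koszul G y u w z"
    show "x' = x" by (rule nondegenerate[OF y]) (simp add: x x')
  qed
  from theI'[OF this] show ?thesis unfolding levi_civita_def by blast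
qed

lemma levi_civita_unique:
  assumes y: "y \<in> S" and x: "\<And>z. G y x z = koszul G y u w z"
  shows "levi_civita G y u w = x"
  by (rule nondegenerate[OF y]) (simp add: x levi_civita_eq[OF y])

lemma koszul_commute: "y \<in> S \<Longrightarrow> koszul G y u w z = koszul G y w u z"
  unfolding koszul_def using dderiv_metric_linear(7)[of y u w z] by simp

lemma levi_civita_commute: "y \<in> S \<Longrightarrow> levi_civita G y u w = levi_civita G y w u"
  by (rule levi_civita_unique) (simp_all add: levi_civita_eq koszul_commute)

text \<open>Linearity in the second argument is uniqueness applied to sums and multiples; the first
  argument follows because the connection is torsion-free.\<close>

lemma bilinear_levi_civita:
  assumes y: "y \<in> S"
  shows "bilinear (levi_civita G y)"
proof -
  have lin: "linear (levi_civita G y u)" for u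
  proof (rule linearI)
    fix w w' r
    show "levi_civita G y u (w + w') = levi_civita G y u w + levi_civita G y u w'"
      by (rule levi_civita_unique[OF y])
        (simp add: bilinear_ladd[OF bil[OF y]] levi_civita_eq[OF y], simp add: koszul_def dderiv_metric_linear(1-6)[OF y] field_simps)
    show "levi_civita G y u (r *\<^sub>R w) = r *\<^sub>R levi_civita G y u w"
      by (rule levi_civita_unique[OF y])
        (simp add: bilinear_lmul[OF bil[OF y]] levi_civita_eq[OF y], simp add: koszul_def dderiv_metric_linear(1-6)[OF y] field_simps)
  qed
  moreover have "linear (\<lambda>u. levi_civita G y u w)" for w
    by (subst levi_civita_commute[OF y]) (rule lin)
  ultimately show ?thesis by (simp add: bilinear_def)
qed

text \<open>In the sum of the two Koszul expressions the derivatives along \<open>a\<close> and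
  \<open>b\<close> cancel, leaving the derivative along \<open>v\<close>.\<close>

lemma metric_compatible:
  assumes y: "y \<in> S"
  shows "dderiv (\<lambda>y. G y a b) y v = G y (levi_civita G y v a) b + G y a (levi_civita G y v b)"
proof -
  have "G y a (levi_civita G y v b) = koszul G y v b a"
    using levi_civita_eq[OF y] sym[OF y] by simp
  then show ?thesis
    using dderiv_metric_linear(7)[OF y] unfolding levi_civita_eq[OF y] koszul_def
    by (simp add: field_simps)
qed

text \<open>The Koszul equations are a linear system for the connection with coefficients depending
  on the base point. Differentiability of the right side is a hypothesis because the ambient and the
  induced metric supply it in different ways.\<close>

lemma levi_civita_differentiable:
  assumes y: "y \<in> S"
    and d: "\<And>z. (\<lambda>y. koszul G y u w z) differentiable (at y)"
  shows "(\<lambda>y. levi_civita G y u w) differentiable (at y)"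
  by (rule differentiable_solution[OF open_S y bil pos[OF y] diff[OF y] d]) (auto intro: levi_civita_eq)

end

text \<open>The second derivative is asked of the ambient metric; the induced metric enters as a
  \<open>local_metric\<close>, and its connection is differentiated through the ambient one.\<close>

locale smooth_local_metric = local_metric +
  assumes diff2: "y \<in> S \<Longrightarrow> (\<lambda>y. dderiv (\<lambda>y. G y u w) y v) differentiable (at y)"
begin

lemma levi_civita_diff: "y \<in> S \<Longrightarrow> (\<lambda>y. levi_civita G y u w) differentiable (at y)"
  unfolding koszul_def
  by (rule levi_civita_differentiable, assumption, unfold koszul_def)
     (intro differentiable_divide differentiable_diff differentiable_add diff2 differentiable_const, simp_all)

lemma dderiv_levi_civita_linear:
  assumes y: "y \<in> S"
  shows "linear (\<lambda>u. dderiv (\<lambda>y. levi_civita G y u w) y v)"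
    and "linear (\<lambda>w. dderiv (\<lambda>y. levi_civita G y u w) y v)"
    and "linear (\<lambda>v. dderiv (\<lambda>y. levi_civita G y u w) y v)"
proof -
  have d: "((\<lambda>y. levi_civita G y a w) has_derivative dderiv (\<lambda>y. levi_civita G y a w) y) (at y)" for a w
    by (rule has_derivative_dderiv[OF levi_civita_diff[OF y]])
  note tr = has_derivative_transform_within_open[OF _ open_S y]
  have 1: "dderiv (\<lambda>y. levi_civita G y (a + b) w) y v = dderiv (\<lambda>y. levi_civita G y a w) y v + dderiv (\<lambda>y. levi_civita G y b w) y v" for a b w
  proof -
    have "((\<lambda>y. levi_civita G y (a + b) w) has_derivative (\<lambda>v. dderiv (\<lambda>y. levi_civita G y a w) y v + dderiv (\<lambda>y. levi_civita G y b w) y v)) (at y)"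
      by (rule tr[OF has_derivative_add[OF d d]]) (simp add: bilinear_ladd[OF bilinear_levi_civita])
    from dderiv_eq[OF this] show ?thesis by simp
  qed
  have 2: "dderiv (\<lambda>y. levi_civita G y (r *\<^sub>R a) w) y v = r *\<^sub>R dderiv (\<lambda>y. levi_civita G y a w) y v" for a r w
  proof -
    have "((\<lambda>y. levi_civita G y (r *\<^sub>R a) w) has_derivative (\<lambda>v. r *\<^sub>R dderiv (\<lambda>y. levi_civita G y a w) y v)) (at y)"
      by (rule tr[OF has_derivative_scaleR_right[OF d]]) (simp add: bilinear_lmul[OF bilinear_levi_civita])
    from dderiv_eq[OF this] show ?thesis by simp
  qed
  have 3: "dderiv (\<lambda>y. levi_civita G y u w) y v = dderiv (\<lambda>y. levi_civita G y w u) y v" for u w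
  proof -
    have "((\<lambda>y. levi_civita G y u w) has_derivative (\<lambda>v. dderiv (\<lambda>y. levi_civita G y w u) y v)) (at y)"
      by (rule tr[OF d]) (rule levi_civita_commute)
    from dderiv_eq[OF this] show ?thesis by simp
  qed
  show "linear (\<lambda>u. dderiv (\<lambda>y. levi_civita G y u w) y v)" for w by (intro linearI 1 2)
  then show "linear (\<lambda>w. dderiv (\<lambda>y. levi_civita G y u w) y v)" by (subst 3)
  show "linear (\<lambda>v. dderiv (\<lambda>y. levi_civita G y u w) y v)" by (rule linear_frechet_derivative[OF levi_civita_diff[OF y]])
qed

text \<open>This yields the bilinear forms to which the basis change of a trace is applied, and the
  continuity behind the compactness argument.\<close>

lemma curv_linear:
  assumes y: "y \<in> S"
  shows "linear (\<lambda>u. curv G y u v w)" "linear (\<lambda>v. curv G y u v w)" "linear (\<lambda>w. curv G y u v w)"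
proof -
  note b = bilinear_levi_civita[OF y]
  have l: "linear (\<lambda>u. levi_civita G y u w)" "linear (levi_civita G y u)" for u w
    using b by (auto simp: bilinear_def)
  have c: "linear (\<lambda>w. levi_civita G y a (levi_civita G y b w))" "linear (\<lambda>u. levi_civita G y a (levi_civita G y u b))" for a b
    using linear_compose[OF l(2) l(2)] linear_compose[OF l(1) l(2)] by (simp_all add: o_def)
  show "linear (\<lambda>u. curv G y u v w)" "linear (\<lambda>v. curv G y u v w)" "linear (\<lambda>w. curv G y u v w)"
    unfolding curv_def
    by (intro linear_compose_sub linear_compose_add dderiv_levi_civita_linear[OF y] l c)+
qed

end

section \<open>Immersions in coordinates and the second fundamental form\<close>

locale local_immersion = ambient: smooth_local_metric T G
  for T :: "'f::euclidean_space set" and G +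
  fixes U :: "'e::euclidean_space set" and F :: "'e \<Rightarrow> 'f" and g :: "'e \<Rightarrow> 'e \<Rightarrow> 'e \<Rightarrow> real"
  assumes open_U: "open U" and smooth_F: "smooth_on U F" and F_in: "y \<in> U \<Longrightarrow> F y \<in> T"
    and inj: "y \<in> U \<Longrightarrow> dderiv F y u = 0 \<Longrightarrow> u = 0"
    and g_eq: "y \<in> U \<Longrightarrow> g y u w = G (F y) (dderiv F y u) (dderiv F y w)"
begin

text \<open>The ambient covariant derivative along \<open>F\<close>, in the direction
  \<open>u\<close>, of the field of images of the constant \<open>w\<close>: the vector whose normal
  part defines the second fundamental form.\<close>

definition hess :: "'e \<Rightarrow> 'e \<Rightarrow> 'e \<Rightarrow> 'f" where
  "hess y u w = dderiv (\<lambda>y'. dderiv F y' w) y u + levi_civita G (F y) (dderiv F y u) (dderiv F y w)"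

text \<open>The tangential part is removed by means of the induced connection. This is the covariant
  differential of the derivative of \<open>F\<close>; that it is normal to the image is a
  consequence of Koszul's formula.\<close>

definition II :: "'e \<Rightarrow> 'e \<Rightarrow> 'e \<Rightarrow> 'f" where
  "II y u w = hess y u w - dderiv F y (levi_civita g y u w)"

lemma dF: "y \<in> U \<Longrightarrow> (F has_derivative dderiv F y) (at y)"
  by (intro has_derivative_dderiv smooth_on_differentiable[OF smooth_F])

lemma linear_dF: "y \<in> U \<Longrightarrow> linear (dderiv F y)"
  by (intro linear_frechet_derivative smooth_on_differentiable[OF smooth_F])

lemma ddF: "y \<in> U \<Longrightarrow> ((\<lambda>y. dderiv F y w) has_derivative dderiv (\<lambda>y. dderiv F y w) y) (at y)"
  by (rule has_derivative_dderiv[OF smooth_on_differentiable[OF smooth_on_dderiv[OF smooth_F]]])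

text \<open>The derivative of the metric in its base point is turned into connection terms by metric
  compatibility, and these complete \<open>X'\<close> and \<open>Y'\<close> to covariant derivatives
  along \<open>F\<close>.\<close>

lemma metric_product_rule:
  assumes y: "y \<in> U" and X: "(X has_derivative X') (at y)" and Y: "(Y has_derivative Y') (at y)"
  shows "((\<lambda>y. G (F y) (X y) (Y y)) has_derivative
    (\<lambda>h. G (F y) (X' h + levi_civita G (F y) (dderiv F y h) (X y)) (Y y)
       + G (F y) (X y) (Y' h + levi_civita G (F y) (dderiv F y h) (Y y)))) (at y)"
proof -
  note b = ambient.bil[OF F_in[OF y]]
  have "((\<lambda>y. G (F y) (X y) (Y y)) has_derivative
    (\<lambda>h. dderiv (\<lambda>p. G p (X y) (Y y)) (F y) (dderiv F y h) + G (F y) (X' h) (Y y) + G (F y) (X y) (Y' h))) (at y)"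
    by (rule has_derivative_bilinear_field[OF ambient.open_S F_in[OF y] ambient.bil
          ambient.diff[OF F_in[OF y]] dF[OF y] X Y])
  then show ?thesis
    unfolding ambient.metric_compatible[OF F_in[OF y]]
    by (simp add: bilinear_ladd[OF b] bilinear_radd[OF b] algebra_simps)
qed

text \<open>Symmetry of second derivatives for the first summand, absence of torsion for the
  second.\<close>

lemma hess_commute: "y \<in> U \<Longrightarrow> hess y u w = hess y w u"
  unfolding hess_def
  using dderiv_commute[OF open_U _ smooth_F, of y u w] ambient.levi_civita_commute[OF F_in, of y] by simp

lemma induced_has_derivative:
  assumes y: "y \<in> U"
  shows "((\<lambda>y. g y v z) has_derivative
     (\<lambda>u. G (F y) (hess y u v) (dderiv F y z) + G (F y) (dderiv F y v) (hess y u z))) (at y)"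
  using has_derivative_transform_within_open[OF metric_product_rule[OF y ddF[OF y] ddF[OF y]] open_U y g_eq[symmetric]]
  unfolding hess_def .

sublocale induced: local_metric U g
proof
  show "open U" by (rule open_U)
  fix y u w assume y: "y \<in> U"
  note b = ambient.bil[OF F_in[OF y]]
  show "bilinear (g y)"
    unfolding bilinear_def
    by (intro conjI allI linearI)
      (simp_all add: g_eq[OF y] linear_add[OF linear_dF[OF y]] linear_scale[OF linear_dF[OF y]]
        bilinear_ladd[OF b] bilinear_radd[OF b] bilinear_lmul[OF b] bilinear_rmul[OF b])
  show "g y u w = g y w u" using ambient.sym[OF F_in[OF y]] by (simp add: g_eq[OF y])
  show "u \<noteq> 0 \<Longrightarrow> g y u u > 0" using ambient.pos[OF F_in[OF y]] inj[OF y] by (auto simp: g_eq[OF y])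
  show "(\<lambda>y. g y u w) differentiable (at y)" by (rule differentiableI[OF induced_has_derivative[OF y]])
qed

text \<open>The three derivatives in Koszul's formula give six terms; symmetry of
  \<open>hess\<close> cancels four of them and makes the other two equal. In effect, the induced
  connection is the tangential part of the ambient one.\<close>

lemma koszul_induced:
  assumes y: "y \<in> U"
  shows "koszul g y u w z = G (F y) (hess y u w) (dderiv F y z)"
  using ambient.sym[OF F_in[OF y]] hess_commute[OF y]
  unfolding koszul_def dderiv_eq[OF induced_has_derivative[OF y]] by simp

lemma g_levi_civita: "y \<in> U \<Longrightarrow> g y (levi_civita g y u w) z = G (F y) (hess y u w) (dderiv F y z)"
  by (simp add: induced.levi_civita_eq koszul_induced)

lemma hess_has_derivative:
  assumes y: "y \<in> U"
  shows "((\<lambda>y. hess y v w) has_derivative (\<lambda>u. dderiv (\<lambda>y. dderiv (\<lambda>y. dderiv F y w) y v) y u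
    + (dderiv (\<lambda>p. levi_civita G p (dderiv F y v) (dderiv F y w)) (F y) (dderiv F y u)
      + levi_civita G (F y) (dderiv (\<lambda>y. dderiv F y v) y u) (dderiv F y w)
      + levi_civita G (F y) (dderiv F y v) (dderiv (\<lambda>y. dderiv F y w) y u)))) (at y)"
  unfolding hess_def
proof (rule has_derivative_add)
  show "((\<lambda>y. dderiv (\<lambda>y'. dderiv F y' w) y v) has_derivative dderiv (\<lambda>y. dderiv (\<lambda>y. dderiv F y w) y v) y) (at y)"
    by (rule has_derivative_dderiv[OF smooth_on_differentiable[OF smooth_on_dderiv[OF smooth_on_dderiv[OF smooth_F]] y]])
  show "((\<lambda>y. levi_civita G (F y) (dderiv F y v) (dderiv F y w)) has_derivative
     (\<lambda>u. dderiv (\<lambda>p. levi_civita G p (dderiv F y v) (dderiv F y w)) (F y) (dderiv F y u)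
      + levi_civita G (F y) (dderiv (\<lambda>y. dderiv F y v) y u) (dderiv F y w)
      + levi_civita G (F y) (dderiv F y v) (dderiv (\<lambda>y. dderiv F y w) y u))) (at y)"
    by (rule has_derivative_bilinear_field[OF ambient.open_S F_in[OF y] ambient.bilinear_levi_civita
          ambient.levi_civita_diff[OF F_in[OF y]] dF[OF y] ddF[OF y] ddF[OF y]])
qed

text \<open>The Koszul expression of \<open>g\<close> equals a product of fields along
  \<open>F\<close> built from the ambient metric, the ambient connection and derivatives of
  \<open>F\<close>, and such a product is differentiable.\<close>

lemma induced_levi_civita_diff:
  assumes y: "y \<in> U"
  shows "(\<lambda>y. levi_civita g y u w) differentiable (at y)"
proof (rule induced.levi_civita_differentiable[OF y])
  fix z
  have "(\<lambda>y. G (F y) (hess y u w) (dderiv F y z)) differentiable (at y)"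
    by (rule differentiableI[OF metric_product_rule[OF y hess_has_derivative[OF y] ddF[OF y]]])
  then obtain D where "((\<lambda>y. G (F y) (hess y u w) (dderiv F y z)) has_derivative D) (at y)"
    unfolding differentiable_def by blast
  from has_derivative_transform_within_open[OF this open_U y koszul_induced[symmetric]]
  show "(\<lambda>y. koszul g y u w z) differentiable (at y)" by (rule differentiableI)
qed

lemma II_normal:
  assumes y: "y \<in> U"
  shows "G (F y) (II y u w) (dderiv F y z) = 0" "G (F y) (dderiv F y z) (II y u w) = 0"
proof -
  have "G (F y) (dderiv F y (levi_civita g y u w)) (dderiv F y z) = G (F y) (hess y u w) (dderiv F y z)"
    using g_levi_civita[OF y, of u w z] by (simp add: g_eq[OF y])
  then show "G (F y) (II y u w) (dderiv F y z) = 0"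
    unfolding II_def by (simp add: bilinear_lsub[OF ambient.bil[OF F_in[OF y]]])
  then show "G (F y) (dderiv F y z) (II y u w) = 0"
    using ambient.sym[OF F_in[OF y]] by simp
qed

lemma II_commute: "y \<in> U \<Longrightarrow> II y u w = II y w u"
  unfolding II_def using hess_commute induced.levi_civita_commute by metis

lemma bilinear_II:
  assumes y: "y \<in> U"
  shows "bilinear (II y)"
proof -
  note b = ambient.bilinear_levi_civita[OF F_in[OF y]] and l = linear_dF[OF y]
    and c = induced.bilinear_levi_civita[OF y]
  have "linear (II y u)" for u
  proof (rule linearI)
    fix w w' r
    have "((\<lambda>y. dderiv F y (w + w')) has_derivative
        (\<lambda>u. dderiv (\<lambda>y. dderiv F y w) y u + dderiv (\<lambda>y. dderiv F y w') y u)) (at y)"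
      by (rule has_derivative_transform_within_open[OF has_derivative_add[OF ddF[OF y] ddF[OF y]] open_U y])
        (simp add: linear_add[OF linear_dF])
    from dderiv_eq[OF this]
    show "II y u (w + w') = II y u w + II y u w'"
      unfolding II_def hess_def
      by (simp add: linear_add[OF l] bilinear_radd[OF b] bilinear_radd[OF c])
    have "((\<lambda>y. dderiv F y (r *\<^sub>R w)) has_derivative (\<lambda>u. r *\<^sub>R dderiv (\<lambda>y. dderiv F y w) y u)) (at y)"
      by (rule has_derivative_transform_within_open[OF has_derivative_scaleR_right[OF ddF[OF y]] open_U y])
        (simp add: linear_scale[OF linear_dF])
    from dderiv_eq[OF this]
    show "II y u (r *\<^sub>R w) = r *\<^sub>R II y u w"
      unfolding II_def hess_def
      by (simp add: linear_scale[OF l] bilinear_rmul[OF b] bilinear_rmul[OF c] algebra_simps)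
  qed
  moreover then have "linear (\<lambda>u. II y u w)" for w
    by (subst II_commute[OF y])
  ultimately show ?thesis by (simp add: bilinear_def)
qed

text \<open>Both sides of \<open>g(\<nabla>\<^sub>v w, z) = G(hess(v, w), dF z)\<close> are differentiated in the direction \<open>u\<close>.\<close>

lemma gauss_aux:
  assumes y: "y \<in> U"
  shows "g y (dderiv (\<lambda>y. levi_civita g y v w) y u + levi_civita g y u (levi_civita g y v w)) z
    = G (F y) (dderiv (\<lambda>y. hess y v w) y u + levi_civita G (F y) (dderiv F y u) (hess y v w)) (dderiv F y z)
      + G (F y) (II y v w) (II y u z)"
proof -
  note b = ambient.bil[OF F_in[OF y]] and bg = induced.bil[OF y]
  have dB: "((\<lambda>y. hess y v w) has_derivative dderiv (\<lambda>y. hess y v w) y) (at y)"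
    by (rule has_derivative_dderiv[OF differentiableI[OF hess_has_derivative[OF y]]])
  have dc: "((\<lambda>y. levi_civita g y v w) has_derivative dderiv (\<lambda>y. levi_civita g y v w) y) (at y)"
    by (rule has_derivative_dderiv[OF induced_levi_civita_diff[OF y]])
  \<comment> \<open>The constant field \<open>z\<close> has derivative 0, which accounts for the
    last summand.\<close>
  have 1: "((\<lambda>y. g y (levi_civita g y v w) z) has_derivative
     (\<lambda>u. dderiv (\<lambda>p. g p (levi_civita g y v w) z) y u + g y (dderiv (\<lambda>y. levi_civita g y v w) y u) z
          + g y (levi_civita g y v w) 0)) (at y)"
    by (rule has_derivative_bilinear_field[OF open_U y induced.bil induced.diff[OF y]
          has_derivative_ident dc has_derivative_const])
  have 2: "((\<lambda>y. g y (levi_civita g y v w) z) has_derivative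
     (\<lambda>u. G (F y) (dderiv (\<lambda>y. hess y v w) y u + levi_civita G (F y) (dderiv F y u) (hess y v w)) (dderiv F y z)
       + G (F y) (hess y v w) (hess y u z))) (at y)"
    using has_derivative_transform_within_open[OF metric_product_rule[OF y dB ddF[OF y]] open_U y g_levi_civita[symmetric]]
    unfolding hess_def[of y _ z] .
  from has_derivative_unique[OF 1 2]
  have "dderiv (\<lambda>p. g p (levi_civita g y v w) z) y u + g y (dderiv (\<lambda>y. levi_civita g y v w) y u) z
     = G (F y) (dderiv (\<lambda>y. hess y v w) y u + levi_civita G (F y) (dderiv F y u) (hess y v w)) (dderiv F y z)
       + G (F y) (hess y v w) (hess y u z)"
    by (simp add: fun_eq_iff bilinear_rzero[OF bg])
  moreover have "dderiv (\<lambda>p. g p (levi_civita g y v w) z) y u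
     = g y (levi_civita g y u (levi_civita g y v w)) z + g y (levi_civita g y v w) (levi_civita g y u z)"
    by (rule induced.metric_compatible[OF y])
  \<comment> \<open>Tangential and normal parts are orthogonal. The product of the tangential parts
    is the term that compatibility of \<open>g\<close> produces on the other side, and it
    cancels.\<close>
  moreover have "G (F y) (hess y v w) (hess y u z) = G (F y) (II y v w) (II y u z) + g y (levi_civita g y v w) (levi_civita g y u z)"
  proof -
    have "hess y v w = II y v w + dderiv F y (levi_civita g y v w)" "hess y u z = II y u z + dderiv F y (levi_civita g y u z)"
      by (simp_all add: II_def)
    then show ?thesis
      by (simp add: bilinear_ladd[OF b] bilinear_radd[OF b] II_normal[OF y] g_eq[OF y])
  qed
  ultimately show ?thesis by (simp add: bilinear_ladd[OF bg])
qed

text \<open>This is the commutator of covariant derivatives along \<open>F\<close>, applied to the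
  image of the constant \<open>w\<close>. Third derivatives of \<open>F\<close> cancel by symmetry,
  and so do the terms in which a second derivative of \<open>F\<close> enters the connection; the
  ambient curvature on image vectors is left.\<close>

lemma curv_eq_commutator:
  assumes y: "y \<in> U"
  shows "dderiv (\<lambda>y. hess y v w) y u + levi_civita G (F y) (dderiv F y u) (hess y v w)
       - (dderiv (\<lambda>y. hess y u w) y v + levi_civita G (F y) (dderiv F y v) (hess y u w))
     = curv G (F y) (dderiv F y u) (dderiv F y v) (dderiv F y w)"
proof -
  note b = ambient.bilinear_levi_civita[OF F_in[OF y]]
  have "dderiv (\<lambda>y. dderiv (\<lambda>y. dderiv F y w) y v) y u = dderiv (\<lambda>y. dderiv (\<lambda>y. dderiv F y w) y u) y v"
    by (rule dderiv_commute[OF open_U y smooth_on_dderiv[OF smooth_F]])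
  moreover have "dderiv (\<lambda>y. dderiv F y u) y v = dderiv (\<lambda>y. dderiv F y v) y u"
    by (rule dderiv_commute[OF open_U y smooth_F])
  ultimately show ?thesis
    unfolding dderiv_eq[OF hess_has_derivative[OF y]] unfolding hess_def curv_def
    by (simp add: bilinear_radd[OF b])
qed

lemma gauss_equation:
  assumes y: "y \<in> U"
  shows "g y (curv g y u v w) z
    = G (F y) (curv G (F y) (dderiv F y u) (dderiv F y v) (dderiv F y w)) (dderiv F y z)
      + G (F y) (II y v w) (II y u z) - G (F y) (II y u w) (II y v z)"
  unfolding curv_eq_commutator[OF y, symmetric] curv_def[of g]
  using gauss_aux[OF y, of v w u z] gauss_aux[OF y, of u w v z]
  by (simp add: bilinear_lsub[OF induced.bil[OF y]] bilinear_lsub[OF ambient.bil[OF F_in[OF y]]])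

end


section \<open>Charts and tangent vectors\<close>

lemma linear_component: "linear (\<lambda>v. v c)"
  by (rule linearI) (simp_all add: plus_fun_def scaleR_fun_def)

lemma cmap_in: "p \<in> cdom c \<Longrightarrow> cmap c p \<in> cran c"
  unfolding cran_def by blast

context
  fixes A :: "('a::{t2_space,second_countable_topology}, 'e::euclidean_space) chart set"
  assumes A: "smooth_atlas A"
begin

lemma chart_open: "c \<in> A \<Longrightarrow> open (cdom c)" "c \<in> A \<Longrightarrow> open (cran c)"
  using A unfolding smooth_atlas_def by blast+

lemma chart_homeomorphism: "c \<in> A \<Longrightarrow> homeomorphism (cdom c) (cran c) (cmap c) (cinv c)"
  using A unfolding smooth_atlas_def by blast

lemma cinv_cmap: "c \<in> A \<Longrightarrow> p \<in> cdom c \<Longrightarrow> cinv c (cmap c p) = p"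
  using chart_homeomorphism unfolding homeomorphism_def by blast

lemma cmap_cinv: "c \<in> A \<Longrightarrow> y \<in> cran c \<Longrightarrow> cmap c (cinv c y) = y"
  using chart_homeomorphism unfolding homeomorphism_def by blast

lemma cinv_in: "c \<in> A \<Longrightarrow> y \<in> cran c \<Longrightarrow> cinv c y \<in> cdom c"
  using chart_homeomorphism unfolding homeomorphism_def by blast

text \<open>The image is the preimage of \<open>W\<close> under the inverse, which is continuous on
  the open range of the chart.\<close>

lemma open_cmap_image:
  assumes c: "c \<in> A" and W: "open W" "W \<subseteq> cdom c"
  shows "open (cmap c ` W)"
proof -
  have "cmap c ` W = cinv c -` W \<inter> cran c"
  proof (intro equalityI subsetI)
    fix y assume "y \<in> cmap c ` W"
    then obtain x where x: "y = cmap c x" "x \<in> W" by blast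
    then have "x \<in> cdom c" using W by blast
    then show "y \<in> cinv c -` W \<inter> cran c" using x cinv_cmap[OF c] cmap_in[of x c] by simp
  next
    fix y assume "y \<in> cinv c -` W \<inter> cran c"
    then show "y \<in> cmap c ` W" using cmap_cinv[OF c, of y] by (intro image_eqI[of _ _ "cinv c y"]) simp_all
  qed
  moreover have "continuous_on (cran c) (cinv c)"
    using chart_homeomorphism[OF c] by (simp add: homeomorphism_def)
  ultimately show ?thesis
    using continuous_on_open_vimage[OF chart_open(2)[OF c], of "cinv c"] W(1) by simp
qed

lemma transition_has_derivative:
  assumes "c \<in> A" "c' \<in> A" "p \<in> cdom c" "p \<in> cdom c'"
  shows "((cmap c' \<circ> cinv c) has_derivative chart_change c c' p) (at (cmap c p))"
proof -
  have "smooth_on (cmap c ` (cdom c \<inter> cdom c')) (cmap c' \<circ> cinv c)"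
    using A assms unfolding smooth_atlas_def by blast
  then have "(cmap c' \<circ> cinv c) differentiable (at (cmap c p))"
    using assms by (intro smooth_on_differentiable) auto
  then show ?thesis unfolding chart_change_def by (rule has_derivative_dderiv)
qed

lemma linear_chart_change:
  assumes "c \<in> A" "c' \<in> A" "p \<in> cdom c" "p \<in> cdom c'"
  shows "linear (chart_change c c' p)"
  using transition_has_derivative[OF assms] has_derivative_linear by blast

text \<open>Chain rule for coordinate changes. The composition agrees with the direct change only on
  the overlap of \<open>c\<close> and \<open>c'\<close>, the open set on which the derivative is
  transferred.\<close>

lemma chart_change_compose:
  assumes "c \<in> A" "c' \<in> A" "c'' \<in> A" "p \<in> cdom c" "p \<in> cdom c'" "p \<in> cdom c''"
  shows "chart_change c' c'' p (chart_change c c' p u) = chart_change c c'' p u"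
proof -
  let ?W = "cmap c ` (cdom c \<inter> cdom c')"
  have "((cmap c'' \<circ> cinv c') has_derivative chart_change c' c'' p) (at ((cmap c' \<circ> cinv c) (cmap c p)))"
    using transition_has_derivative[of c' c'' p] assms by (simp add: cinv_cmap)
  from diff_chain_at[OF transition_has_derivative[OF assms(1,2,4,5)] this]
  have "((cmap c'' \<circ> cinv c') \<circ> (cmap c' \<circ> cinv c) has_derivative chart_change c' c'' p \<circ> chart_change c c' p)
      (at (cmap c p))" .
  moreover have "open ?W" using assms by (intro open_cmap_image open_Int chart_open) auto
  ultimately have "((cmap c'' \<circ> cinv c) has_derivative chart_change c' c'' p \<circ> chart_change c c' p) (at (cmap c p))"
    by (rule has_derivative_transform_within_open) (use assms in \<open>auto simp: cinv_cmap\<close>)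
  from has_derivative_unique[OF this transition_has_derivative[OF assms(1,3,4,6)]]
  show ?thesis by (auto dest: fun_cong[of _ _ u])
qed

lemma chart_change_same:
  assumes "c \<in> A" "p \<in> cdom c"
  shows "chart_change c c p u = u"
proof -
  have "((cmap c \<circ> cinv c) has_derivative (\<lambda>x. x)) (at (cmap c p))"
    by (rule has_derivative_transform_within_open[OF has_derivative_ident chart_open(2)[OF assms(1)] cmap_in[OF assms(2)]])
      (simp add: cmap_cinv[OF assms(1)])
  from has_derivative_unique[OF this transition_has_derivative[OF assms(1,1,2,2)]]
  show ?thesis by (rule fun_cong[symmetric])
qed

lemma chart_change_component:
  assumes "v \<in> tangent_space A p" "c \<in> A" "c' \<in> A" "p \<in> cdom c" "p \<in> cdom c'"
  shows "chart_change c c' p (v c) = v c'"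
proof -
  have "\<forall>c\<in>A. \<forall>c'\<in>A. p \<in> cdom c \<inter> cdom c' \<longrightarrow> v c' = chart_change c c' p (v c)"
    using assms(1)[unfolded tangent_space_def mem_Collect_eq] by (rule conjunct1)
  then show ?thesis using assms(2-5) by (metis IntI)
qed

lemma tvec_of_component: "c \<in> A \<Longrightarrow> p \<in> cdom c \<Longrightarrow> tvec_of A c p u c = u"
  by (simp add: tvec_of_def chart_change_same)

lemma tvec_of_in: "c \<in> A \<Longrightarrow> p \<in> cdom c \<Longrightarrow> tvec_of A c p u \<in> tangent_space A p"
  unfolding tangent_space_def tvec_of_def by (auto simp: chart_change_compose)

text \<open>On charts around \<open>p\<close> this is the transformation law; on all others both
  sides have the default value 0.\<close>

lemma tvec_of_eq:
  assumes "c \<in> A" "p \<in> cdom c" "v \<in> tangent_space A p"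
  shows "tvec_of A c p (v c) = v"
proof (rule ext)
  fix c'
  show "tvec_of A c p (v c) c' = v c'"
  proof (cases "c' \<in> A \<and> p \<in> cdom c'")
    case True
    then show ?thesis using chart_change_component[OF assms(3,1) _ assms(2), of c'] by (simp add: tvec_of_def)
  next
    case False
    moreover have "\<forall>c. \<not> (c \<in> A \<and> p \<in> cdom c) \<longrightarrow> v c = 0"
      using assms(3)[unfolded tangent_space_def mem_Collect_eq] by (rule conjunct2)
    ultimately have "v c' = 0" by blast
    with False show ?thesis unfolding tvec_of_def by (simp only: if_False)
  qed
qed

lemma tvec_of_chart_change:
  assumes "c \<in> A" "c' \<in> A" "p \<in> cdom c" "p \<in> cdom c'"
  shows "tvec_of A c' p (chart_change c c' p u) = tvec_of A c p u"
  unfolding tvec_of_def using assms by (auto simp: chart_change_compose)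

lemma linear_tvec_of:
  assumes "c \<in> A" "p \<in> cdom c"
  shows "linear (tvec_of A c p)"
proof (rule linearI; rule ext)
  fix u w :: 'e and r :: real and c'
  note l = linear_chart_change[OF assms(1) _ assms(2), of c']
  show "tvec_of A c p (u + w) c' = (tvec_of A c p u + tvec_of A c p w) c'"
    by (simp add: tvec_of_def plus_fun_def linear_add[OF l])
  show "tvec_of A c p (r *\<^sub>R u) c' = (r *\<^sub>R tvec_of A c p u) c'"
    by (simp add: tvec_of_def scaleR_fun_def linear_scale[OF l])
qed

text \<open>Any chart around \<open>p\<close> thus identifies the tangent space with the model
  space, from which its linear structure and its dimension are read off.\<close>

lemma tangent_space_eq_range:
  assumes "c \<in> A" "p \<in> cdom c"
  shows "tangent_space A p = range (tvec_of A c p)"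
proof (intro equalityI subsetI)
  fix v assume "v \<in> tangent_space A p"
  then show "v \<in> range (tvec_of A c p)" using tvec_of_eq[OF assms] by (metis rangeI)
qed (use tvec_of_in[OF assms] in auto)

lemma inj_tvec_of: "c \<in> A \<Longrightarrow> p \<in> cdom c \<Longrightarrow> inj (tvec_of A c p)"
  by (metis injI tvec_of_component)

lemma subspace_tangent_space:
  assumes "c \<in> A" "p \<in> cdom c"
  shows "subspace (tangent_space A p)"
  unfolding tangent_space_eq_range[OF assms]
  by (rule linear_subspace_image[OF linear_tvec_of[OF assms] subspace_UNIV])

lemma tangent_space_span:
  assumes "c \<in> A" "p \<in> cdom c"
  shows "tangent_space A p = span (tvec_of A c p ` Basis)"
  unfolding tangent_space_eq_range[OF assms] linear_span_image[OF linear_tvec_of[OF assms]]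
  by simp

lemma dim_tangent_space:
  assumes "c \<in> A" "p \<in> cdom c"
  shows "dim (tangent_space A p) = DIM('e)"
proof -
  have "independent (tvec_of A c p ` Basis)"
    by (rule linear_independent_injective_image[OF linear_tvec_of[OF assms] independent_Basis])
      (rule inj_on_subset[OF inj_tvec_of[OF assms]], simp)
  then have "dim (tangent_space A p) = card (tvec_of A c p ` Basis)"
    unfolding tangent_space_span[OF assms] by (rule dim_span_eq_card_independent)
  also have "\<dots> = DIM('e)" by (rule card_image) (rule inj_on_subset[OF inj_tvec_of[OF assms]], simp)
  finally show ?thesis .
qed

lemma chart_at:
  assumes "p \<in> manifold_carrier A"
  shows "chart_at A p \<in> A" "p \<in> cdom (chart_at A p)"
proof -
  have "\<exists>c. c \<in> A \<and> p \<in> cdom c" using assms unfolding manifold_carrier_def by blast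
  from someI_ex[OF this] show "chart_at A p \<in> A" "p \<in> cdom (chart_at A p)"
    unfolding chart_at_def by blast+
qed

end

lemma inner_product_on_tangent_space:
  assumes A: "smooth_atlas A" and g: "riemannian_metric A g" and p: "p \<in> manifold_carrier A"
  shows "inner_product_on (tangent_space A p) (g p)"
proof
  note c = chart_at[OF A p]
  have *: "\<And>u v. u \<in> tangent_space A p \<Longrightarrow> v \<in> tangent_space A p \<Longrightarrow> g p u v = g p v u"
    "\<And>u v w. u \<in> tangent_space A p \<Longrightarrow> v \<in> tangent_space A p \<Longrightarrow> w \<in> tangent_space A p \<Longrightarrow>
      g p (u + v) w = g p u w + g p v w"
    "\<And>u v r. u \<in> tangent_space A p \<Longrightarrow> v \<in> tangent_space A p \<Longrightarrow> g p (r *\<^sub>R u) v = r * g p u v"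
    "\<And>u. u \<in> tangent_space A p \<Longrightarrow> u \<noteq> 0 \<Longrightarrow> g p u u > 0"
    using g p unfolding riemannian_metric_def by blast+
  show sub: "subspace (tangent_space A p)" by (rule subspace_tangent_space[OF A c])
  show "\<exists>S. finite S \<and> tangent_space A p \<subseteq> span S"
    using tangent_space_span[OF A c]
    by (intro exI[of _ "tvec_of A (chart_at A p) p ` Basis"]) simp
  show "u \<in> tangent_space A p \<Longrightarrow> v \<in> tangent_space A p \<Longrightarrow> g p u v = g p v u" for u v by (rule *)
  show "u \<in> tangent_space A p \<Longrightarrow> u \<noteq> 0 \<Longrightarrow> g p u u > 0" for u by (rule *)
  show "bilinear_on (tangent_space A p) (g p)"
    unfolding bilinear_on_def
  proof (intro ballI conjI allI)
    fix u v w r assume u: "u \<in> tangent_space A p" and v: "v \<in> tangent_space A p"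
    show r: "g p (r *\<^sub>R u) v = r *\<^sub>R g p u v" by (simp add: *(3) u v)
    show "g p v (r *\<^sub>R u) = r *\<^sub>R g p v u"
      unfolding *(1)[OF v subspace_scale[OF sub u]] *(1)[OF v u] by (rule r)
    assume w: "w \<in> tangent_space A p"
    show a: "g p (u + w) v = g p u v + g p w v" by (rule *(2)[OF u w v])
    show "g p v (u + w) = g p v u + g p v w"
      unfolding *(1)[OF v subspace_add[OF sub u w]] *(1)[OF v u] *(1)[OF v w] by (rule a)
  qed
qed

lemma smooth_local_metric_coord:
  assumes A: "smooth_atlas A" and g: "riemannian_metric A g" and c: "c \<in> A"
  shows "smooth_local_metric (cran c) (metric_coord A g c)"
proof
  show "open (cran c)" by (rule chart_open[OF A c])
  have sm: "smooth_on (cran c) (\<lambda>y. metric_coord A g c y u w)" for u w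
  proof -
    have "\<forall>c\<in>A. \<forall>u w. smooth_on (cran c) (\<lambda>y. metric_coord A g c y u w)"
      using g unfolding riemannian_metric_def by (rule conjunct2)
    then show ?thesis using c by simp
  qed
  fix y u w v assume y: "y \<in> cran c"
  define p where "p = cinv c y"
  have p: "p \<in> cdom c" unfolding p_def by (rule cinv_in[OF A c y])
  then have pA: "p \<in> manifold_carrier A" using c unfolding manifold_carrier_def by blast
  interpret inner_product_on "tangent_space A p" "g p"
    by (rule inner_product_on_tangent_space[OF A g pA])
  note l = linear_tvec_of[OF A c p] and t = tvec_of_in[OF A c p]
  show "bilinear (metric_coord A g c y)"
    unfolding bilinear_def metric_coord_def p_def[symmetric]
    by (intro conjI allI linearI) (simp_all add: linear_add[OF l] linear_scale[OF l] add scale t)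
  show "metric_coord A g c y u w = metric_coord A g c y w u"
    unfolding metric_coord_def p_def[symmetric] by (rule commute[OF t t])
  show "u \<noteq> 0 \<Longrightarrow> metric_coord A g c y u u > 0"
    unfolding metric_coord_def p_def[symmetric]
    using pos[OF t] linear_0[OF l] inj_tvec_of[OF A c p] by (metis injD)
  show "(\<lambda>y. metric_coord A g c y u w) differentiable (at y)"
    by (rule smooth_on_differentiable[OF sm y])
  show "(\<lambda>y. dderiv (\<lambda>y. metric_coord A g c y u w) y v) differentiable (at y)"
    by (rule smooth_on_differentiable[OF smooth_on_dderiv[OF sm] y])
qed

lemma metric_eq_metric_coord:
  assumes A: "smooth_atlas A" and c: "c \<in> A" "p \<in> cdom c"
  shows "g p (tvec_of A c p u) (tvec_of A c p w) = metric_coord A g c (cmap c p) u w"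
  by (simp add: metric_coord_def cinv_cmap[OF A c])

section \<open>Immersions read in charts\<close>

locale immersed_submanifold =
  fixes A :: "('a::{t2_space,second_countable_topology}, 'e::euclidean_space) chart set"
    and B :: "('b::{t2_space,second_countable_topology}, 'f::euclidean_space) chart set"
    and gb :: "('b, 'f) metric" and f :: "'a \<Rightarrow> 'b"
  assumes atlas_A: "smooth_atlas A" and atlas_B: "smooth_atlas B"
    and metric_B: "riemannian_metric B gb" and immersion: "immersion A B f"
begin

lemma continuous_f: "continuous_on (manifold_carrier A) f"
  and f_in: "p \<in> manifold_carrier A \<Longrightarrow> f p \<in> manifold_carrier B"
  and inj_differential: "p \<in> manifold_carrier A \<Longrightarrow> inj_on (differential A B f p) (tangent_space A p)"
  and smooth_local_rep:
    "c \<in> A \<Longrightarrow> c' \<in> B \<Longrightarrow> smooth_on (cmap c ` (cdom c \<inter> f -` cdom c')) (local_rep c c' f)"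
proof -
  note im = immersion[unfolded immersion_def]
  show "continuous_on (manifold_carrier A) f" by (rule im[THEN conjunct1])
  show "p \<in> manifold_carrier A \<Longrightarrow> f p \<in> manifold_carrier B"
    using im[THEN conjunct2, THEN conjunct1] by (rule subsetD[OF _ imageI])
  show "p \<in> manifold_carrier A \<Longrightarrow> inj_on (differential A B f p) (tangent_space A p)"
    by (rule im[THEN conjunct2, THEN conjunct2, THEN conjunct2, rule_format])
  show "c \<in> A \<Longrightarrow> c' \<in> B \<Longrightarrow> smooth_on (cmap c ` (cdom c \<inter> f -` cdom c')) (local_rep c c' f)"
    by (rule im[THEN conjunct2, THEN conjunct2, THEN conjunct1, rule_format])
qed

abbreviation "chart_dom c c' \<equiv> cmap c ` (cdom c \<inter> f -` cdom c')"

lemma open_chart_dom: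
  assumes "c \<in> A" "c' \<in> B"
  shows "open (chart_dom c c')"
proof (rule open_cmap_image[OF atlas_A assms(1)])
  have "continuous_on (cdom c) f"
  proof (rule continuous_on_subset)
    show "continuous_on (manifold_carrier A) f" by (rule continuous_f)
    show "cdom c \<subseteq> manifold_carrier A" using assms(1) unfolding manifold_carrier_def by (rule UN_upper)
  qed
  then have "open (f -` cdom c' \<inter> cdom c)"
    using continuous_on_open_vimage[OF chart_open(1)[OF atlas_A assms(1)], of f] chart_open(1)[OF atlas_B assms(2)] by simp
  then show "open (cdom c \<inter> f -` cdom c')" by (simp add: Int_commute)
qed auto

lemma local_rep_has_derivative:
  assumes "c \<in> A" "c' \<in> B" "p \<in> cdom c" "f p \<in> cdom c'"
  shows "(local_rep c c' f has_derivative dderiv (local_rep c c' f) (cmap c p)) (at (cmap c p))"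
  using assms by (intro has_derivative_dderiv smooth_on_differentiable[OF smooth_local_rep]) auto

text \<open>Chain rule through the two coordinate changes. The underlying identity of maps holds
  where both \<open>c1\<close> and the preimage of \<open>c1'\<close> are available, an open set
  around the point.\<close>

lemma local_rep_chart_change:
  assumes c: "c \<in> A" "c1 \<in> A" "p \<in> cdom c" "p \<in> cdom c1"
    and c': "c' \<in> B" "c1' \<in> B" "f p \<in> cdom c'" "f p \<in> cdom c1'"
  shows "dderiv (local_rep c c' f) (cmap c p) u =
    chart_change c1' c' (f p) (dderiv (local_rep c1 c1' f) (cmap c1 p) (chart_change c c1 p u))"
proof -
  have [simp]: "cinv c (cmap c p) = p" "cinv c1 (cmap c1 p) = p"
    using c by (simp_all add: cinv_cmap[OF atlas_A])
  have 1: "(local_rep c1 c1' f has_derivative dderiv (local_rep c1 c1' f) (cmap c1 p))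
     (at ((cmap c1 \<circ> cinv c) (cmap c p)))"
    using local_rep_has_derivative[OF c(2) c'(2) c(4) c'(4)] by simp
  note 2 = diff_chain_at[OF transition_has_derivative[OF atlas_A c] 1]
  have 3: "((cmap c' \<circ> cinv c1') has_derivative chart_change c1' c' (f p))
     (at ((local_rep c1 c1' f \<circ> (cmap c1 \<circ> cinv c)) (cmap c p)))"
    using transition_has_derivative[OF atlas_B c'(2,1,4,3)] by (simp add: local_rep_def)
  note 4 = diff_chain_at[OF 2 3]
  have "open (cmap c ` (cdom c \<inter> f -` cdom c1') \<inter> cmap c ` (cdom c \<inter> cdom c1))"
    using c c' by (intro open_Int open_chart_dom open_cmap_image[OF atlas_A] chart_open[OF atlas_A]) auto
  moreover have "cmap c p \<in> cmap c ` (cdom c \<inter> f -` cdom c1') \<inter> cmap c ` (cdom c \<inter> cdom c1)"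
    using c c' by auto
  ultimately have "(local_rep c c' f has_derivative
      chart_change c1' c' (f p) \<circ> (dderiv (local_rep c1 c1' f) (cmap c1 p) \<circ> chart_change c c1 p)) (at (cmap c p))"
  proof (rule has_derivative_transform_within_open[OF 4])
    fix y assume y: "y \<in> cmap c ` (cdom c \<inter> f -` cdom c1') \<inter> cmap c ` (cdom c \<inter> cdom c1)"
    then obtain x z where "y = cmap c x" "x \<in> cdom c \<inter> f -` cdom c1'"
      "y = cmap c z" "z \<in> cdom c \<inter> cdom c1" by blast
    then have "cinv c y \<in> cdom c \<inter> f -` cdom c1'" "cinv c y \<in> cdom c1"
      using cinv_cmap[OF atlas_A c(1)] by (metis IntD1, metis IntD1 IntD2)
    then show "((cmap c' \<circ> cinv c1') \<circ> (local_rep c1 c1' f \<circ> (cmap c1 \<circ> cinv c))) y = local_rep c c' f y"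
      using c c' by (simp add: local_rep_def cinv_cmap[OF atlas_A] cinv_cmap[OF atlas_B])
  qed
  from dderiv_eq[OF this] show ?thesis by simp
qed

text \<open>\<open>differential\<close> is defined by the charts chosen at \<open>p\<close>, which
  may vary with \<open>p\<close>. The induced metric can be differentiated in the base point only
  once a single pair of charts computes \<open>differential\<close> at all nearby points.\<close>

lemma differential_eq:
  assumes c: "c \<in> A" "p \<in> cdom c" and c': "c' \<in> B" "f p \<in> cdom c'" and v: "v \<in> tangent_space A p"
  shows "differential A B f p v = tvec_of B c' (f p) (dderiv (local_rep c c' f) (cmap c p) (v c))"
proof -
  have p: "p \<in> manifold_carrier A" using c unfolding manifold_carrier_def by blast
  note c0 = chart_at[OF atlas_A p] and c0' = chart_at[OF atlas_B f_in[OF p]]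
  have "chart_change (chart_at A p) c p (v (chart_at A p)) = v c"
    by (rule chart_change_component[OF atlas_A v c0(1) c(1) c0(2) c(2)])
  then show ?thesis
    unfolding differential_def Let_def
      local_rep_chart_change[OF c0(1) c(1) c0(2) c(2) c0'(1) c'(1) c0'(2) c'(2)]
    by (simp add: tvec_of_chart_change[OF atlas_B c'(1) c0'(1) c'(2) c0'(2)])
qed

text \<open>Picking out one component is linear on all families, not only on tangent vectors;
  general facts on images of spans and subspaces under linear maps therefore apply.\<close>

lemma linear_differential:
  assumes p: "p \<in> manifold_carrier A"
  shows "linear (differential A B f p)"
proof -
  note c = chart_at[OF atlas_A p] and c' = chart_at[OF atlas_B f_in[OF p]]
  have "linear (dderiv (local_rep (chart_at A p) (chart_at B (f p)) f) (cmap (chart_at A p) p))"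
    using local_rep_has_derivative[OF c(1) c'(1) c(2) c'(2)] has_derivative_linear by blast
  from linear_compose[OF linear_compose[OF linear_component[of "chart_at A p"] this] linear_tvec_of[OF atlas_B c']]
  show ?thesis unfolding differential_def[abs_def] Let_def by (simp add: o_def)
qed

lemma differential_in:
  assumes "p \<in> manifold_carrier A"
  shows "differential A B f p v \<in> tangent_space B (f p)"
  unfolding differential_def Let_def by (rule tvec_of_in[OF atlas_B chart_at[OF atlas_B f_in[OF assms]]])

lemma local_immersion:
  assumes c: "c \<in> A" and c': "c' \<in> B"
  shows "local_immersion (cran c') (metric_coord B gb c') (chart_dom c c') (local_rep c c' f)
     (metric_coord A (induced_metric A B gb f) c)"
proof -
  interpret smooth_local_metric "cran c'" "metric_coord B gb c'"
    by (rule smooth_local_metric_coord[OF atlas_B metric_B c'])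
  show ?thesis
  proof
    show "open (chart_dom c c')" by (rule open_chart_dom[OF c c'])
    show "smooth_on (chart_dom c c') (local_rep c c' f)" by (rule smooth_local_rep[OF c c'])
    fix y u w assume "y \<in> chart_dom c c'"
    then obtain p where p: "y = cmap c p" "p \<in> cdom c" "f p \<in> cdom c'" by auto
    have pA: "p \<in> manifold_carrier A" using p(2) c unfolding manifold_carrier_def by blast
    have inv: "cinv c y = p" using p by (simp add: cinv_cmap[OF atlas_A c])
    then have Fy: "local_rep c c' f y = cmap c' (f p)" by (simp add: local_rep_def)
    then show "local_rep c c' f y \<in> cran c'" using p(3) by (simp add: cmap_in)
    note t = tvec_of_in[OF atlas_A c p(2)]
    have d: "differential A B f p (tvec_of A c p u) = tvec_of B c' (f p) (dderiv (local_rep c c' f) y u)" for u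
      using differential_eq[OF c p(2) c' p(3) t] tvec_of_component[OF atlas_A c p(2)] p(1) by simp
    show "metric_coord A (induced_metric A B gb f) c y u w =
       metric_coord B gb c' (local_rep c c' f y) (dderiv (local_rep c c' f) y u) (dderiv (local_rep c c' f) y w)"
      unfolding metric_coord_def inv Fy induced_metric_def d by (simp add: cinv_cmap[OF atlas_B c' p(3)])
    assume "dderiv (local_rep c c' f) y u = 0"
    then have "differential A B f p (tvec_of A c p u) = differential A B f p 0"
      using d[of u] linear_0[OF linear_tvec_of[OF atlas_B c' p(3)]] linear_0[OF linear_differential[OF pA]] by simp
    then have "tvec_of A c p u = 0"
      using inj_onD[OF inj_differential[OF pA]] t subspace_0[OF subspace_tangent_space[OF atlas_A c p(2)]] by blast
    then show "u = 0"
      using linear_0[OF linear_tvec_of[OF atlas_A c p(2)]] inj_tvec_of[OF atlas_A c p(2)] by (metis injD)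
  qed
qed

end


section \<open>Mutual curvature\<close>

lemma is_onb_iff: "is_onb g p V E \<longleftrightarrow> orthonormal_basis (g p) V E"
  unfolding is_onb_def orthonormal_basis_def ..

lemma onb:
  assumes "inner_product_on T (g p)" "subspace V" "V \<subseteq> T"
  shows "orthonormal_basis (g p) V (onb g p V)"
proof -
  have "\<exists>E. is_onb g p V E"
    unfolding is_onb_iff using assms by (intro inner_product_on.onb_exists)
  from someI_ex[OF this] show ?thesis unfolding onb_def is_onb_iff .
qed

lemma bilinear_on_component:
  assumes "bilinear b"
  shows "bilinear_on V (\<lambda>u v. b (u c) (v c))"
  unfolding bilinear_on_def
  by (simp add: plus_fun_def scaleR_fun_def bilinear_ladd[OF assms] bilinear_radd[OF assms]
      bilinear_lmul[OF assms] bilinear_rmul[OF assms])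

text \<open>The numerator of the sectional curvature; for an orthonormal pair the denominator is
  1.\<close>

definition curv_form :: "('e::euclidean_space \<Rightarrow> 'e \<Rightarrow> 'e \<Rightarrow> real) \<Rightarrow> 'e \<Rightarrow> 'e \<Rightarrow> 'e \<Rightarrow> real" where
  "curv_form G y u v = G y (curv G y u v v) u"

lemma sectional_curvature_eq:
  assumes A: "smooth_atlas A" and p: "p \<in> manifold_carrier A"
    and u: "u \<in> tangent_space A p"
    and on: "g p u u = 1" "g p v v = 1" "g p u v = 0"
  shows "sectional_curvature A g p u v =
    curv_form (metric_coord A g (chart_at A p)) (cmap (chart_at A p) p) (u (chart_at A p)) (v (chart_at A p))"
proof -
  let ?c = "chart_at A p"
  note c = chart_at[OF A p]
  have "sectional_curvature A g p u v = g p (riemann_curvature A g p u v v) (tvec_of A ?c p (u ?c))"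
    unfolding sectional_curvature_def on tvec_of_eq[OF A c u] by simp
  then show ?thesis
    unfolding riemann_curvature_def Let_def metric_eq_metric_coord[OF A c] curvature_coord_eq_curv curv_form_def .
qed

section \<open>Continuity and compactness for the curvature form\<close>

context smooth_local_metric
begin

text \<open>\<open>curv_form\<close> is quadratic in each argument. These forms have it as their
  diagonal, one for either argument, so that a curvature sum can be moved to other bases one
  argument at a time.\<close>

lemma bilinear_curv_form:
  assumes y: "y \<in> S"
  shows "bilinear (\<lambda>a b. G y (curv G y a v v) b)" "bilinear (\<lambda>a b. G y (curv G y u a b) u)"
proof -
  have l: "linear (\<lambda>a. G y a w)" "linear (G y w)" for w
    using bil[OF y] by (auto simp: bilinear_def)
  show "bilinear (\<lambda>a b. G y (curv G y a v v) b)"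
    unfolding bilinear_def
    using linear_compose[OF curv_linear(1)[OF y, of v v] l(1)] l(2) by (simp add: o_def)
  show "bilinear (\<lambda>a b. G y (curv G y u a b) u)"
    unfolding bilinear_def
    using linear_compose[OF curv_linear(2)[OF y] l(1)] linear_compose[OF curv_linear(3)[OF y] l(1)]
    by (simp add: o_def)
qed

lemma continuous_on_metric:
  assumes y: "y \<in> S" and "continuous_on K a" "continuous_on K b"
  shows "continuous_on K (\<lambda>x. G y (a x) (b x))"
  using assms(2,3) bil[OF y]
  by (intro bounded_bilinear.continuous_on[of "G y"]) (simp_all add: bilinear_conv_bounded_bilinear)

lemma continuous_on_curv_form:
  assumes y: "y \<in> S" and a: "continuous_on K a" and b: "continuous_on K b"
  shows "continuous_on K (\<lambda>x. curv_form G y (a x) (b x))"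
proof -
  have expand: "curv G y u v w = (\<Sum>i\<in>Basis. (w \<bullet> i) *\<^sub>R curv G y u v i)" for u v w
    using linear_sum[OF curv_linear(3)[OF y, of u v], of "\<lambda>i. (w \<bullet> i) *\<^sub>R i" Basis]
    by (simp add: euclidean_representation linear_scale[OF curv_linear(3)[OF y]])
  have "bounded_bilinear (\<lambda>u v. curv G y u v i)" for i
    unfolding bilinear_conv_bounded_bilinear[symmetric] bilinear_def
    by (intro conjI allI curv_linear(1,2)[OF y])
  then have "continuous_on K (\<lambda>x. curv G y (a x) (b x) i)" for i
    using a b by (rule bounded_bilinear.continuous_on)
  then have "continuous_on K (\<lambda>x. curv G y (a x) (b x) (b x))"
    by (subst expand) (intro continuous_intros b)
  then show ?thesis unfolding curv_form_def by (intro continuous_on_metric y a)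
qed

text \<open>The minimum of the quadratic form on the unit sphere is positive, and homogeneity
  extends the bound. It controls the Euclidean norm of vectors that are orthonormal for
  \<open>G\<close>.\<close>

lemma coercive:
  assumes y: "y \<in> S"
  shows "\<exists>m>0. \<forall>v. m * (norm v)\<^sup>2 \<le> G y v v"
proof -
  have cont: "continuous_on (sphere 0 1) (\<lambda>v. G y v v)"
    by (intro continuous_on_metric y continuous_on_id)
  have ne: "sphere (0::'a) 1 \<noteq> {}" by simp
  obtain x where x: "x \<in> sphere 0 1" "\<And>v. v \<in> sphere 0 1 \<Longrightarrow> G y x x \<le> G y v v"
    using continuous_attains_inf[OF compact_sphere ne cont] by blast
  have "x \<noteq> 0" using x(1) by auto
  then have "G y x x > 0" by (rule pos[OF y])
  moreover have "G y x x * (norm v)\<^sup>2 \<le> G y v v" for v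
  proof (cases "v = 0")
    case False
    define w where "w = (1 / norm v) *\<^sub>R v"
    have "w \<in> sphere 0 1" using False by (simp add: w_def)
    then have "G y x x \<le> G y w w" by (rule x(2))
    also have "G y w w = G y v v / (norm v)\<^sup>2"
      unfolding w_def by (simp add: bilinear_lmul[OF bil[OF y]] bilinear_rmul[OF bil[OF y]] power2_eq_square)
    finally show ?thesis using False by (simp add: field_simps)
  qed (simp add: bilinear_lzero[OF bil[OF y]])
  ultimately show ?thesis by blast
qed

text \<open>A linear map \<open>L\<close> here encodes two mutually orthogonal orthonormal families, the images of \<open>I1\<close>
  and \<open>I2\<close>.\<close>

lemma curv_form_sum_attains_max:
  assumes y: "y \<in> S" and I: "I1 \<subseteq> Basis" "I2 \<subseteq> Basis"
  defines "K \<equiv> {L :: 'a \<Rightarrow>\<^sub>L 'a. (\<forall>b\<in>Basis - (I1 \<union> I2). L b = 0) \<and>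
    (\<forall>b\<in>I1 \<union> I2. \<forall>b'\<in>I1 \<union> I2. G y (L b) (L b') = (if b = b' then 1 else 0))}"
  assumes ne: "K \<noteq> {}"
  shows "\<exists>L\<in>K. \<forall>L'\<in>K. (\<Sum>a\<in>I1. \<Sum>b\<in>I2. curv_form G y (L' a) (L' b))
      \<le> (\<Sum>a\<in>I1. \<Sum>b\<in>I2. curv_form G y (L a) (L b))"
proof -
  have ev: "continuous_on UNIV (\<lambda>L :: 'a \<Rightarrow>\<^sub>L 'a. L b)" for b
    by (intro continuous_intros)
  have "closed K"
  proof -
    have "closed {L :: 'a \<Rightarrow>\<^sub>L 'a. L b = 0}" for b
      by (intro closed_Collect_eq ev continuous_on_const)
    moreover have "closed {L :: 'a \<Rightarrow>\<^sub>L 'a. G y (L b) (L b') = r}" for b b' r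
      by (intro closed_Collect_eq continuous_on_metric y ev continuous_on_const)
    moreover have "K = (\<Inter>b\<in>Basis - (I1 \<union> I2). {L :: 'a \<Rightarrow>\<^sub>L 'a. L b = 0}) \<inter>
      (\<Inter>b\<in>I1 \<union> I2. \<Inter>b'\<in>I1 \<union> I2. {L :: 'a \<Rightarrow>\<^sub>L 'a. G y (L b) (L b') = (if b = b' then 1 else 0)})"
      unfolding K_def by blast
    ultimately show ?thesis by (simp only:) (intro closed_Int closed_INT ballI)
  qed
  \<comment> \<open>Coercivity bounds the images of the selected basis vectors; the condition that
    the others go to 0 bounds the rest of the operator.\<close>
  moreover have "bounded K"
  proof -
    obtain m where m: "m > 0" "\<And>v. m * (norm v)\<^sup>2 \<le> G y v v" using coercive[OF y] by blast
    have "norm L \<le> (\<Sum>b\<in>(Basis::'a set). sqrt (1 / m))" if L: "L \<in> K" for L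
    proof -
      have "norm (L b) \<le> sqrt (1 / m)" if b: "b \<in> Basis" for b
      proof (cases "b \<in> I1 \<union> I2")
        case True
        then have "G y (L b) (L b) = 1" using L unfolding K_def by simp
        then have "(norm (L b))\<^sup>2 \<le> 1 / m" using m(1) m(2)[of "L b"] by (simp add: field_simps)
        then show ?thesis by (rule real_le_rsqrt)
      next
        case False
        then have "L b = 0" using L b unfolding K_def by blast
        then show ?thesis using m(1) by simp
      qed
      then show ?thesis by (intro order_trans[OF norm_blinfun_euclidean_le] sum_mono)
    qed
    then show ?thesis by (rule boundedI)
  qed
  ultimately have "compact K" by (simp add: compact_eq_bounded_closed)
  moreover have "continuous_on K (\<lambda>L. \<Sum>a\<in>I1. \<Sum>b\<in>I2. curv_form G y (L a) (L b))"
    by (intro continuous_on_sum continuous_on_curv_form y continuous_on_subset[OF ev]) auto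
  ultimately show ?thesis using continuous_attains_sup[OF _ ne] by blast
qed

end

locale riemannian_manifold_at =
  fixes A :: "('a::{t2_space,second_countable_topology}, 'e::euclidean_space) chart set"
    and g :: "('a, 'e) metric" and p :: 'a
  assumes atlas: "smooth_atlas A" and metric: "riemannian_metric A g" and p: "p \<in> manifold_carrier A"
begin

abbreviation "c \<equiv> chart_at A p"
abbreviation "y \<equiv> cmap c p"
abbreviation "T \<equiv> tangent_space A p"
abbreviation "G \<equiv> metric_coord A g c"

sublocale inner_product_on T "g p"
  by (rule inner_product_on_tangent_space[OF atlas metric p])

sublocale coord: smooth_local_metric "cran c" G
  by (rule smooth_local_metric_coord[OF atlas metric chart_at(1)[OF atlas p]])

lemma y_in: "y \<in> cran c" by (rule cmap_in[OF chart_at(2)[OF atlas p]])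

text \<open>Orthonormality of the pairs reduces sectional curvature to \<open>curv_form\<close>. The
  bases are then exchanged one after the other, each inner sum being the trace of a bilinear
  form.\<close>

lemma mutual_curvature_eq:
  assumes E: "orthonormal_basis (g p) V E" "orthonormal_basis (g p) W E'"
    and V: "V \<subseteq> T" "W \<subseteq> T" and orth: "\<And>v w. v \<in> V \<Longrightarrow> w \<in> W \<Longrightarrow> g p v w = 0"
  shows "mutual_curvature A g p V W = (\<Sum>u\<in>E. \<Sum>v\<in>E'. curv_form G y (u c) (v c))"
proof -
  have sub: "subspace V" "subspace W" using E unfolding orthonormal_basis_def by auto
  define F where "F = onb g p V"
  define F' where "F' = onb g p W"
  have F: "orthonormal_basis (g p) V F" "orthonormal_basis (g p) W F'"
    unfolding F_def F'_def using sub V by (auto intro: onb[where T = T and g = g and p = p, OF inner_product_on_axioms])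
  have "mutual_curvature A g p V W = (\<Sum>u\<in>F. \<Sum>v\<in>F'. curv_form G y (u c) (v c))"
    unfolding mutual_curvature_def F_def[symmetric] F'_def[symmetric]
  proof (intro sum.cong refl sectional_curvature_eq[OF atlas p])
    fix u v assume "u \<in> F" "v \<in> F'"
    then show "u \<in> T" "g p u u = 1" "g p v v = 1" "g p u v = 0"
      using F V orth unfolding orthonormal_basis_def by (blast, metis, metis, blast)
  qed
  also have "\<dots> = (\<Sum>v\<in>F'. \<Sum>u\<in>F. curv_form G y (u c) (v c))" by (rule sum.swap)
  also have "\<dots> = (\<Sum>v\<in>F'. \<Sum>u\<in>E. curv_form G y (u c) (v c))"
    unfolding curv_form_def
    by (intro sum.cong refl trace_independent[OF F(1) E(1) V(1)] bilinear_on_component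
        coord.bilinear_curv_form[OF y_in])
  also have "\<dots> = (\<Sum>u\<in>E. \<Sum>v\<in>F'. curv_form G y (u c) (v c))" by (rule sum.swap)
  also have "\<dots> = (\<Sum>u\<in>E. \<Sum>v\<in>E'. curv_form G y (u c) (v c))"
    unfolding curv_form_def
    by (intro sum.cong refl trace_independent[OF F(2) E(2) V(2)] bilinear_on_component
        coord.bilinear_curv_form[OF y_in])
  finally show ?thesis .
qed

text \<open>\<open>GREATEST\<close> has the intended value once a maximum is known to exist. The
  admissible values are exactly those of a continuous function on a compact set of linear maps:
  orthonormal bases of a pair of subspaces define such a map, and such a map spans a pair.\<close>

lemma mutual_curvature_le_max:
  assumes V: "subspace V" "V \<subseteq> T" and W: "subspace W" "W \<subseteq> T"
    and orth: "\<forall>v\<in>V. \<forall>w\<in>W. g p v w = 0"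
    and le: "dim V + dim W \<le> DIM('e)"
  shows "mutual_curvature A g p V W \<le> max_mutual_curvature A g (dim V) (dim W) p"
proof -
  note ch = chart_at[OF atlas p]
  define P where "P s \<longleftrightarrow> (\<exists>V' W'. subspace V' \<and> V' \<subseteq> T \<and> dim V' = dim V \<and>
     subspace W' \<and> W' \<subseteq> T \<and> dim W' = dim W \<and> (\<forall>v\<in>V'. \<forall>w\<in>W'. g p v w = 0) \<and>
     s = mutual_curvature A g p V' W')" for s
  \<comment> \<open>One model basis vector for each member of the two orthonormal bases;
    \<open>le\<close> guarantees that there are enough.\<close>
  obtain I where I: "I \<subseteq> (Basis::'e set)" "card I = dim V + dim W"
    by (rule obtain_subset_with_card_n[OF le]) (rule that)
  have "dim V \<le> card I" using I(2) by simp
  then obtain I1 where I1: "I1 \<subseteq> I" "card I1 = dim V"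
    by (rule obtain_subset_with_card_n) (rule that)
  define I2 where "I2 = I - I1"
  have finI: "finite I" using I(1) finite_Basis finite_subset by blast
  have I2: "card I2 = dim W" "I1 \<inter> I2 = {}" "I1 \<union> I2 = I"
    unfolding I2_def using I I1 finI by (auto simp: card_Diff_subset finite_subset)
  have I12: "I1 \<subseteq> Basis" "I2 \<subseteq> Basis" "finite I1" "finite I2"
    using I I1 finI unfolding I2_def by (auto intro: finite_subset)
  define K where "K = {L :: 'e \<Rightarrow>\<^sub>L 'e. (\<forall>b\<in>Basis - (I1 \<union> I2). L b = 0) \<and>
    (\<forall>b\<in>I1 \<union> I2. \<forall>b'\<in>I1 \<union> I2. G y (L b) (L b') = (if b = b' then 1 else 0))}"
  define \<phi> where "\<phi> L = (\<Sum>a\<in>I1. \<Sum>b\<in>I2. curv_form G y (L a) (L b))" for L :: "'e \<Rightarrow>\<^sub>L 'e"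
  have in_K: "\<exists>L\<in>K. \<phi> L = s" if Ps: "P s" for s
  proof -
    from Ps obtain V' W' where V': "subspace V'" "V' \<subseteq> T" "dim V' = dim V"
      and W': "subspace W'" "W' \<subseteq> T" "dim W' = dim W" and orth': "\<forall>v\<in>V'. \<forall>w\<in>W'. g p v w = 0"
      and s: "s = mutual_curvature A g p V' W'" unfolding P_def by (elim exE conjE) (rule that)
    obtain E where E: "orthonormal_basis (g p) V' E" using onb_exists V' by blast
    obtain E' where E': "orthonormal_basis (g p) W' E'" using onb_exists W' by blast
    have fin: "finite E" "finite E'" and sub: "E \<subseteq> V'" "E' \<subseteq> W'"
      and on: "\<And>u v. u \<in> E \<Longrightarrow> v \<in> E \<Longrightarrow> g p u v = (if u = v then 1 else 0)"
        "\<And>u v. u \<in> E' \<Longrightarrow> v \<in> E' \<Longrightarrow> g p u v = (if u = v then 1 else 0)"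
      using E E' unfolding orthonormal_basis_def by auto
    have card: "card E = card I1" "card E' = card I2"
      using onb_independent(2)[OF E V'(2)] onb_independent(2)[OF E' W'(2)] V'(3) W'(3) I1 I2 by auto
    obtain h1 where h1: "bij_betw h1 I1 E" using finite_same_card_bij[OF I12(3) fin(1)] card by auto
    obtain h2 where h2: "bij_betw h2 I2 E'" using finite_same_card_bij[OF I12(4) fin(2)] card by auto
    define h where "h b = (if b \<in> I1 then h1 b else h2 b)" for b
    have h: "b \<in> I1 \<Longrightarrow> h b = h1 b" "b \<in> I2 \<Longrightarrow> h b = h2 b" for b
      using I2(2) unfolding h_def by auto
    \<comment> \<open>Sends each selected basis vector to the coordinates of the member assigned to
      it and annihilates the rest of \<open>Basis\<close>.\<close>
    define l where "l x = (\<Sum>b\<in>I. (x \<bullet> b) *\<^sub>R h b c)" for x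
    have "bounded_linear l"
      unfolding linear_conv_bounded_linear[symmetric] l_def
      by (intro linear_compose_sum ballI linearI) (simp_all add: inner_add_left scaleR_add_left)
    then have L: "blinfun_apply (Blinfun l) = l" by (rule bounded_linear_Blinfun_apply)
    have lb: "l b = h b c" if "b \<in> I" for b
    proof -
      have "l b = (\<Sum>b'\<in>I. if b' = b then h b' c else 0)"
        unfolding l_def using that by (intro sum.cong refl) (auto simp: inner_Basis subsetD[OF I(1)])
      then show ?thesis using that finI by simp
    qed
    have l0: "l b = 0" if "b \<in> Basis - I" for b
      unfolding l_def using that by (intro sum.neutral) (auto simp: inner_Basis subsetD[OF I(1)])
    have hin: "b \<in> I1 \<Longrightarrow> h b \<in> E" "b \<in> I2 \<Longrightarrow> h b \<in> E'" for b
      using h h1 h2 by (auto simp: bij_betw_def)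
    have hT: "h b \<in> T" if "b \<in> I" for b
      using that hin[of b] sub V' W' I2(3) by blast
    have Gh: "G y (h b c) (h b' c) = g p (h b) (h b')" if "b \<in> I" "b' \<in> I" for b b'
      unfolding metric_eq_metric_coord[OF atlas ch, symmetric]
        tvec_of_eq[OF atlas ch hT[OF that(1)]] tvec_of_eq[OF atlas ch hT[OF that(2)]] ..
    have ghh: "g p (h b) (h b') = (if b = b' then 1 else 0)" if b: "b \<in> I" "b' \<in> I" for b b'
    proof -
      consider "b \<in> I1" "b' \<in> I1" | "b \<in> I2" "b' \<in> I2" | "b \<in> I1" "b' \<in> I2" | "b \<in> I2" "b' \<in> I1"
        using b I2(3) by blast
      then show ?thesis
      proof cases
        case 1
        then show ?thesis using on(1)[OF hin(1) hin(1)] bij_betw_imp_inj_on[OF h1] h(1) by (auto simp: inj_on_eq_iff)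
      next
        case 2
        then show ?thesis using on(2)[OF hin(2) hin(2)] bij_betw_imp_inj_on[OF h2] h(2) by (auto simp: inj_on_eq_iff)
      next
        case 3
        then have "g p (h b) (h b') = 0" using orth' hin sub by blast
        then show ?thesis using 3 I2(2) by auto
      next
        case 4
        then have "g p (h b') (h b) = 0" using orth' hin sub by blast
        then show ?thesis using 4 I2(2) commute[OF hT[OF b(1)] hT[OF b(2)]] by auto
      qed
    qed
    have "Blinfun l \<in> K"
      unfolding K_def mem_Collect_eq L I2(3) using l0 lb Gh ghh by simp
    moreover have "\<phi> (Blinfun l) = s"
    proof -
      have "\<phi> (Blinfun l) = (\<Sum>a\<in>I1. \<Sum>b\<in>I2. curv_form G y (h1 a c) (h2 b c))"
        unfolding \<phi>_def L using lb h I2(3) by (intro sum.cong refl) auto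
      also have "\<dots> = (\<Sum>a\<in>I1. \<Sum>v\<in>E'. curv_form G y (h1 a c) (v c))"
        by (intro sum.cong refl sum.reindex_bij_betw[OF h2])
      also have "\<dots> = (\<Sum>u\<in>E. \<Sum>v\<in>E'. curv_form G y (u c) (v c))"
        by (rule sum.reindex_bij_betw[OF h1])
      also have "\<dots> = s"
        unfolding s using orth' by (intro mutual_curvature_eq[OF E E' V'(2) W'(2), symmetric]) blast
      finally show ?thesis .
    qed
    ultimately show ?thesis by blast
  qed
  have P_K: "P (\<phi> L)" if L: "L \<in> K" for L
  proof -
    define t where "t b = tvec_of A c p (L b)" for b
    have tT: "t b \<in> T" for b unfolding t_def by (rule tvec_of_in[OF atlas ch])
    have tc: "t b c = L b" for b unfolding t_def by (rule tvec_of_component[OF atlas ch])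
    have gt: "g p (t b) (t b') = (if b = b' then 1 else 0)" if "b \<in> I" "b' \<in> I" for b b'
      using L that unfolding t_def metric_eq_metric_coord[OF atlas ch] K_def I2(3) by simp
    have tinj: "inj_on t I"
    proof (rule inj_onI)
      fix b b' assume "b \<in> I" "b' \<in> I" "t b = t b'"
      then show "b = b'" using gt[of b b] gt[of b b'] by (auto split: if_splits)
    qed
    have sp: "span (t ` X) \<subseteq> T" for X using tT subspace_T by (intro span_minimal) auto
    have E: "orthonormal_basis (g p) (span (t ` X)) (t ` X)" if "X \<subseteq> I" for X
      unfolding orthonormal_basis_def
    proof (intro conjI ballI)
      show "finite (t ` X)" using finite_subset[OF that finI] by simp
      show "t ` X \<subseteq> span (t ` X)" by (rule span_superset)
      fix u v assume "u \<in> t ` X" "v \<in> t ` X"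
      then obtain a b where ab: "u = t a" "v = t b" "a \<in> X" "b \<in> X"
        by (elim imageE) (rule that)
      then have "a \<in> I" "b \<in> I" using \<open>X \<subseteq> I\<close> by blast+
      then show "g p u v = (if u = v then 1 else 0)"
        using gt[of a b] inj_onD[OF tinj, of a b] unfolding ab(1,2) by auto
    qed simp
    have dimE: "dim (span (t ` X)) = card X" if "X \<subseteq> I" for X
      using onb_independent(2)[OF E[OF that] sp] card_image[OF inj_on_subset[OF tinj that]] by simp
    \<comment> \<open>Orthogonality of the generators extends to the spans one argument at a time,
      because an orthogonal complement is a subspace.\<close>
    have o: "g p v w = 0" if v: "v \<in> span (t ` I1)" and w: "w \<in> span (t ` I2)" for v w
    proof -
      have vT: "v \<in> T" "w \<in> T" using v w sp by blast+
      have "v \<in> {v \<in> T. \<forall>u\<in>t ` I2. g p u v = 0}"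
      proof (rule subsetD[OF span_minimal v])
        show "subspace {v \<in> T. \<forall>u\<in>t ` I2. g p u v = 0}" using tT by (intro subspace_complement) auto
        show "t ` I1 \<subseteq> {v \<in> T. \<forall>u\<in>t ` I2. g p u v = 0}" using tT gt I2 by fastforce
      qed
      then have v': "\<forall>u\<in>t ` I2. g p v u = 0" using tT commute[OF vT(1)] by auto
      have "w \<in> {w \<in> T. \<forall>u\<in>{v}. g p u w = 0}"
      proof (rule subsetD[OF span_minimal w])
        show "subspace {w \<in> T. \<forall>u\<in>{v}. g p u w = 0}" using vT by (intro subspace_complement) auto
        show "t ` I2 \<subseteq> {w \<in> T. \<forall>u\<in>{v}. g p u w = 0}" using tT v' by auto
      qed
      then show ?thesis by blast
    qed
    have "mutual_curvature A g p (span (t ` I1)) (span (t ` I2))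
      = (\<Sum>u\<in>t ` I1. \<Sum>v\<in>t ` I2. curv_form G y (u c) (v c))"
      using I1(1) I2(3) o by (intro mutual_curvature_eq E sp) auto
    also have "\<dots> = (\<Sum>a\<in>I1. \<Sum>v\<in>t ` I2. curv_form G y (t a c) (v c))"
      using inj_on_subset[OF tinj I1(1)] by (simp add: sum.reindex)
    also have "\<dots> = \<phi> L"
    proof -
      have "inj_on t I2" by (rule inj_on_subset[OF tinj]) (use I2(3) in blast)
      then show ?thesis unfolding \<phi>_def by (simp add: sum.reindex tc)
    qed
    finally have "\<phi> L = mutual_curvature A g p (span (t ` I1)) (span (t ` I2))" by simp
    moreover have "dim (span (t ` I1)) = dim V" "dim (span (t ` I2)) = dim W"
      using dimE[of I1] dimE[of I2] I1 I2 by auto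
    ultimately show ?thesis unfolding P_def using sp subspace_span o by metis
  qed
  \<comment> \<open>The given pair itself shows that the compact set is nonempty.\<close>
  have PV: "P (mutual_curvature A g p V W)" unfolding P_def using V W orth by blast
  then have "K \<noteq> {}" using in_K by blast
  then obtain L where L: "L \<in> K" "\<And>L'. L' \<in> K \<Longrightarrow> \<phi> L' \<le> \<phi> L"
    using coord.curv_form_sum_attains_max[OF y_in I12(1,2)] unfolding K_def[symmetric] \<phi>_def[symmetric] by blast
  have "(GREATEST s. P s) = \<phi> L"
    using P_K[OF L(1)] in_K L(2) by (intro Greatest_equality) auto
  moreover have "mutual_curvature A g p V W \<le> \<phi> L" using in_K[OF PV] L(2) by metis
  ultimately show ?thesis unfolding max_mutual_curvature_def P_def by simp
qed

end


section \<open>The inequality\<close>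

locale immersed_submanifold_at = immersed_submanifold A B gb f
  for A :: "('a::{t2_space,second_countable_topology}, 'e::euclidean_space) chart set"
    and B :: "('b::{t2_space,second_countable_topology}, 'f::euclidean_space) chart set"
    and gb f +
  fixes x :: 'a
  assumes x: "x \<in> manifold_carrier A"
begin

abbreviation "g \<equiv> induced_metric A B gb f"
abbreviation "c \<equiv> chart_at A x"
abbreviation "c' \<equiv> chart_at B (f x)"
abbreviation "y \<equiv> cmap c x"
abbreviation "T \<equiv> tangent_space A x"
abbreviation "df \<equiv> differential A B f x"
abbreviation "h \<equiv> second_fundamental_form A B gb f x"
abbreviation "H \<equiv> mean_curvature A B gb f x"

lemmas ch = chart_at[OF atlas_A x]
lemmas ch' = chart_at[OF atlas_B f_in[OF x]]

sublocale ambient: riemannian_manifold_at B gb "f x"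
  by unfold_locales (rule atlas_B metric_B f_in[OF x])+

sublocale coord: local_immersion "cran c'" "metric_coord B gb c'" "chart_dom c c'" "local_rep c c' f"
    "metric_coord A g c"
  by (rule local_immersion[OF ch(1) ch'(1)])

lemma y_in: "y \<in> chart_dom c c'"
  using ch ch' by blast

lemma local_rep_y: "local_rep c c' f y = cmap c' (f x)"
  by (simp add: local_rep_def cinv_cmap[OF atlas_A ch])

lemma linear_df: "linear df"
  by (rule linear_differential[OF x])

lemma df_in: "df v \<in> tangent_space B (f x)"
  by (rule differential_in[OF x])

lemma df_eq: "df v = tvec_of B c' (f x) (dderiv (local_rep c c' f) y (v c))"
  unfolding differential_def Let_def ..

lemma df_component: "df v c' = dderiv (local_rep c c' f) y (v c)"
  unfolding df_eq by (rule tvec_of_component[OF atlas_B ch'])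

lemma metric_tvec_of: "gb (f x) (tvec_of B c' (f x) a) (tvec_of B c' (f x) b)
    = metric_coord B gb c' (local_rep c c' f y) a b"
  unfolding local_rep_y by (rule metric_eq_metric_coord[OF atlas_B ch'])

lemma induced_eq: "g x u v = gb (f x) (df u) (df v)"
  unfolding induced_metric_def ..

text \<open>Positivity is where injectivity of the differential enters: a nonzero tangent vector has
  a nonzero image.\<close>

sublocale inner_product_on T "g x"
proof
  note sub = subspace_tangent_space[OF atlas_A ch]
  show "subspace T" by (rule sub)
  show "\<exists>S. finite S \<and> T \<subseteq> span S"
    using tangent_space_span[OF atlas_A ch] by (intro exI[of _ "tvec_of A c x ` Basis"]) simp
  show "bilinear_on T (g x)"
    unfolding bilinear_on_def induced_eq linear_add[OF linear_df] linear_scale[OF linear_df]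
    by (simp add: ambient.add ambient.scale df_in)
  show "g x u v = g x v u" for u v
    unfolding induced_eq by (rule ambient.commute[OF df_in df_in])
  fix u assume u: "u \<in> T" "u \<noteq> 0"
  have "df u \<noteq> df 0" using inj_onD[OF inj_differential[OF x], of u 0] u subspace_0[OF sub] by blast
  then show "g x u u > 0" unfolding induced_eq by (intro ambient.pos df_in) (simp add: linear_0[OF linear_df])
qed

text \<open>\<open>normal_part\<close> is a definite description. \<open>hess\<close> is
  \<open>II\<close> plus a tangential vector, so \<open>II\<close> is a candidate; the difference of
  two candidates is both normal and tangential, hence zero.\<close>

lemma h_eq: "h u v = tvec_of B c' (f x) (coord.II y (u c) (v c))"
proof -
  let ?t = "tvec_of A c x (levi_civita (metric_coord A g c) y (u c) (v c))"
  let ?n = "tvec_of B c' (f x) (coord.II y (u c) (v c))"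
  let ?w = "tvec_of B c' (f x) (coord.hess y (u c) (v c))"
  note lB = linear_tvec_of[OF atlas_B ch']
  have t: "?t \<in> T" by (rule tvec_of_in[OF atlas_A ch])
  have n: "?n \<in> tangent_space B (f x)" by (rule tvec_of_in[OF atlas_B ch'])
  have orth: "gb (f x) ?n (df z) = 0" for z
    unfolding df_eq metric_tvec_of by (rule coord.II_normal(1)[OF y_in])
  have w: "?w = df ?t + ?n"
    unfolding df_eq tvec_of_component[OF atlas_A ch] linear_add[OF lB, symmetric] coord.II_def by simp
  have "h u v = normal_part A B gb f x ?w"
    unfolding second_fundamental_form_def Let_def christoffel_eq_levi_civita coord.hess_def ..
  also have "\<dots> = ?n"
    unfolding normal_part_def
  proof (rule the_equality)
    show "?n \<in> tangent_space B (f x) \<and> (\<forall>u\<in>T. gb (f x) ?n (df u) = 0) \<and> (\<exists>t\<in>T. ?w = df t + ?n)"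
      using n orth t w by blast
    fix n'
    assume "n' \<in> tangent_space B (f x) \<and> (\<forall>u\<in>T. gb (f x) n' (df u) = 0) \<and> (\<exists>t\<in>T. ?w = df t + n')"
    then obtain t' where n': "n' \<in> tangent_space B (f x)" "\<And>u. u \<in> T \<Longrightarrow> gb (f x) n' (df u) = 0"
      and t': "t' \<in> T" "?w = df t' + n'" by blast
    have e: "n' - ?n = df (?t - t')"
      using w t'(2) unfolding linear_diff[OF linear_df] by (simp add: algebra_simps)
    have "?t - t' \<in> T" by (rule subspace_diff[OF subspace_T t t'(1)])
    then have "gb (f x) (n' - ?n) (df (?t - t')) = 0"
      using n'(2) orth by (simp add: ambient.diff(1)[OF n'(1) n df_in])
    then have "gb (f x) (n' - ?n) (n' - ?n) = 0" by (simp only: e)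
    then have "n' - ?n = 0"
      using ambient.eq_0_iff[OF subspace_diff[OF ambient.subspace_T n'(1) n]] by simp
    then show "n' = ?n" by simp
  qed
  finally show ?thesis .
qed

lemma h_in: "h u v \<in> tangent_space B (f x)"
  unfolding h_eq by (rule tvec_of_in[OF atlas_B ch'])

lemma bilinear_on_h: "bilinear_on V h"
proof -
  note b = coord.bilinear_II[OF y_in, unfolded bilinear_def]
  have "bilinear (\<lambda>a b. tvec_of B c' (f x) (coord.II y a b))"
    unfolding bilinear_def
    by (intro conjI allI linear_compose[OF _ linear_tvec_of[OF atlas_B ch'], unfolded o_def]
        b[THEN conjunct1, rule_format] b[THEN conjunct2, rule_format])
  from bilinear_on_component[OF this, of V c] show ?thesis unfolding h_eq[abs_def] .
qed

text \<open>The coordinate Gauss equation with third argument \<open>v\<close> and fourth argument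
  \<open>u\<close>; symmetry of \<open>II\<close> turns its last term into a square.\<close>

lemma gauss_sectional:
  assumes u: "u \<in> T" and on: "g x u u = 1" "g x v v = 1" "g x u v = 0"
  shows "sectional_curvature A g x u v =
     curv_form (metric_coord B gb c') (cmap c' (f x)) (df u c') (df v c')
       + gb (f x) (h u u) (h v v) - gb (f x) (h u v) (h u v)"
proof -
  have "gb (f x) (h u u) (h v v) = gb (f x) (h v v) (h u u)" by (rule ambient.commute[OF h_in h_in])
  then show ?thesis
    unfolding sectional_curvature_eq[where g = g and p = x, OF atlas_A x u on] curv_form_def coord.gauss_equation[OF y_in]
      df_component h_eq metric_tvec_of local_rep_y[symmetric]
    using coord.II_commute[OF y_in, of "v c" "u c"] by simp
qed

section \<open>The estimate for a subspace and its orthogonal complement\<close>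

context
  fixes V W
  assumes V: "subspace V" "V \<subseteq> T" and W_def: "W = orth_complement A g x V"
begin

lemma W_eq: "W = {v \<in> T. \<forall>u\<in>V. g x u v = 0}"
  unfolding W_def orth_complement_def ..

lemma W: "subspace W" "W \<subseteq> T"
  unfolding W_eq using subspace_complement[OF V(2)] by auto

lemma onb_V: "orthonormal_basis (g x) V (onb g x V)"
  by (rule onb[where T = T and g = g and p = x, OF inner_product_on_axioms V])

lemma onb_W: "orthonormal_basis (g x) W (onb g x W)"
  by (rule onb[where T = T and g = g and p = x, OF inner_product_on_axioms W])

text \<open>The two chosen bases together form an orthonormal basis of \<open>T\<close>, and the
  trace does not depend on the basis.\<close>

lemma mean_curvature_split: "H T = H V + H W"
proof -
  let ?E = "onb g x V" and ?E' = "onb g x W"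
  note un = onb_union[OF onb_V V(2) onb_W[unfolded W_eq], folded W_eq]
  have fin: "finite ?E" "finite ?E'" using onb_V onb_W unfolding orthonormal_basis_def by auto
  have T: "orthonormal_basis (g x) T (onb g x T)"
    by (rule onb[where T = T and g = g and p = x, OF inner_product_on_axioms subspace_T order_refl])
  have "H T = (\<Sum>e\<in>?E \<union> ?E'. h e e)"
    unfolding mean_curvature_def by (rule trace_independent[OF T un(1) order_refl bilinear_on_h])
  then show ?thesis unfolding mean_curvature_def by (simp add: sum.union_disjoint[OF fin un(2)])
qed

lemma dim_split: "dim V + dim W = DIM('e)"
proof -
  note un = onb_union[OF onb_V V(2) onb_W[unfolded W_eq], folded W_eq]
  have fin: "finite (onb g x V)" "finite (onb g x W)" using onb_V onb_W unfolding orthonormal_basis_def by auto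
  have "dim V + dim W = card (onb g x V \<union> onb g x W)"
    unfolding card_Un_disjoint[OF fin un(2)]
    using onb_independent(2)[OF onb_V V(2)] onb_independent(2)[OF onb_W W(2)] by simp
  also have "\<dots> = dim T" by (rule onb_independent(2)[OF un(1) order_refl])
  finally show ?thesis using dim_tangent_space[OF atlas_A ch] by simp
qed

text \<open>\<open>df\<close> preserves the metric by definition of the induced one, so it carries
  the two chosen bases to orthonormal bases of the images.\<close>

lemma mutual_curvature_ambient:
  "mutual_curvature B gb (f x) (df ` V) (df ` W) =
    (\<Sum>u\<in>onb g x V. \<Sum>v\<in>onb g x W. curv_form (metric_coord B gb c') (cmap c' (f x)) (df u c') (df v c'))"
proof -
  note im = orthonormal_basis_image[OF onb_V linear_df, of "gb (f x)", OF induced_eq[symmetric]]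
  note im' = orthonormal_basis_image[OF onb_W linear_df, of "gb (f x)", OF induced_eq[symmetric]]
  have sub: "df ` V \<subseteq> tangent_space B (f x)" "df ` W \<subseteq> tangent_space B (f x)"
    using df_in by auto
  have "gb (f x) v w = 0" if "v \<in> df ` V" "w \<in> df ` W" for v w
    using that by (auto simp: W_eq induced_eq)
  from ambient.mutual_curvature_eq[OF im(1) im'(1) sub this]
  show ?thesis by (simp add: sum.reindex[OF im(2)] sum.reindex[OF im'(2)])
qed

lemma mutual_curvature_split:
  "mutual_curvature A g x V W = mutual_curvature B gb (f x) (df ` V) (df ` W)
     + gb (f x) (H V) (H W) - (\<Sum>u\<in>onb g x V. \<Sum>v\<in>onb g x W. gb (f x) (h u v) (h u v))"
proof -
  let ?E = "onb g x V" and ?E' = "onb g x W"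
  have fin: "finite ?E" "finite ?E'" using onb_V onb_W unfolding orthonormal_basis_def by auto
  have HW: "H W \<in> tangent_space B (f x)"
    unfolding mean_curvature_def by (intro subspace_sum ambient.subspace_T h_in)
  have "gb (f x) (H V) (H W) = (\<Sum>u\<in>?E. gb (f x) (h u u) (H W))"
    using ambient.sum(1)[OF fin(1), of "\<lambda>e. h e e" "H W" "\<lambda>_. 1"] h_in HW
    by (simp add: mean_curvature_def)
  also have "\<dots> = (\<Sum>u\<in>?E. \<Sum>v\<in>?E'. gb (f x) (h u u) (h v v))"
    using ambient.sum(2)[OF fin(2), of "\<lambda>e. h e e" _ "\<lambda>_. 1"] h_in
    by (simp add: mean_curvature_def)
  finally have HH: "gb (f x) (H V) (H W) = (\<Sum>u\<in>?E. \<Sum>v\<in>?E'. gb (f x) (h u u) (h v v))" .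
  have "mutual_curvature A g x V W = (\<Sum>u\<in>?E. \<Sum>v\<in>?E'.
     curv_form (metric_coord B gb c') (cmap c' (f x)) (df u c') (df v c')
       + gb (f x) (h u u) (h v v) - gb (f x) (h u v) (h u v))"
    unfolding mutual_curvature_def
  proof (intro sum.cong refl gauss_sectional)
    fix u v assume u: "u \<in> ?E" and v: "v \<in> ?E'"
    have "u \<in> V" "v \<in> W" using u v onb_V onb_W unfolding orthonormal_basis_def by auto
    then show "u \<in> T" "g x u v = 0" using V unfolding W_eq by auto
    show "g x u u = 1" using onb_V u unfolding orthonormal_basis_def by auto
    show "g x v v = 1" using onb_W v unfolding orthonormal_basis_def by auto
  qed
  then show ?thesis unfolding mutual_curvature_ambient HH by (simp add: sum.distrib sum_subtractf)
qed

text \<open>A vanishing sum of squares makes \<open>h\<close> vanish on pairs from the two bases,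
  and bilinearity extends this to their spans.\<close>

lemma mixed_totally_geodesic_iff:
  "mixed_totally_geodesic_at A B gb f x V W \<longleftrightarrow>
    (\<Sum>u\<in>onb g x V. \<Sum>v\<in>onb g x W. gb (f x) (h u v) (h u v)) = 0"
proof -
  let ?E = "onb g x V" and ?E' = "onb g x W"
  have fin: "finite ?E" "finite ?E'" and sub: "?E \<subseteq> V" "?E' \<subseteq> W"
    using onb_V onb_W unfolding orthonormal_basis_def by auto
  have nn: "gb (f x) (h u v) (h u v) \<ge> 0" for u v by (rule ambient.nonneg[OF h_in])
  have "(\<Sum>u\<in>?E. \<Sum>v\<in>?E'. gb (f x) (h u v) (h u v)) = 0 \<longleftrightarrow> (\<forall>u\<in>?E. \<forall>v\<in>?E'. h u v = 0)"
    by (simp add: sum_nonneg_eq_0_iff fin nn sum_nonneg ambient.eq_0_iff[OF h_in])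
  also have "\<dots> \<longleftrightarrow> (\<forall>u\<in>V. \<forall>v\<in>W. h u v = 0)"
  proof
    assume 0: "\<forall>u\<in>?E. \<forall>v\<in>?E'. h u v = 0"
    show "\<forall>u\<in>V. \<forall>v\<in>W. h u v = 0"
    proof (intro ballI)
      fix u v assume u: "u \<in> V" and v: "v \<in> W"
      note s = bilinear_on_sum[OF subspace_UNIV bilinear_on_h]
      have "h e v = 0" if e: "e \<in> ?E" for e
      proof -
        have "h e v = h e (\<Sum>e'\<in>?E'. g x v e' *\<^sub>R e')" using onb_expansion[OF onb_W W(2) v] by simp
        also have "\<dots> = (\<Sum>e'\<in>?E'. g x v e' *\<^sub>R h e e')" by (rule s(2)[OF fin(2)]) auto
        finally show ?thesis using 0 e by simp
      qed
      moreover have "h u v = h (\<Sum>e\<in>?E. g x u e *\<^sub>R e) v" using onb_expansion[OF onb_V V(2) u] by simp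
      moreover have "\<dots> = (\<Sum>e\<in>?E. g x u e *\<^sub>R h e v)" by (rule s(1)[OF fin(1)]) auto
      ultimately show "h u v = 0" by simp
    qed
  qed (use sub in blast)
  finally show ?thesis unfolding mixed_totally_geodesic_at_def by blast
qed

lemma dim_df_image:
  assumes "subspace U" "U \<subseteq> T"
  shows "dim (df ` U) = dim U"
proof -
  obtain E where E: "orthonormal_basis (g x) U E" using onb_exists[OF assms] by blast
  note im = orthonormal_basis_image[OF E linear_df, of "gb (f x)", OF induced_eq[symmetric]]
  have "df ` U \<subseteq> tangent_space B (f x)" using df_in by auto
  then show ?thesis
    using ambient.onb_independent(2)[OF im(1)] onb_independent(2)[OF E assms(2)] card_image[OF im(2)] by simp
qed

text \<open>The derivative of the immersion is injective. Orthonormal families of the sizes of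
  \<open>V\<close> and \<open>W\<close> therefore fit together into the ambient tangent space, as
  \<open>mutual_curvature_le_max\<close> requires.\<close>

lemma dim_le: "DIM('e) \<le> DIM('f)"
proof -
  have l: "linear (dderiv (local_rep c c' f) y)" by (rule coord.linear_dF[OF y_in])
  have "inj (dderiv (local_rep c c' f) y)"
    using linear_injective_0[OF l] coord.inj[OF y_in] by blast
  from dim_image_eq[OF l, of UNIV] this
  have "DIM('e) = dim (range (dderiv (local_rep c c' f) y))" by simp
  also have "\<dots> \<le> DIM('f)" by (rule dim_subset_UNIV)
  finally show ?thesis .
qed

text \<open>The right side minus the left is the sum of three nonnegative terms:
  \<open>\<delta> - Sb\<close>, a quarter of the squared length of \<open>H V - H W\<close>, and
  \<open>N\<close>. Equality means that each of them vanishes, which gives the three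
  conditions.\<close>

lemma mutual_curvature_inequality:
  fixes S \<delta>
  defines "S \<equiv> mutual_curvature A g x V W"
    and "\<delta> \<equiv> max_mutual_curvature B gb (dim V) (dim W) (f x)"
  shows "S \<le> 1/4 * gb (f x) (H T) (H T) + \<delta>"
    and "S = 1/4 * gb (f x) (H T) (H T) + \<delta> \<longleftrightarrow>
      mixed_totally_geodesic_at A B gb f x V W \<and> H V = H W \<and>
      mutual_curvature B gb (f x) (df ` V) (df ` W) = \<delta>"
proof -
  define N where "N = (\<Sum>u\<in>onb g x V. \<Sum>v\<in>onb g x W. gb (f x) (h u v) (h u v))"
  define Sb where "Sb = mutual_curvature B gb (f x) (df ` V) (df ` W)"
  have Hin: "H U \<in> tangent_space B (f x)" for U
    unfolding mean_curvature_def by (intro subspace_sum ambient.subspace_T h_in)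
  have din: "H V - H W \<in> tangent_space B (f x)"
    by (rule subspace_diff[OF ambient.subspace_T Hin Hin])
  have sin: "H V + H W \<in> tangent_space B (f x)"
    by (rule subspace_add[OF ambient.subspace_T Hin Hin])
  have polar: "gb (f x) (H V) (H W) = 1/4 * gb (f x) (H T) (H T) - 1/4 * gb (f x) (H V - H W) (H V - H W)"
    unfolding mean_curvature_split
    using ambient.commute[OF Hin Hin, of V W]
    by (simp add: ambient.add[OF Hin Hin sin] ambient.add[OF Hin Hin Hin]
        ambient.diff[OF Hin Hin din] ambient.diff[OF Hin Hin Hin] field_simps)
  have S: "S = Sb + 1/4 * gb (f x) (H T) (H T) - 1/4 * gb (f x) (H V - H W) (H V - H W) - N"
    unfolding S_def mutual_curvature_split polar Sb_def N_def by simp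
  have orth: "\<forall>v\<in>df ` V. \<forall>w\<in>df ` W. gb (f x) v w = 0"
    by (auto simp: W_eq induced_eq)
  have sub: "subspace (df ` V)" "subspace (df ` W)" "df ` V \<subseteq> tangent_space B (f x)" "df ` W \<subseteq> tangent_space B (f x)"
    using linear_subspace_image[OF linear_df] V(1) W(1) df_in by auto
  have max: "Sb \<le> \<delta>"
    using ambient.mutual_curvature_le_max[OF sub(1,3,2,4) orth] dim_split dim_le
    unfolding Sb_def \<delta>_def by (simp add: dim_df_image V W)
  have N: "N \<ge> 0" unfolding N_def by (intro sum_nonneg ambient.nonneg[OF h_in])
  have d: "gb (f x) (H V - H W) (H V - H W) \<ge> 0" by (rule ambient.nonneg[OF din])
  show "S \<le> 1/4 * gb (f x) (H T) (H T) + \<delta>" using S max N d by linarith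
  have "S = 1/4 * gb (f x) (H T) (H T) + \<delta> \<longleftrightarrow> N = 0 \<and> gb (f x) (H V - H W) (H V - H W) = 0 \<and> Sb = \<delta>"
    using S max N d by linarith
  then show "S = 1/4 * gb (f x) (H T) (H T) + \<delta> \<longleftrightarrow>
      mixed_totally_geodesic_at A B gb f x V W \<and> H V = H W \<and>
      mutual_curvature B gb (f x) (df ` V) (df ` W) = \<delta>"
    unfolding ambient.eq_0_iff[OF din] mixed_totally_geodesic_iff N_def Sb_def by simp
qed

end

text \<open>\<open>J\<close> is linear on tangent vectors only, but every vector it meets here is an
  image under \<open>df\<close>. Sums and multiples of the witnesses for \<open>u\<close> and
  \<open>v\<close> are then witnesses for their sums and multiples.\<close>

lemma subspace_cr_distribution:
  assumes J: "almost_hermitian B J gb"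
  shows "subspace (cr_distribution A B J f x)"
proof -
  have J1: "J (f x) (u + v) = J (f x) u + J (f x) v" "J (f x) (r *\<^sub>R u) = r *\<^sub>R J (f x) u"
    if "u \<in> tangent_space B (f x)" "v \<in> tangent_space B (f x)" for u v r
    using J f_in[OF x] that unfolding almost_hermitian_def by blast+
  have J: "J (f x) (df u + df v) = J (f x) (df u) + J (f x) (df v)"
    "J (f x) (r *\<^sub>R df u) = r *\<^sub>R J (f x) (df u)" for u v r
    using J1[OF df_in df_in] by blast+
  show ?thesis
  proof (rule subspaceI)
    \<comment> \<open>Homogeneity with factor 0.\<close>
    have "J (f x) 0 = 0" using J(2)[of 0 0] by simp
    then have "df 0 = J (f x) (df 0)" by (simp add: linear_0[OF linear_df])
    then show "0 \<in> cr_distribution A B J f x"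
      unfolding cr_distribution_def using subspace_0[OF subspace_T] by blast
  next
    fix u v assume "u \<in> cr_distribution A B J f x" "v \<in> cr_distribution A B J f x"
    then obtain s t where uv: "u \<in> T" "v \<in> T" and s: "s \<in> T" "df u = J (f x) (df s)"
      and t: "t \<in> T" "df v = J (f x) (df t)"
      unfolding cr_distribution_def by blast
    have "df (u + v) = J (f x) (df (s + t))" by (simp add: linear_add[OF linear_df] J s t)
    then show "u + v \<in> cr_distribution A B J f x"
      unfolding cr_distribution_def
      using subspace_add[OF subspace_T uv] subspace_add[OF subspace_T s(1) t(1)] by blast
  next
    fix r u assume "u \<in> cr_distribution A B J f x"
    then obtain s where u: "u \<in> T" and s: "s \<in> T" "df u = J (f x) (df s)"
      unfolding cr_distribution_def by blast
    have "df (r *\<^sub>R u) = J (f x) (df (r *\<^sub>R s))" by (simp add: linear_scale[OF linear_df] J s)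
    then show "r *\<^sub>R u \<in> cr_distribution A B J f x"
      unfolding cr_distribution_def
      using subspace_scale[OF subspace_T u] subspace_scale[OF subspace_T s(1)] by blast
  qed
qed

end

theorem theorem4:
  fixes A :: "('a::{t2_space,second_countable_topology}, 'e::euclidean_space) chart set"
    and B :: "('b::{t2_space,second_countable_topology}, 'f::euclidean_space) chart set"
    and J :: "'b \<Rightarrow> ('b, 'f) tvec \<Rightarrow> ('b, 'f) tvec"
    and gb :: "('b, 'f) metric"
    and g :: "('a, 'e) metric"
    and f :: "'a \<Rightarrow> 'b"
    and d l :: nat
    and D D_perp :: "'a \<Rightarrow> ('a, 'e) tvec set"
    and H :: "'a \<Rightarrow> ('a, 'e) tvec set \<Rightarrow> ('b, 'f) tvec"
  assumes "almost_hermitian B J gb"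
    and "CR_submanifold A B J f d l"
  defines "g \<equiv> induced_metric A B gb f"
    and "D \<equiv> cr_distribution A B J f"
    and "D_perp \<equiv> \<lambda>x. orth_complement A g x (D x)"
    and "H \<equiv> mean_curvature A B gb f"
  shows "\<forall>x\<in>manifold_carrier A.
    mutual_curvature A g x (D x) (D_perp x)
      \<le> 1/4 * gb (f x) (H x (tangent_space A x)) (H x (tangent_space A x))
         + max_mutual_curvature B gb d l (f x) \<and>
    (mutual_curvature A g x (D x) (D_perp x)
      = 1/4 * gb (f x) (H x (tangent_space A x)) (H x (tangent_space A x))
         + max_mutual_curvature B gb d l (f x)
     \<longleftrightarrow>
       mixed_totally_geodesic_at A B gb f x (D x) (D_perp x) \<and>
       H x (D x) = H x (D_perp x) \<and>
       mutual_curvature B gb (f x) (differential A B f x ` D x) (differential A B f x ` D_perp x)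
         = max_mutual_curvature B gb d l (f x))"
proof
  fix x assume x: "x \<in> manifold_carrier A"
  interpret immersed_submanifold_at A B gb f x
    using assms(1,2) x unfolding almost_hermitian_def CR_submanifold_def by unfold_locales blast+
  have DT: "subspace (D x)" "D x \<subseteq> tangent_space A x"
    unfolding D_def using subspace_cr_distribution[OF assms(1)] by (auto simp: cr_distribution_def)
  have dim: "dim (D x) = d" "DIM('e) = d + l"
    using assms(2) x unfolding CR_submanifold_def D_def by blast+
  \<comment> \<open>The complement takes up the remaining dimension, so the ambient maximum for the
    dimensions of the two spaces is the one for \<open>d\<close> and \<open>l\<close>.\<close>
  then have diml: "dim (D_perp x) = l"
    using dim_split[OF DT refl] unfolding D_perp_def g_def by simp
  show "mutual_curvature A g x (D x) (D_perp x)
      \<le> 1/4 * gb (f x) (H x (tangent_space A x)) (H x (tangent_space A x))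
         + max_mutual_curvature B gb d l (f x) \<and>
    (mutual_curvature A g x (D x) (D_perp x)
      = 1/4 * gb (f x) (H x (tangent_space A x)) (H x (tangent_space A x))
         + max_mutual_curvature B gb d l (f x)
     \<longleftrightarrow>
       mixed_totally_geodesic_at A B gb f x (D x) (D_perp x) \<and>
       H x (D x) = H x (D_perp x) \<and>
       mutual_curvature B gb (f x) (differential A B f x ` D x) (differential A B f x ` D_perp x)
         = max_mutual_curvature B gb d l (f x))"
    using mutual_curvature_inequality[OF DT refl] dim(1) diml
    unfolding D_perp_def g_def H_def by simp
qed

end
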